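(* Let $(\mathcal{X},d)$ be a countable metric space, $p\ge1$, $x_0\in\mathcal{X}$, let $X_1,\dots,X_n\sim\mathbf r$ be i.i.d. with values in $\mathcal{X}$, and let $\hat{\mathbf r}_n$ be the empirical measure. Then $$\sqrt n\,(\hat{\mathbf r}_n-\mathbf r)\ \xrightarrow{\mathscr{D}}\ \mathbf G$$ with respect to the $\|\cdot\|_{\ell^1(d^p)}$-norm, where $\mathbf G$ is a Gaussian process with mean $0$ and covariance structure $$\Sigma(\mathbf r)_{x,x'}=\begin{cases}r_x(1-r_x)&\text{if }x=x',\\-r_xr_{x'}&\text{if }x\neq x',\end{cases}$$ if and only if $$\sum_{x\in\mathcal{X}}d^p(x,x_0)\sqrt{r_x}<\infty .$$
   Context: Probability measures on $\mathcal{X}$ are vectors $\mathbf r=(r_x)_{x\in\mathcal{X}}$ with $r_x\ge0$, $\sum_x r_x=1$. The empirical measure is $\hat{\mathbf r}_n=(\hat r_{n,x})_{x\in\mathcal{X}}$ with $\hat r_{n,x}=\frac1n\sum_{k=1}^n\mathbf 1_{\{X_k=x\}}$. The weighted norm is $\|a\|_{\ell^1(d^p)}=\sum_{x\in\mathcal{X}}d^p(x,x_0)|a_x|+|a_{x_0}|$, and $\ell^1_{d^p}(\mathcal{X})$ is the space of $a\in\mathbb{R}^{\mathcal{X}}$ with finite norm. The convergence $\xrightarrow{\mathscr{D}}$ is weak convergence of random elements of $\ell^1_{d^p}(\mathcal{X})$. *)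

theory Defs
  imports "HOL-Probability.Probability"
begin

section \<open>The weighted space \<open>\<ell>\<^sup>1(d\<^sup>p)\<close>\<close>

definition wl1_space :: "real \<Rightarrow> 'a::metric_space \<Rightarrow> ('a \<Rightarrow> real) set" where
  "wl1_space p x0 = {a. (\<lambda>x. dist x x0 powr p * \<bar>a x\<bar>) summable_on UNIV}"

text \<open>\<^const>\<open>infsum\<close> is \<open>0\<close> on non-summable families, so the following is the norm only on
  \<^const>\<open>wl1_space\<close>.\<close>

definition wl1_norm :: "real \<Rightarrow> 'a::metric_space \<Rightarrow> ('a \<Rightarrow> real) \<Rightarrow> real" where
  "wl1_norm p x0 a = (\<Sum>\<^sub>\<infinity>x. dist x x0 powr p * \<bar>a x\<bar>) + \<bar>a x0\<bar>"

definition wl1_dist :: "real \<Rightarrow> 'a::metric_space \<Rightarrow> ('a \<Rightarrow> real) \<Rightarrow> ('a \<Rightarrow> real) \<Rightarrow> real" where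
  "wl1_dist p x0 a b = wl1_norm p x0 (\<lambda>x. a x - b x)"

definition wl1_topology :: "real \<Rightarrow> 'a::metric_space \<Rightarrow> ('a \<Rightarrow> real) topology" where
  "wl1_topology p x0 = Metric_space.mtopology (wl1_space p x0) (wl1_dist p x0)"

lemma wl1_space_diff:
  assumes "a \<in> wl1_space p x0" "b \<in> wl1_space p x0"
  shows "(\<lambda>x. a x - b x) \<in> wl1_space p x0"
proof -
  have "(\<lambda>x. dist x x0 powr p * \<bar>a x\<bar> + dist x x0 powr p * \<bar>b x\<bar>) summable_on UNIV"
    using assms by (auto simp: wl1_space_def intro!: summable_on_add)
  then have "(\<lambda>x. dist x x0 powr p * \<bar>a x - b x\<bar>) summable_on UNIV"
  proof (rule summable_on_comparison_test)
    fix x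
    show "dist x x0 powr p * \<bar>a x - b x\<bar> \<le> dist x x0 powr p * \<bar>a x\<bar> + dist x x0 powr p * \<bar>b x\<bar>"
      by (metis abs_triangle_ineq4 distrib_left mult_left_mono powr_ge_zero)
  qed auto
  then show ?thesis by (simp add: wl1_space_def)
qed

lemma Metric_space_wl1: "Metric_space (wl1_space p x0) (wl1_dist p x0)"
proof
  fix a b c :: "'a \<Rightarrow> real"
  show "0 \<le> wl1_dist p x0 a b"
    by (auto simp: wl1_dist_def wl1_norm_def intro!: add_nonneg_nonneg infsum_nonneg)
  show "wl1_dist p x0 a b = wl1_dist p x0 b a"
    by (simp add: wl1_dist_def wl1_norm_def abs_minus_commute)
  assume a: "a \<in> wl1_space p x0" and b: "b \<in> wl1_space p x0"
  have ab: "(\<lambda>x. dist x x0 powr p * \<bar>a x - b x\<bar>) summable_on UNIV"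
    using wl1_space_diff[OF a b] by (simp add: wl1_space_def)
  show "wl1_dist p x0 a b = 0 \<longleftrightarrow> a = b"
  proof
    assume "wl1_dist p x0 a b = 0"
    moreover have n: "0 \<le> (\<Sum>\<^sub>\<infinity>x. dist x x0 powr p * \<bar>a x - b x\<bar>)"
      by (intro infsum_nonneg) auto
    ultimately have s: "(\<Sum>\<^sub>\<infinity>x. dist x x0 powr p * \<bar>a x - b x\<bar>) = 0" and x0: "a x0 = b x0"
      by (auto simp: wl1_dist_def wl1_norm_def)
    have "a x = b x" for x
    proof (cases "x = x0")
      case False
      have "dist x x0 powr p * \<bar>a x - b x\<bar> = 0"
        by (rule nonneg_infsum_le_0D[OF _ ab]) (auto simp: s)
      with False show ?thesis by simp
    qed (use x0 in simp)
    then show "a = b" by blast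
  qed (simp add: wl1_dist_def wl1_norm_def)
  assume c: "c \<in> wl1_space p x0"
  have bc: "(\<lambda>x. dist x x0 powr p * \<bar>b x - c x\<bar>) summable_on UNIV"
    and ac: "(\<lambda>x. dist x x0 powr p * \<bar>a x - c x\<bar>) summable_on UNIV"
    using wl1_space_diff[OF b c] wl1_space_diff[OF a c] by (simp_all add: wl1_space_def)
  have "(\<Sum>\<^sub>\<infinity>x. dist x x0 powr p * \<bar>a x - c x\<bar>)
      \<le> (\<Sum>\<^sub>\<infinity>x. dist x x0 powr p * \<bar>a x - b x\<bar> + dist x x0 powr p * \<bar>b x - c x\<bar>)"
  proof (intro infsum_mono ac summable_on_add ab bc)
    fix x
    have "\<bar>a x - c x\<bar> \<le> \<bar>a x - b x\<bar> + \<bar>b x - c x\<bar>" by simp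
    then show "dist x x0 powr p * \<bar>a x - c x\<bar>
        \<le> dist x x0 powr p * \<bar>a x - b x\<bar> + dist x x0 powr p * \<bar>b x - c x\<bar>"
      by (metis distrib_left mult_left_mono powr_ge_zero)
  qed
  also have "\<dots> = (\<Sum>\<^sub>\<infinity>x. dist x x0 powr p * \<bar>a x - b x\<bar>) + (\<Sum>\<^sub>\<infinity>x. dist x x0 powr p * \<bar>b x - c x\<bar>)"
    by (rule infsum_add[OF ab bc])
  finally show "wl1_dist p x0 a c \<le> wl1_dist p x0 a b + wl1_dist p x0 b c"
    by (simp add: wl1_dist_def wl1_norm_def)
qed


section \<open>Weak convergence of random elements of a topological space\<close>

definition borel_of :: "'b topology \<Rightarrow> 'b measure" where
  "borel_of T = sigma (topspace T) {U. openin T U}"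

text \<open>Measurability includes that all values lie in \<^term>\<open>topspace T\<close>.\<close>

definition random_element :: "'b topology \<Rightarrow> 'm measure \<Rightarrow> ('m \<Rightarrow> 'b) \<Rightarrow> bool" where
  "random_element T M Y \<longleftrightarrow> prob_space M \<and> Y \<in> M \<rightarrow>\<^sub>M borel_of T"

definition converges_in_distribution ::
  "'b topology \<Rightarrow> 'm measure \<Rightarrow> (nat \<Rightarrow> 'm \<Rightarrow> 'b) \<Rightarrow> 'k measure \<Rightarrow> ('k \<Rightarrow> 'b) \<Rightarrow> bool" where
  "converges_in_distribution T M Y N Z \<longleftrightarrow>
     (\<forall>n. random_element T M (Y n)) \<and> random_element T N Z \<and>
     (\<forall>f::'b \<Rightarrow> real. continuous_map T euclideanreal f \<and> bounded (f ` topspace T) \<longrightarrow>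
        (\<lambda>n. \<integral>\<omega>. f (Y n \<omega>) \<partial>M) \<longlonglongrightarrow> (\<integral>\<omega>. f (Z \<omega>) \<partial>N))"


section \<open>Gaussian processes\<close>

definition normal_law :: "real \<Rightarrow> real \<Rightarrow> real measure" where
  "normal_law \<mu> \<sigma> =
     (if \<sigma> = 0 then return borel \<mu> else density lborel (\<lambda>x. ennreal (normal_density \<mu> \<sigma> x)))"

text \<open>The process is Gaussian if all finite linear combinations are normal, where degenerate normal
  laws are allowed (the covariance structure of interest is singular). The expectations below exist
  because the coordinates are then normally distributed.\<close>

definition gaussian_process ::
  "'k measure \<Rightarrow> ('k \<Rightarrow> 'a \<Rightarrow> real) \<Rightarrow> ('a \<Rightarrow> real) \<Rightarrow> ('a \<Rightarrow> 'a \<Rightarrow> real) \<Rightarrow> bool" where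
  "gaussian_process N G m S \<longleftrightarrow>
     prob_space N \<and>
     (\<forall>x. (\<lambda>\<omega>. G \<omega> x) \<in> borel_measurable N) \<and>
     (\<forall>F c. finite F \<longrightarrow>
        (\<exists>\<mu> \<sigma>. \<sigma> \<ge> 0 \<and> distr N borel (\<lambda>\<omega>. \<Sum>x\<in>F. c x * G \<omega> x) = normal_law \<mu> \<sigma>)) \<and>
     (\<forall>x. (\<integral>\<omega>. G \<omega> x \<partial>N) = m x) \<and>
     (\<forall>x x'. (\<integral>\<omega>. (G \<omega> x - m x) * (G \<omega> x' - m x') \<partial>N) = S x x')"

definition multinomial_cov :: "'a pmf \<Rightarrow> 'a \<Rightarrow> 'a \<Rightarrow> real" where
  "multinomial_cov r x x' =
     (if x = x' then pmf r x * (1 - pmf r x) else - pmf r x * pmf r x')"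


section \<open>The empirical measure\<close>

definition empirical_measure :: "(nat \<Rightarrow> 'm \<Rightarrow> 'a) \<Rightarrow> nat \<Rightarrow> 'm \<Rightarrow> 'a \<Rightarrow> real" where
  "empirical_measure X n \<omega> x = 1 / real n * (\<Sum>k=1..n. of_bool (X k \<omega> = x))"

end

(* Only the Gaussian limit matters for necessity: if G lies in the weighted space, then with
   s x = sqrt (r x (1 - r x)) the bound |G x| <= b/4 * (G x)^2 / s x + (s x / b) * 1_B, where B is the
   event that the norm of G exceeds a large level, shows that the partial sums of
   E (sum w x |G x|) = sqrt (2/pi) * sum w x s x stay bounded.

   For sufficiency the limit is constructed from i.i.d. standard normal variables as the increments of
   a Brownian bridge. Both the fluctuations and the limit have first absolute coordinate moments at
   most sqrt (r x), so for a Lipschitz test function all but finitely many coordinates can be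
   discarded uniformly in n. The remaining finite-dimensional convergence follows from the
   one-dimensional central limit theorem for linear combinations, by tilting the laws coordinate by
   coordinate and applying Stone-Weierstrass. *)

theory Submission
  imports Defs
begin

section \<open>Bounded Lipschitz test functions\<close>

text \<open>Two obstacles shape the proof. For necessity, the norm of \<open>G\<close> is not known
  to be integrable, so the expectation of the infinite weighted sum cannot simply be taken. The
  split over \<open>B\<close> replaces an integrability theorem: it bounds a finite partial sum by a
  constant plus a small multiple of the same partial sum, and that multiple is absorbed.

  For sufficiency, the covariance is singular on infinitely many coordinates. The formula
  \<open>sqrt (r x) * \<xi> x - r x * (\<Sum>y. sqrt (r y) * \<xi> y)\<close> needs a convergent
  random series, whereas bridge increments are triangular in the noise, so that each coordinate is a
  finite sum. Joint convergence rests on the one-dimensional continuity theorem alone: a bounded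
  positive weight under the integral can be normalised to a density, so one coordinate can be
  treated under laws that already carry a function of the others. The bound
  \<open>sqrt (r x)\<close> is free of \<open>n\<close> because the factor \<open>sqrt n\<close>
  exactly compensates the averaging of independent terms; it makes the summability condition a
  uniform tail bound.\<close>

lemma space_borel_of [simp]: "space (borel_of T) = topspace T"
  by (simp add: borel_of_def space_measure_of_conv)

lemma sets_borel_of: "sets (borel_of T) = sigma_sets (topspace T) {U. openin T U}"
  unfolding borel_of_def by (rule sets_measure_of) (auto dest: openin_subset)

lemma continuous_map_borel_of:
  assumes "continuous_map T euclideanreal f"
  shows "f \<in> borel_measurable (borel_of T)"
proof (rule borel_measurableI)
  fix S :: "real set" assume "open S"
  then have "openin T {x \<in> topspace T. f x \<in> S}"
    using assms by (simp add: openin_continuous_map_preimage)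
  moreover have "f -` S \<inter> space (borel_of T) = {x \<in> topspace T. f x \<in> S}" by auto
  ultimately show "f -` S \<inter> space (borel_of T) \<in> sets (borel_of T)"
    by (auto simp: sets_borel_of)
qed

context Metric_space
begin

lemma continuous_map_real_iff:
  "continuous_map mtopology euclideanreal f \<longleftrightarrow>
     (\<forall>a\<in>M. \<forall>\<epsilon>>0. \<exists>\<delta>>0. \<forall>x. x \<in> M \<and> d a x < \<delta> \<longrightarrow> \<bar>f x - f a\<bar> < \<epsilon>)"
  for f :: "'a \<Rightarrow> real"
  using metric_continuous_map[OF Met_TC.Metric_space_axioms, of f]
  by (simp add: dist_real_def abs_minus_commute)

lemma Lipschitz_continuous_map_real:
  fixes f :: "'a \<Rightarrow> real"
  assumes "\<And>x y. x \<in> M \<Longrightarrow> y \<in> M \<Longrightarrow> \<bar>f x - f y\<bar> \<le> L * d x y" "L \<ge> 0"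
  shows "continuous_map mtopology euclideanreal f"
  unfolding continuous_map_real_iff
proof (intro ballI allI impI)
  fix a and \<epsilon> :: real assume a: "a \<in> M" and \<epsilon>: "\<epsilon> > 0"
  show "\<exists>\<delta>>0. \<forall>x. x \<in> M \<and> d a x < \<delta> \<longrightarrow> \<bar>f x - f a\<bar> < \<epsilon>"
  proof (intro exI[of _ "\<epsilon> / (L + 1)"] conjI allI impI)
    show "\<epsilon> / (L + 1) > 0" using \<epsilon> assms(2) by simp
    fix x assume x: "x \<in> M \<and> d a x < \<epsilon> / (L + 1)"
    then have "\<bar>f x - f a\<bar> \<le> L * d a x" using assms(1)[of x a] a by (simp add: commute)
    also have "\<dots> \<le> (L + 1) * d a x" by (simp add: algebra_simps)
    also have "\<dots> < \<epsilon>" using x assms(2) by (simp add: field_simps)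
    finally show "\<bar>f x - f a\<bar> < \<epsilon>" .
  qed
qed

text \<open>The Pasch-Hausdorff regularisation: for \<open>f\<close> bounded below on
  \<open>M\<close> and \<open>k \<ge> 0\<close> it is the largest \<open>k\<close>-Lipschitz
  minorant of \<open>f\<close> on \<open>M\<close>. An infimum of reals is meaningful only with a
  lower bound, hence \<open>- C \<le> f y\<close> in the lemmas on it.\<close>

definition lower_envelope :: "('a \<Rightarrow> real) \<Rightarrow> real \<Rightarrow> 'a \<Rightarrow> real" where
  "lower_envelope f k x = (INF y\<in>M. f y + k * d x y)"

lemma lower_envelope_bdd:
  assumes "\<And>y. y \<in> M \<Longrightarrow> - C \<le> f y" "k \<ge> 0"
  shows "bdd_below ((\<lambda>y. f y + k * d x y) ` M)"
proof (rule bdd_belowI2[of _ "- C"])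
  fix y assume "y \<in> M"
  moreover have "0 \<le> k * d x y" using assms(2) by simp
  ultimately show "- C \<le> f y + k * d x y" using assms(1)[of y] by linarith
qed

lemma lower_envelope_le:
  assumes "\<And>y. y \<in> M \<Longrightarrow> - C \<le> f y" "k \<ge> 0" "x \<in> M"
  shows "lower_envelope f k x \<le> f x"
  unfolding lower_envelope_def
  using cINF_lower[OF lower_envelope_bdd[OF assms(1,2), where x = x] assms(3)] assms(3) by simp

lemma lower_envelope_ge:
  assumes "\<And>y. y \<in> M \<Longrightarrow> - C \<le> f y" "k \<ge> 0" "x \<in> M"
  shows "- C \<le> lower_envelope f k x"
  unfolding lower_envelope_def
proof (rule cINF_greatest)
  fix y assume "y \<in> M"
  moreover have "0 \<le> k * d x y" using assms(2) by simp
  ultimately show "- C \<le> f y + k * d x y" using assms(1)[of y] by linarith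
qed (use assms(3) in auto)

lemma lower_envelope_Lipschitz:
  assumes "\<And>y. y \<in> M \<Longrightarrow> - C \<le> f y" "k \<ge> 0" "x \<in> M" "x' \<in> M"
  shows "\<bar>lower_envelope f k x - lower_envelope f k x'\<bar> \<le> k * d x x'"
proof -
  have *: "lower_envelope f k u \<le> lower_envelope f k v + k * d u v" if u: "u \<in> M" and v: "v \<in> M" for u v
  proof -
    have "lower_envelope f k u - k * d u v \<le> (INF y\<in>M. f y + k * d v y)"
    proof (rule cINF_greatest)
      fix y assume y: "y \<in> M"
      have "lower_envelope f k u \<le> f y + k * d u y"
        unfolding lower_envelope_def by (rule cINF_lower[OF lower_envelope_bdd[OF assms(1,2)] y])
      moreover have "k * d u y \<le> k * (d u v + d v y)"
        using triangle[OF u v y] assms(2) by (rule mult_left_mono)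
      ultimately show "lower_envelope f k u - k * d u v \<le> f y + k * d v y"
        by (simp add: algebra_simps)
    qed (use v in auto)
    then show ?thesis by (simp add: lower_envelope_def)
  qed
  show ?thesis using *[OF assms(3,4)] *[OF assms(4,3)] by (simp add: commute abs_le_iff)
qed

text \<open>A point outside the ball of radius \<open>\<delta>\<close> pays at least
  \<open>k * \<delta>\<close>, which for large \<open>k\<close> exceeds the oscillation
  \<open>2 * C\<close>; inside the ball continuity controls \<open>f\<close>.\<close>

lemma lower_envelope_tendsto:
  assumes f: "continuous_map mtopology euclideanreal f" "\<And>y. y \<in> M \<Longrightarrow> \<bar>f y\<bar> \<le> C" and x: "x \<in> M"
  shows "(\<lambda>k. lower_envelope f (real k) x) \<longlonglongrightarrow> f x"
proof (rule LIMSEQ_I)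
  fix \<epsilon> :: real assume \<epsilon>: "\<epsilon> > 0"
  have lb: "- C \<le> f y" if "y \<in> M" for y using f(2)[OF that] by linarith
  have C: "C \<ge> 0" using f(2)[OF x] by linarith
  obtain \<delta> where \<delta>: "\<delta> > 0" "\<And>y. y \<in> M \<Longrightarrow> d x y < \<delta> \<Longrightarrow> \<bar>f y - f x\<bar> < \<epsilon> / 2"
    using f(1) x \<epsilon> unfolding continuous_map_real_iff by (meson half_gt_zero)
  obtain K :: nat where K: "real K > 2 * C / \<delta>" using reals_Archimedean2 by blast
  show "\<exists>no. \<forall>k\<ge>no. norm (lower_envelope f (real k) x - f x) < \<epsilon>"
  proof (intro exI[of _ K] allI impI)
    fix k assume k: "K \<le> k"
    have "f x - \<epsilon> / 2 \<le> lower_envelope f (real k) x"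
      unfolding lower_envelope_def
    proof (rule cINF_greatest)
      fix y assume y: "y \<in> M"
      show "f x - \<epsilon> / 2 \<le> f y + real k * d x y"
      proof (cases "d x y < \<delta>")
        case True
        have "0 \<le> real k * d x y" by simp
        then show ?thesis using \<delta>(2)[OF y True] by linarith
      next
        case False
        have "2 * C < real K * \<delta>" using K \<delta>(1) by (simp add: field_simps)
        also have "\<dots> \<le> real k * d x y"
          using False k \<delta>(1) by (intro mult_mono) auto
        finally show ?thesis using f(2)[OF x] f(2)[OF y] \<epsilon> by linarith
      qed
    qed (use x in auto)
    moreover have "lower_envelope f (real k) x \<le> f x"
      by (rule lower_envelope_le[OF lb _ x]) auto
    ultimately show "norm (lower_envelope f (real k) x - f x) < \<epsilon>" using \<epsilon> by simp
  qed
qed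

text \<open>The Lipschitz functions \<^term>\<open>lower_envelope f k\<close> increase to \<^term>\<open>f\<close>, which gives the lower
  half of the convergence; the upper half is the lower half for \<^term>\<open>- f\<close>.\<close>

lemma expectation_tendsto_if_Lipschitz:
  fixes f :: "'a \<Rightarrow> real"
  assumes P: "prob_space P" and Q: "prob_space Q"
    and Y: "\<And>n. Y n \<in> P \<rightarrow>\<^sub>M borel_of mtopology" and Z: "Z \<in> Q \<rightarrow>\<^sub>M borel_of mtopology"
    and lip: "\<And>g L C. L \<ge> 0 \<Longrightarrow> (\<And>x y. x \<in> M \<Longrightarrow> y \<in> M \<Longrightarrow> \<bar>g x - g y\<bar> \<le> L * d x y) \<Longrightarrow>
       (\<And>x. x \<in> M \<Longrightarrow> \<bar>g x\<bar> \<le> C) \<Longrightarrow> (\<lambda>n. \<integral>\<omega>. g (Y n \<omega>) \<partial>P) \<longlonglongrightarrow> (\<integral>\<omega>. g (Z \<omega>) \<partial>Q)"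
    and f: "continuous_map mtopology euclideanreal f" "bounded (f ` M)"
  shows "(\<lambda>n. \<integral>\<omega>. f (Y n \<omega>) \<partial>P) \<longlonglongrightarrow> (\<integral>\<omega>. f (Z \<omega>) \<partial>Q)"
proof -
  interpret P: prob_space P by fact
  interpret Q: prob_space Q by fact
  have YM: "Y n \<omega> \<in> M" if "\<omega> \<in> space P" for n \<omega> using measurable_space[OF Y that] by simp
  have ZM: "Z \<omega> \<in> M" if "\<omega> \<in> space Q" for \<omega> using measurable_space[OF Z that] by simp
  have lower: "\<forall>\<^sub>F n in sequentially. (\<integral>\<omega>. f (Y n \<omega>) \<partial>P) > (\<integral>\<omega>. f (Z \<omega>) \<partial>Q) - \<epsilon>"
    if f: "continuous_map mtopology euclideanreal f" "\<And>y. y \<in> M \<Longrightarrow> \<bar>f y\<bar> \<le> C"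
      and \<epsilon>: "\<epsilon> > 0" for f :: "'a \<Rightarrow> real" and C \<epsilon>
  proof -
    have lb: "- C \<le> f y" if "y \<in> M" for y using f(2)[OF that] by linarith
    have ub: "f y \<le> C" if "y \<in> M" for y using f(2)[OF that] by linarith
    let ?g = "\<lambda>k. lower_envelope f (real k)"
    have gL: "\<bar>?g k x - ?g k y\<bar> \<le> real k * d x y" if "x \<in> M" "y \<in> M" for k x y
      by (rule lower_envelope_Lipschitz[OF lb _ that]) auto
    have gle: "?g k x \<le> f x" if "x \<in> M" for k x
      by (rule lower_envelope_le[OF lb _ that]) auto
    have gge: "- C \<le> ?g k x" if "x \<in> M" for k x
      by (rule lower_envelope_ge[OF lb _ that]) auto
    have gb: "\<bar>?g k x\<bar> \<le> C" if "x \<in> M" for k x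
      using gle[OF that, of k] gge[OF that, of k] ub[OF that] by auto
    have gm: "?g k \<in> borel_measurable (borel_of mtopology)" for k
      by (intro continuous_map_borel_of Lipschitz_continuous_map_real[OF gL]) auto
    have fm: "f \<in> borel_measurable (borel_of mtopology)"
      by (intro continuous_map_borel_of f)
    have "(\<lambda>k. \<integral>\<omega>. ?g k (Z \<omega>) \<partial>Q) \<longlonglongrightarrow> (\<integral>\<omega>. f (Z \<omega>) \<partial>Q)"
    proof (rule integral_dominated_convergence[where w = "\<lambda>_. C"])
      show "AE \<omega> in Q. (\<lambda>k. ?g k (Z \<omega>)) \<longlonglongrightarrow> f (Z \<omega>)"
        using ZM by (intro AE_I2 lower_envelope_tendsto[OF f]) auto
      show "AE \<omega> in Q. norm (?g k (Z \<omega>)) \<le> C" for k using ZM gb by (intro AE_I2) auto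
    qed (use measurable_compose[OF Z fm] measurable_compose[OF Z gm] in auto)
    then have "\<forall>\<^sub>F k in sequentially. (\<integral>\<omega>. ?g k (Z \<omega>) \<partial>Q) > (\<integral>\<omega>. f (Z \<omega>) \<partial>Q) - \<epsilon>"
      using \<epsilon> by (intro order_tendstoD(1)) auto
    \<comment> \<open>\<open>k\<close> is fixed before \<open>n\<close> varies, so that the
      Lipschitz hypothesis is applied to a single function.\<close>
    then obtain k where k: "(\<integral>\<omega>. ?g k (Z \<omega>) \<partial>Q) > (\<integral>\<omega>. f (Z \<omega>) \<partial>Q) - \<epsilon>"
      using eventually_happens'[OF sequentially_bot] by blast
    have "(\<lambda>n. \<integral>\<omega>. ?g k (Y n \<omega>) \<partial>P) \<longlonglongrightarrow> (\<integral>\<omega>. ?g k (Z \<omega>) \<partial>Q)"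
      by (rule lip[OF _ gL gb]) auto
    then have "\<forall>\<^sub>F n in sequentially. (\<integral>\<omega>. ?g k (Y n \<omega>) \<partial>P) > (\<integral>\<omega>. f (Z \<omega>) \<partial>Q) - \<epsilon>"
      using k by (rule order_tendstoD(1))
    then show ?thesis
    proof eventually_elim
      case (elim n)
      have "(\<integral>\<omega>. ?g k (Y n \<omega>) \<partial>P) \<le> (\<integral>\<omega>. f (Y n \<omega>) \<partial>P)"
        using gle YM gb f(2)
        by (intro integral_mono P.integrable_const_bound[where B = C]
            measurable_compose[OF Y gm] measurable_compose[OF Y fm] AE_I2) auto
      with elim show ?case by linarith
    qed
  qed
  obtain C where C: "\<And>y. y \<in> M \<Longrightarrow> \<bar>f y\<bar> \<le> C" using f(2) by (auto simp: bounded_iff)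
  show ?thesis
  proof (rule order_tendstoI)
    fix a assume "a < (\<integral>\<omega>. f (Z \<omega>) \<partial>Q)"
    then show "\<forall>\<^sub>F n in sequentially. a < (\<integral>\<omega>. f (Y n \<omega>) \<partial>P)"
      using lower[OF f(1) C, of "(\<integral>\<omega>. f (Z \<omega>) \<partial>Q) - a"] by simp
  next
    fix a assume "a > (\<integral>\<omega>. f (Z \<omega>) \<partial>Q)"
    moreover have "continuous_map mtopology euclideanreal (\<lambda>x. - f x)"
      using f(1) by (rule continuous_map_minus)
    ultimately show "\<forall>\<^sub>F n in sequentially. (\<integral>\<omega>. f (Y n \<omega>) \<partial>P) < a"
      using lower[of "\<lambda>x. - f x" C "a - (\<integral>\<omega>. f (Z \<omega>) \<partial>Q)"] C by simp
  qed
qed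

end

section \<open>The weighted sequence space\<close>

text \<open>Cutting along the enumeration \<open>to_nat_on\<close> serves finite and infinite types
  alike and gives one fixed increasing sequence of finite sets.\<close>

definition initial :: "nat \<Rightarrow> 'a set" where
  "initial n = {x. to_nat_on UNIV x < n}"

lemma finite_initial:
  assumes "countable (UNIV :: 'a set)"
  shows "finite (initial n :: 'a set)"
proof -
  have "finite (to_nat_on (UNIV :: 'a set) -` {..<n})"
    by (rule finite_vimageI) (use inj_on_to_nat_on[OF assms] in auto)
  then show ?thesis by (simp add: initial_def vimage_def)
qed

lemma initial_mono: "m \<le> n \<Longrightarrow> initial m \<subseteq> initial n"
  by (auto simp: initial_def)

lemma finite_subset_initial:
  assumes "finite F"
  shows "\<exists>n. F \<subseteq> initial n"
proof (intro exI subsetI)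
  fix x assume "x \<in> F"
  then show "x \<in> initial (Suc (Max (to_nat_on UNIV ` F)))"
    using assms by (auto simp: initial_def less_Suc_eq_le)
qed

text \<open>Each finite \<open>X\<close> lies in some \<open>initial m\<close>, so a limit along all
  finite subsets of \<open>A\<close> is also a limit along this sequence, the form that
  measurability and monotone convergence require.\<close>

lemma filterlim_initial:
  assumes "countable (UNIV :: 'a set)"
  shows "filterlim (\<lambda>n. A \<inter> initial n :: 'a set) (finite_subsets_at_top A) sequentially"
  unfolding filterlim_iff eventually_finite_subsets_at_top
proof (intro allI impI)
  fix P :: "'a set \<Rightarrow> bool"
  assume "\<exists>X. finite X \<and> X \<subseteq> A \<and> (\<forall>Y. finite Y \<and> X \<subseteq> Y \<and> Y \<subseteq> A \<longrightarrow> P Y)"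
  then obtain X where X: "finite X" "X \<subseteq> A" "\<forall>Y. finite Y \<and> X \<subseteq> Y \<and> Y \<subseteq> A \<longrightarrow> P Y"
    by (elim exE conjE)
  obtain m where "X \<subseteq> initial m" using finite_subset_initial[OF X(1)] by blast
  then have "finite (A \<inter> initial n) \<and> X \<subseteq> A \<inter> initial n \<and> A \<inter> initial n \<subseteq> A" if "n \<ge> m" for n
    using X(2) finite_initial[OF assms, of n] initial_mono[OF that] by auto
  then have "P (A \<inter> initial n)" if "n \<ge> m" for n
    using X(3) that by simp
  then show "\<forall>\<^sub>F n in sequentially. P (A \<inter> initial n)"
    by (auto simp: eventually_sequentially)
qed

lemma sum_initial_tendsto:
  fixes f :: "'a \<Rightarrow> 'b :: {comm_monoid_add, t2_space}"
  assumes "countable (UNIV :: 'a set)" "f summable_on A"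
  shows "(\<lambda>n. sum f (A \<inter> initial n)) \<longlonglongrightarrow> infsum f A"
  using filterlim_compose[OF infsum_tendsto[OF assms(2)] filterlim_initial[OF assms(1)]] .

lemma summable_on_if_sum_initial_le:
  fixes f :: "'a \<Rightarrow> real"
  assumes "countable (UNIV :: 'a set)" "\<And>x. x \<in> A \<Longrightarrow> f x \<ge> 0" "\<And>n. sum f (A \<inter> initial n) \<le> B"
  shows "f summable_on A"
proof (rule nonneg_bounded_partial_sums_imp_summable_on[of _ _ B])
  show "\<forall>\<^sub>F X in finite_subsets_at_top A. sum f X \<le> B"
  proof (rule eventually_finite_subsets_at_top_weakI)
    fix X assume X: "finite X" "X \<subseteq> A"
    obtain n where "X \<subseteq> initial n" using finite_subset_initial[OF X(1)] by blast
    then have "sum f X \<le> sum f (A \<inter> initial n)"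
      using X assms(2) by (intro sum_mono2 finite_Int disjI2 finite_initial assms(1)) auto
    then show "sum f X \<le> B" using assms(3)[of n] by linarith
  qed
qed (use assms(2) in auto)

lemma sum_initial_le_infsum:
  fixes f :: "'a \<Rightarrow> real"
  assumes "countable (UNIV :: 'a set)" "\<And>x. x \<in> A \<Longrightarrow> f x \<ge> 0" "f summable_on A"
  shows "sum f (A \<inter> initial n) \<le> infsum f A"
  using assms by (intro finite_sum_le_infsum finite_Int disjI2 finite_initial) auto

lemma infsum_Compl_initial_tendsto:
  fixes f :: "'a \<Rightarrow> real"
  assumes "countable (UNIV :: 'a set)" "f summable_on UNIV"
  shows "(\<lambda>n. infsum f (- initial n)) \<longlonglongrightarrow> 0"
proof -
  have "infsum f (- initial n) = infsum f UNIV - sum f (initial n)" for n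
    using infsum_Diff[OF assms(2), of "initial n"] finite_initial[OF assms(1), of n]
    by (simp add: Compl_eq_Diff_UNIV)
  moreover have "(\<lambda>n. infsum f UNIV - sum f (initial n)) \<longlonglongrightarrow> infsum f UNIV - infsum f UNIV"
    using sum_initial_tendsto[OF assms] by (intro tendsto_intros) simp
  ultimately show ?thesis by simp
qed

text \<open>Summability of nonnegative terms is the countable condition that some natural number
  bounds all partial sums. Where it holds the sum is a limit of partial sums, elsewhere
  \<open>infsum\<close> is \<open>0\<close>: a measurable case distinction.\<close>

lemma borel_measurable_infsum:
  fixes V :: "'a \<Rightarrow> 'm \<Rightarrow> real"
  assumes c: "countable (UNIV :: 'a set)" and [measurable]: "\<And>x. V x \<in> borel_measurable M"
    and nn: "\<And>x \<omega>. V x \<omega> \<ge> 0"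
  shows "(\<lambda>\<omega>. \<Sum>\<^sub>\<infinity>x\<in>A. V x \<omega>) \<in> borel_measurable M"
    and "Measurable.pred M (\<lambda>\<omega>. (\<lambda>x. V x \<omega>) summable_on A)"
proof -
  let ?S = "\<lambda>n \<omega>. \<Sum>x\<in>A \<inter> initial n. V x \<omega>"
  have iff: "(\<lambda>x. V x \<omega>) summable_on A \<longleftrightarrow> (\<exists>k::nat. \<forall>n. ?S n \<omega> \<le> real k)" for \<omega>
  proof
    assume "(\<lambda>x. V x \<omega>) summable_on A"
    moreover obtain k :: nat where "infsum (\<lambda>x. V x \<omega>) A \<le> real k" using real_arch_simple by blast
    ultimately show "\<exists>k::nat. \<forall>n. ?S n \<omega> \<le> real k"
      using sum_initial_le_infsum[OF c, of A "\<lambda>x. V x \<omega>"] nn by (meson order_trans)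
  next
    assume "\<exists>k::nat. \<forall>n. ?S n \<omega> \<le> real k"
    then show "(\<lambda>x. V x \<omega>) summable_on A"
      using summable_on_if_sum_initial_le[OF c, of A "\<lambda>x. V x \<omega>"] nn by blast
  qed
  show *[measurable]: "Measurable.pred M (\<lambda>\<omega>. (\<lambda>x. V x \<omega>) summable_on A)"
    unfolding iff by measurable
  have "(\<lambda>\<omega>. if (\<lambda>x. V x \<omega>) summable_on A then lim (\<lambda>n. ?S n \<omega>) else 0) \<in> borel_measurable M"
    by measurable
  moreover have "(if (\<lambda>x. V x \<omega>) summable_on A then lim (\<lambda>n. ?S n \<omega>) else 0) = (\<Sum>\<^sub>\<infinity>x\<in>A. V x \<omega>)" for \<omega>
    using limI[OF sum_initial_tendsto[OF c, of "\<lambda>x. V x \<omega>" A]] infsum_not_exists by auto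
  ultimately show "(\<lambda>\<omega>. \<Sum>\<^sub>\<infinity>x\<in>A. V x \<omega>) \<in> borel_measurable M" by simp
qed

text \<open>Tonelli for unordered sums, by monotone convergence along \<open>initial n\<close>. The
  extended supremum of the partial sums has finite integral and is therefore finite almost
  everywhere; this gives summability before any real-valued sum is integrated.\<close>

lemma expectation_infsum_le:
  fixes V :: "'a \<Rightarrow> 'm \<Rightarrow> real"
  assumes c: "countable (UNIV :: 'a set)" and int: "\<And>x. integrable M (V x)"
    and nn: "\<And>x \<omega>. V x \<omega> \<ge> 0" and le: "\<And>x. (\<integral>\<omega>. V x \<omega> \<partial>M) \<le> s x" and s: "s summable_on A"
  shows "AE \<omega> in M. (\<lambda>x. V x \<omega>) summable_on A"
    and "integrable M (\<lambda>\<omega>. \<Sum>\<^sub>\<infinity>x\<in>A. V x \<omega>)"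
    and "(\<integral>\<omega>. (\<Sum>\<^sub>\<infinity>x\<in>A. V x \<omega>) \<partial>M) \<le> infsum s A"
proof -
  let ?S = "\<lambda>n \<omega>. \<Sum>x\<in>A \<inter> initial n. V x \<omega>"
  note meas [measurable] = borel_measurable_integrable[OF int]
  have s0: "s x \<ge> 0" for x using order_trans[OF Bochner_Integration.integral_nonneg[OF nn] le] .
  have intS: "integrable M (?S n)" for n using int by auto
  have S0: "?S n \<omega> \<ge> 0" for n \<omega> using nn by (auto intro: sum_nonneg)
  have mono: "?S m \<omega> \<le> ?S n \<omega>" if "m \<le> n" for m n \<omega>
    using initial_mono[OF that] nn
    by (intro sum_mono2 finite_Int disjI2 finite_initial c) auto
  have sV: "(\<lambda>x. \<integral>\<omega>. V x \<omega> \<partial>M) summable_on A"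
    using le nn by (intro summable_on_comparison_test[OF s]) auto
  have intS_le: "(\<integral>\<omega>. ?S n \<omega> \<partial>M) \<le> infsum s A" for n
  proof -
    have "(\<integral>\<omega>. ?S n \<omega> \<partial>M) = (\<Sum>x\<in>A \<inter> initial n. \<integral>\<omega>. V x \<omega> \<partial>M)" using int by simp
    also have "\<dots> \<le> (\<Sum>x\<in>A \<inter> initial n. s x)" using le by (rule sum_mono)
    also have "\<dots> \<le> infsum s A" using sum_initial_le_infsum[OF c _ s] s0 by auto
    finally show ?thesis .
  qed
  have "(\<integral>\<^sup>+\<omega>. (SUP n. ennreal (?S n \<omega>)) \<partial>M) = (SUP n. \<integral>\<^sup>+\<omega>. ennreal (?S n \<omega>) \<partial>M)"
    by (rule nn_integral_monotone_convergence_SUP)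
       (auto simp: incseq_def le_fun_def intro!: ennreal_leI mono)
  also have "\<dots> \<le> ennreal (infsum s A)"
  proof (rule SUP_least)
    fix n show "(\<integral>\<^sup>+\<omega>. ennreal (?S n \<omega>) \<partial>M) \<le> ennreal (infsum s A)"
      using intS_le[of n] S0 by (subst nn_integral_eq_integral[OF intS]) (auto intro: ennreal_leI)
  qed
  finally have "(\<integral>\<^sup>+\<omega>. (SUP n. ennreal (?S n \<omega>)) \<partial>M) \<le> ennreal (infsum s A)" .
  from le_less_trans[OF this ennreal_less_top]
  have "(\<integral>\<^sup>+\<omega>. (SUP n. ennreal (?S n \<omega>)) \<partial>M) \<noteq> \<infinity>" by simp
  then have "AE \<omega> in M. (SUP n. ennreal (?S n \<omega>)) \<noteq> \<infinity>"
    by (intro nn_integral_noteq_infinite) simp_all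
  then show AE: "AE \<omega> in M. (\<lambda>x. V x \<omega>) summable_on A"
  proof eventually_elim
    case (elim \<omega>)
    define B where "B = enn2real (SUP n. ennreal (?S n \<omega>))"
    have "(SUP n. ennreal (?S n \<omega>)) < top"
      using elim unfolding infinity_ennreal_def less_top .
    then have B: "B \<ge> 0" "(SUP n. ennreal (?S n \<omega>)) = ennreal B"
      unfolding B_def by (simp_all only: ennreal_enn2real enn2real_nonneg)
    have "?S n \<omega> \<le> B" for n
    proof -
      have "ennreal (?S n \<omega>) \<le> ennreal B" unfolding B(2)[symmetric] by (rule SUP_upper) auto
      then show ?thesis using B(1) by (simp add: ennreal_le_iff)
    qed
    then show ?case using nn by (intro summable_on_if_sum_initial_le[OF c]) auto
  qed
  have lim: "(\<lambda>n. \<integral>\<omega>. ?S n \<omega> \<partial>M) \<longlonglongrightarrow> infsum (\<lambda>x. \<integral>\<omega>. V x \<omega> \<partial>M) A"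
    using sum_initial_tendsto[OF c sV] int by simp
  have AElim: "AE \<omega> in M. (\<lambda>n. ?S n \<omega>) \<longlonglongrightarrow> (\<Sum>\<^sub>\<infinity>x\<in>A. V x \<omega>)"
    using AE by eventually_elim (rule sum_initial_tendsto[OF c])
  show "integrable M (\<lambda>\<omega>. \<Sum>\<^sub>\<infinity>x\<in>A. V x \<omega>)"
    by (rule integrable_monotone_convergence[OF intS _ AElim lim borel_measurable_infsum(1)[OF c meas nn]])
       (auto simp: mono_def intro!: AE_I2 mono)
  have "(\<integral>\<omega>. (\<Sum>\<^sub>\<infinity>x\<in>A. V x \<omega>) \<partial>M) = infsum (\<lambda>x. \<integral>\<omega>. V x \<omega> \<partial>M) A"
    by (rule integral_monotone_convergence[OF intS _ AElim lim borel_measurable_infsum(1)[OF c meas nn]])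
       (auto simp: mono_def intro!: AE_I2 mono)
  also have "\<dots> \<le> infsum s A" using sV s le by (rule infsum_mono)
  finally show "(\<integral>\<omega>. (\<Sum>\<^sub>\<infinity>x\<in>A. V x \<omega>) \<partial>M) \<le> infsum s A" .
qed

section \<open>The norm as a single weighted sum, and truncation\<close>

lemma summable_on_finite_support:
  fixes f :: "'a \<Rightarrow> real"
  assumes "finite F" "\<And>x. x \<notin> F \<Longrightarrow> f x = 0"
  shows "f summable_on UNIV"
  using summable_on_cong_neutral[of F UNIV f f] assms by simp

text \<open>The unit added at \<open>x0\<close>, where the distance term is \<open>0\<close>,
  absorbs the separate summand \<open>\<bar>a x0\<bar>\<close> of the norm and makes the weight
  strictly positive everywhere.\<close>

definition wl1_weight :: "real \<Rightarrow> 'a::metric_space \<Rightarrow> 'a \<Rightarrow> real" where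
  "wl1_weight p x0 x = dist x x0 powr p + of_bool (x = x0)"

lemma wl1_weight_pos: "wl1_weight p x0 x > 0"
  by (cases "x = x0") (auto simp: wl1_weight_def)

lemma wl1_weight_nonneg [simp]: "wl1_weight p x0 x \<ge> 0"
  using wl1_weight_pos[of p x0 x] by simp

text \<open>The two families differ at the single point \<open>x0\<close>. This moves both the space
  and the criterion of the theorem to \<open>wl1_weight\<close>.\<close>

lemma wl1_weight_summable_iff:
  "(\<lambda>x. wl1_weight p x0 x * f x) summable_on UNIV \<longleftrightarrow> (\<lambda>x. dist x x0 powr p * f x) summable_on UNIV"
proof -
  have *: "(\<lambda>x. of_bool (x = x0) * f x) summable_on UNIV"
    by (rule summable_on_finite_support[of "{x0}"]) auto
  have eq: "wl1_weight p x0 x * f x = dist x x0 powr p * f x + of_bool (x = x0) * f x" for x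
    by (simp add: wl1_weight_def algebra_simps)
  show ?thesis
  proof
    assume "(\<lambda>x. wl1_weight p x0 x * f x) summable_on UNIV"
    from summable_on_add[OF this summable_on_uminus[THEN iffD2, OF *]] show "(\<lambda>x. dist x x0 powr p * f x) summable_on UNIV"
      by (simp add: eq)
  next
    assume "(\<lambda>x. dist x x0 powr p * f x) summable_on UNIV"
    from summable_on_add[OF this *] show "(\<lambda>x. wl1_weight p x0 x * f x) summable_on UNIV"
      by (simp add: eq)
  qed
qed

lemma wl1_space_iff: "a \<in> wl1_space p x0 \<longleftrightarrow> (\<lambda>x. wl1_weight p x0 x * \<bar>a x\<bar>) summable_on UNIV"
  by (simp add: wl1_weight_summable_iff wl1_space_def)

lemma wl1_norm_eq:
  assumes "a \<in> wl1_space p x0"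
  shows "wl1_norm p x0 a = (\<Sum>\<^sub>\<infinity>x. wl1_weight p x0 x * \<bar>a x\<bar>)"
proof -
  have *: "(\<lambda>x. of_bool (x = x0) * \<bar>a x\<bar>) summable_on UNIV"
    by (rule summable_on_finite_support[of "{x0}"]) auto
  have "(\<Sum>\<^sub>\<infinity>x. of_bool (x = x0) * \<bar>a x\<bar>) = (\<Sum>\<^sub>\<infinity>x\<in>{x0}. \<bar>a x\<bar>)"
    by (rule infsum_cong_neutral) auto
  moreover have "(\<Sum>\<^sub>\<infinity>x. wl1_weight p x0 x * \<bar>a x\<bar>)
      = (\<Sum>\<^sub>\<infinity>x. dist x x0 powr p * \<bar>a x\<bar>) + (\<Sum>\<^sub>\<infinity>x. of_bool (x = x0) * \<bar>a x\<bar>)"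
    using assms by (subst infsum_add[symmetric, OF _ *])
      (auto simp: wl1_space_def wl1_weight_def algebra_simps)
  ultimately show ?thesis by (simp add: wl1_norm_def)
qed

lemma wl1_dist_eq:
  assumes "a \<in> wl1_space p x0" "b \<in> wl1_space p x0"
  shows "wl1_dist p x0 a b = (\<Sum>\<^sub>\<infinity>x. wl1_weight p x0 x * \<bar>a x - b x\<bar>)"
  by (simp add: wl1_dist_def wl1_norm_eq[OF wl1_space_diff[OF assms]])

lemma topspace_wl1 [simp]: "topspace (wl1_topology p x0) = wl1_space p x0"
  by (simp add: wl1_topology_def Metric_space.topspace_mtopology[OF Metric_space_wl1])

text \<open>Extension by \<open>0\<close>, unlike extension by \<open>undefined\<close>, keeps the
  truncation to a finite set inside the weighted space.\<close>

definition restrict0 :: "'a set \<Rightarrow> ('a \<Rightarrow> real) \<Rightarrow> 'a \<Rightarrow> real" where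
  "restrict0 F a x = (if x \<in> F then a x else 0)"

lemma finite_support_in_wl1_space:
  assumes "finite F" "\<And>x. x \<notin> F \<Longrightarrow> a x = 0"
  shows "a \<in> wl1_space p x0"
  unfolding wl1_space_iff by (rule summable_on_finite_support[OF assms(1)]) (use assms(2) in auto)

lemma restrict0_in_wl1_space [simp]: "finite F \<Longrightarrow> restrict0 F a \<in> wl1_space p x0"
  by (rule finite_support_in_wl1_space) (auto simp: restrict0_def)

lemma wl1_dist_finite_support:
  assumes "finite F" "\<And>x. x \<notin> F \<Longrightarrow> a x = 0" "\<And>x. x \<notin> F \<Longrightarrow> b x = 0"
  shows "wl1_dist p x0 a b = (\<Sum>x\<in>F. wl1_weight p x0 x * \<bar>a x - b x\<bar>)"
proof -
  have "(\<Sum>\<^sub>\<infinity>x. wl1_weight p x0 x * \<bar>a x - b x\<bar>) = (\<Sum>\<^sub>\<infinity>x\<in>F. wl1_weight p x0 x * \<bar>a x - b x\<bar>)"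
    using assms by (intro infsum_cong_neutral) auto
  then show ?thesis using assms
    by (simp add: wl1_dist_eq finite_support_in_wl1_space[where F = F])
qed

lemma wl1_dist_restrict0:
  assumes "finite F" "a \<in> wl1_space p x0"
  shows "wl1_dist p x0 a (restrict0 F a) = (\<Sum>\<^sub>\<infinity>x\<in>- F. wl1_weight p x0 x * \<bar>a x\<bar>)"
  unfolding wl1_dist_eq[OF assms(2) restrict0_in_wl1_space[OF assms(1)]]
  by (rule infsum_cong_neutral) (auto simp: restrict0_def)

section \<open>Separability and Borel measurability\<close>

text \<open>The countable dense set that witnesses separability. Confining supports to some
  \<open>initial n\<close> exhibits it as a countable union of images of finite products of the
  rationals.\<close>

definition rational_finite_support :: "('a \<Rightarrow> real) set" where
  "rational_finite_support = (\<Union>n. {q. (\<forall>x\<in>initial n. q x \<in> \<rat>) \<and> (\<forall>x. x \<notin> initial n \<longrightarrow> q x = 0)})"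

lemma countable_rational_finite_support:
  assumes "countable (UNIV :: 'a set)"
  shows "countable (rational_finite_support :: ('a \<Rightarrow> real) set)"
  unfolding rational_finite_support_def
proof (rule countable_UN)
  fix n
  have "{q :: 'a \<Rightarrow> real. (\<forall>x\<in>initial n. q x \<in> \<rat>) \<and> (\<forall>x. x \<notin> initial n \<longrightarrow> q x = 0)}
      \<subseteq> restrict0 (initial n) ` (PiE (initial n :: 'a set) (\<lambda>_. \<rat>))"
  proof
    fix q :: "'a \<Rightarrow> real" assume "q \<in> {q. (\<forall>x\<in>initial n. q x \<in> \<rat>) \<and> (\<forall>x. x \<notin> initial n \<longrightarrow> q x = 0)}"
    then show "q \<in> restrict0 (initial n) ` (PiE (initial n) (\<lambda>_. \<rat>))"
      by (intro image_eqI[of _ _ "restrict q (initial n)"]) (auto simp: restrict0_def fun_eq_iff)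
  qed
  moreover have "countable (PiE (initial n :: 'a set) (\<lambda>_. \<rat> :: real set))"
    by (intro countable_PiE finite_initial assms countable_rat)
  ultimately show "countable {q :: 'a \<Rightarrow> real. (\<forall>x\<in>initial n. q x \<in> \<rat>) \<and> (\<forall>x. x \<notin> initial n \<longrightarrow> q x = 0)}"
    by (meson countable_image countable_subset)
qed auto

lemma rational_finite_support_in_wl1_space:
  assumes "countable (UNIV :: 'a::metric_space set)" "q \<in> rational_finite_support"
  shows "(q :: 'a \<Rightarrow> real) \<in> wl1_space p x0"
  using assms(2) unfolding rational_finite_support_def
  by (auto intro: finite_support_in_wl1_space[OF finite_initial[OF assms(1)]])

text \<open>Half of \<open>\<epsilon>\<close> is spent on the tail outside some
  \<open>initial n\<close>, the other half is shared by the finitely many coordinates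
  inside.\<close>

lemma rational_finite_support_dense:
  assumes c: "countable (UNIV :: 'a::metric_space set)"
    and a: "(a :: 'a \<Rightarrow> real) \<in> wl1_space p x0" and \<epsilon>: "\<epsilon> > 0"
  shows "\<exists>q\<in>rational_finite_support. wl1_dist p x0 a q < \<epsilon>"
proof -
  let ?w = "wl1_weight p x0"
  have "(\<lambda>n. \<Sum>\<^sub>\<infinity>x\<in>- initial n. ?w x * \<bar>a x\<bar>) \<longlonglongrightarrow> 0"
    using a by (intro infsum_Compl_initial_tendsto c) (simp add: wl1_space_iff)
  from order_tendstoD(2)[OF this, of "\<epsilon> / 2"] \<epsilon>
  have "\<forall>\<^sub>F n in sequentially. (\<Sum>\<^sub>\<infinity>x\<in>- initial n. ?w x * \<bar>a x\<bar>) < \<epsilon> / 2" by simp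
  from eventually_happens'[OF sequentially_bot this] obtain n
    where n: "(\<Sum>\<^sub>\<infinity>x\<in>- initial n. ?w x * \<bar>a x\<bar>) < \<epsilon> / 2" ..
  let ?F = "initial n :: 'a set"
  note fin = finite_initial[OF c, of n]
  \<comment> \<open>The summand \<open>1\<close> keeps \<open>N\<close> positive when
    \<open>?F\<close> is empty.\<close>
  define N where "N = real (card ?F) + 1"
  have "\<exists>q. q \<in> \<rat> \<and> ?w x * \<bar>a x - q\<bar> \<le> \<epsilon> / (2 * N)" for x
  proof -
    \<comment> \<open>The tolerance is divided by the weight, which is strictly positive even at
      \<open>x0\<close>.\<close>
    have "a x < a x + \<epsilon> / (2 * N * ?w x)" using \<epsilon> wl1_weight_pos[of p x0 x] by (simp add: N_def)
    then obtain q where q: "q \<in> \<rat>" "a x < q" "q < a x + \<epsilon> / (2 * N * ?w x)"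
      using Rats_dense_in_real by blast
    then have "\<bar>a x - q\<bar> \<le> \<epsilon> / (2 * N * ?w x)" by simp
    then have "?w x * \<bar>a x - q\<bar> \<le> ?w x * (\<epsilon> / (2 * N * ?w x))" by (intro mult_left_mono) auto
    also have "\<dots> = \<epsilon> / (2 * N)" using wl1_weight_pos[of p x0 x] by simp
    finally show ?thesis using q(1) by blast
  qed
  then obtain q0 where q0: "\<And>x. q0 x \<in> \<rat>" "\<And>x. ?w x * \<bar>a x - q0 x\<bar> \<le> \<epsilon> / (2 * N)" by metis
  define q where "q = restrict0 ?F q0"
  have qD: "q \<in> rational_finite_support"
    using q0 by (auto simp: rational_finite_support_def q_def restrict0_def)
  interpret Metric_space "wl1_space p x0" "wl1_dist p x0" by (rule Metric_space_wl1)
  have "wl1_dist p x0 (restrict0 ?F a) q = (\<Sum>x\<in>?F. ?w x * \<bar>restrict0 ?F a x - q x\<bar>)"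
    by (rule wl1_dist_finite_support[OF fin]) (auto simp: q_def restrict0_def)
  also have "\<dots> \<le> (\<Sum>x\<in>?F. \<epsilon> / (2 * N))"
    using q0(2) by (intro sum_mono) (auto simp: q_def restrict0_def)
  also have "\<dots> \<le> \<epsilon> / 2" using \<epsilon> by (simp add: N_def field_simps)
  finally have "wl1_dist p x0 (restrict0 ?F a) q \<le> \<epsilon> / 2" .
  moreover have "wl1_dist p x0 a (restrict0 ?F a) < \<epsilon> / 2"
    using n by (simp add: wl1_dist_restrict0[OF fin a])
  moreover have "wl1_dist p x0 a q
      \<le> wl1_dist p x0 a (restrict0 ?F a) + wl1_dist p x0 (restrict0 ?F a) q"
    using a fin by (intro triangle) (auto simp: q_def)
  ultimately show ?thesis using qD by force
qed

text \<open>By separability every open set is a countable union of balls, and the preimage of a ball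
  is a sublevel set of a measurable unordered sum. Measurable coordinates therefore suffice for
  Borel measurability in the norm topology.\<close>

lemma measurable_borel_of_wl1:
  assumes c: "countable (UNIV :: 'a::metric_space set)"
    and [measurable]: "\<And>x. (\<lambda>\<omega>. V \<omega> x) \<in> borel_measurable M"
    and sp: "\<And>\<omega>. \<omega> \<in> space M \<Longrightarrow> V \<omega> \<in> wl1_space p (x0 :: 'a)"
  shows "V \<in> M \<rightarrow>\<^sub>M borel_of (wl1_topology p x0)"
  unfolding borel_of_def
proof (rule measurable_measure_of)
  interpret Metric_space "wl1_space p x0" "wl1_dist p x0" by (rule Metric_space_wl1)
  fix U assume "U \<in> {U. openin (wl1_topology p x0) U}"
  then have U: "openin mtopology U" by (simp add: wl1_topology_def)
  let ?I = "{(q, \<rho>). q \<in> rational_finite_support \<and> \<rho> \<in> \<rat> \<and> mball q \<rho> \<subseteq> U}"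
  have cI: "countable ?I"
    by (rule countable_subset[of _ "rational_finite_support \<times> \<rat>"])
       (use countable_rational_finite_support[OF c] countable_rat in auto)
  have "U \<subseteq> (\<Union>(q, \<rho>)\<in>?I. mball q \<rho>)"
  proof
    fix a assume aU: "a \<in> U"
    then obtain e where e: "e > 0" "mball a e \<subseteq> U" using U by (auto simp: openin_mtopology)
    have a: "a \<in> wl1_space p x0" using U aU openin_subset by fastforce
    \<comment> \<open>With \<open>\<rho> < e / 2\<close>, a centre \<open>q\<close> within
      \<open>\<rho>\<close> of \<open>a\<close> has its \<open>\<rho>\<close>-ball inside the
      \<open>e\<close>-ball around \<open>a\<close>.\<close>
    obtain \<rho> where \<rho>: "\<rho> \<in> \<rat>" "0 < \<rho>" "\<rho> < e / 2" using Rats_dense_in_real[of 0 "e / 2"] e by auto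
    obtain q where q: "q \<in> rational_finite_support" "wl1_dist p x0 a q < \<rho>"
      using rational_finite_support_dense[OF c a \<rho>(2)] by blast
    have qs: "q \<in> wl1_space p x0" by (rule rational_finite_support_in_wl1_space[OF c q(1)])
    have "mball q \<rho> \<subseteq> mball a e"
    proof
      fix b assume b: "b \<in> mball q \<rho>"
      then have "wl1_dist p x0 a b \<le> wl1_dist p x0 a q + wl1_dist p x0 q b"
        using a qs by (intro triangle) auto
      then show "b \<in> mball a e" using b a q(2) \<rho> by auto
    qed
    moreover have "a \<in> mball q \<rho>" using a qs q(2) by (simp add: commute)
    ultimately show "a \<in> (\<Union>(q, \<rho>)\<in>?I. mball q \<rho>)" using q \<rho> e by fastforce
  qed
  then have "U = (\<Union>(q, \<rho>)\<in>?I. mball q \<rho>)" by auto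
  then have "V -` U \<inter> space M = (\<Union>(q, \<rho>)\<in>?I. V -` mball q \<rho> \<inter> space M)" by fastforce
  moreover have "V -` mball q \<rho> \<inter> space M \<in> sets M" if "(q, \<rho>) \<in> ?I" for q \<rho>
  proof -
    have qs: "q \<in> wl1_space p x0" using that rational_finite_support_in_wl1_space[OF c] by auto
    have [measurable]: "(\<lambda>\<omega>. \<Sum>\<^sub>\<infinity>x. wl1_weight p x0 x * \<bar>q x - V \<omega> x\<bar>) \<in> borel_measurable M"
      by (rule borel_measurable_infsum(1)[OF c]) auto
    have "V -` mball q \<rho> \<inter> space M
        = {\<omega> \<in> space M. (\<Sum>\<^sub>\<infinity>x. wl1_weight p x0 x * \<bar>q x - V \<omega> x\<bar>) < \<rho>}"
      using sp qs by (auto simp: wl1_dist_eq)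
    then show ?thesis by simp
  qed
  ultimately show "V -` U \<inter> space M \<in> sets M"
    using cI by (auto intro!: sets.countable_UN')
qed (use sp openin_subset[of "wl1_topology p x0"] in auto)

section \<open>Gaussian processes\<close>

lemma sets_normal_law [simp, measurable_cong]: "sets (normal_law \<mu> \<sigma>) = sets borel"
  by (simp add: normal_law_def)

lemma space_normal_law [simp]: "space (normal_law \<mu> \<sigma>) = UNIV"
  by (simp add: normal_law_def)

lemma prob_space_normal_law:
  assumes "\<sigma> \<ge> 0"
  shows "prob_space (normal_law \<mu> \<sigma>)"
  using assms by (auto simp: normal_law_def prob_space_return intro!: prob_space_normal_density)

lemma has_bochner_integral_normal_law:
  fixes f :: "real \<Rightarrow> real"
  assumes \<sigma>: "\<sigma> \<ge> 0" and f: "f \<in> borel_measurable borel"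
    and "\<sigma> = 0 \<Longrightarrow> z = f \<mu>"
    and *: "\<sigma> > 0 \<Longrightarrow> has_bochner_integral lborel (\<lambda>x. normal_density \<mu> \<sigma> x * f x) z"
  shows "has_bochner_integral (normal_law \<mu> \<sigma>) f z"
proof (cases "\<sigma> = 0")
  case True
  then show ?thesis using assms
    by (auto simp: normal_law_def has_bochner_integral_iff integral_return nn_integral_return intro!: integrableI_bounded)
next
  case False
  then have "has_bochner_integral (density lborel (\<lambda>x. ennreal (normal_density \<mu> \<sigma> x))) f z"
    using * \<sigma> f by (intro has_bochner_integral_density) (auto simp: normal_density_nonneg)
  then show ?thesis using False by (simp add: normal_law_def)
qed

lemma normal_law_moments:
  assumes \<sigma>: "\<sigma> \<ge> 0"
  shows "has_bochner_integral (normal_law \<mu> \<sigma>) (\<lambda>x. x) \<mu>"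
    and "has_bochner_integral (normal_law \<mu> \<sigma>) (\<lambda>x. (x - \<mu>)\<^sup>2) (\<sigma>\<^sup>2)"
    and "has_bochner_integral (normal_law \<mu> \<sigma>) (\<lambda>x. \<bar>x - \<mu>\<bar>) (\<sigma> * sqrt (2 / pi))"
proof -
  show "has_bochner_integral (normal_law \<mu> \<sigma>) (\<lambda>x. x) \<mu>"
    by (rule has_bochner_integral_normal_law[OF \<sigma> _ _ normal_moment_nz_1]) auto
  show "has_bochner_integral (normal_law \<mu> \<sigma>) (\<lambda>x. (x - \<mu>)\<^sup>2) (\<sigma>\<^sup>2)"
  proof (rule has_bochner_integral_normal_law[OF \<sigma>])
    assume "\<sigma> > 0"
    from normal_moment_even[OF this, of \<mu> 1]
    show "has_bochner_integral lborel (\<lambda>x. normal_density \<mu> \<sigma> x * (x - \<mu>)\<^sup>2) (\<sigma>\<^sup>2)" by simp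
  qed auto
  show "has_bochner_integral (normal_law \<mu> \<sigma>) (\<lambda>x. \<bar>x - \<mu>\<bar>) (\<sigma> * sqrt (2 / pi))"
  proof (rule has_bochner_integral_normal_law[OF \<sigma>])
    assume "\<sigma> > 0"
    from normal_moment_abs_odd[OF this, of \<mu> 0]
    show "has_bochner_integral lborel (\<lambda>x. normal_density \<mu> \<sigma> x * \<bar>x - \<mu>\<bar>) (\<sigma> * sqrt (2 / pi))" by simp
  qed auto
qed

lemma moments_if_distr_normal_law:
  fixes W :: "'m \<Rightarrow> real"
  assumes \<sigma>: "\<sigma> \<ge> 0" and W [measurable]: "W \<in> borel_measurable M"
    and d: "distr M borel W = normal_law \<mu> \<sigma>"
  shows "integrable M W" "(\<integral>\<omega>. W \<omega> \<partial>M) = \<mu>"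
    "integrable M (\<lambda>\<omega>. (W \<omega> - \<mu>)\<^sup>2)" "(\<integral>\<omega>. (W \<omega> - \<mu>)\<^sup>2 \<partial>M) = \<sigma>\<^sup>2"
    "integrable M (\<lambda>\<omega>. \<bar>W \<omega> - \<mu>\<bar>)" "(\<integral>\<omega>. \<bar>W \<omega> - \<mu>\<bar> \<partial>M) = \<sigma> * sqrt (2 / pi)"
proof -
  have *: "integrable M (\<lambda>\<omega>. f (W \<omega>)) \<and> (\<integral>\<omega>. f (W \<omega>) \<partial>M) = z"
    if "has_bochner_integral (normal_law \<mu> \<sigma>) f z" and [measurable]: "f \<in> borel_measurable borel"
    for f :: "real \<Rightarrow> real" and z
    using that(1) unfolding d[symmetric]
    by (simp add: has_bochner_integral_iff integrable_distr_eq integral_distr)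
  note m = normal_law_moments[OF \<sigma>, of \<mu>]
  show "integrable M W" "(\<integral>\<omega>. W \<omega> \<partial>M) = \<mu>" using *[OF m(1)] by simp_all
  show "integrable M (\<lambda>\<omega>. (W \<omega> - \<mu>)\<^sup>2)" "(\<integral>\<omega>. (W \<omega> - \<mu>)\<^sup>2 \<partial>M) = \<sigma>\<^sup>2"
    using *[OF m(2)] by simp_all
  show "integrable M (\<lambda>\<omega>. \<bar>W \<omega> - \<mu>\<bar>)" "(\<integral>\<omega>. \<bar>W \<omega> - \<mu>\<bar> \<partial>M) = \<sigma> * sqrt (2 / pi)"
    using *[OF m(3)] by simp_all
qed

lemma integrable_mult_if_square_integrable:
  fixes f g :: "'m \<Rightarrow> real"
  assumes [measurable]: "f \<in> borel_measurable M" "g \<in> borel_measurable M"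
    and "integrable M (\<lambda>\<omega>. (f \<omega>)\<^sup>2)" "integrable M (\<lambda>\<omega>. (g \<omega>)\<^sup>2)"
  shows "integrable M (\<lambda>\<omega>. f \<omega> * g \<omega>)"
proof (rule Bochner_Integration.integrable_bound)
  show "integrable M (\<lambda>\<omega>. (f \<omega>)\<^sup>2 + (g \<omega>)\<^sup>2)" using assms by simp
  show "AE \<omega> in M. norm (f \<omega> * g \<omega>) \<le> norm ((f \<omega>)\<^sup>2 + (g \<omega>)\<^sup>2)"
  proof (rule AE_I2)
    fix \<omega>
    have "2 * (\<bar>f \<omega>\<bar> * \<bar>g \<omega>\<bar>) \<le> (f \<omega>)\<^sup>2 + (g \<omega>)\<^sup>2"
      using sum_squares_bound[of "\<bar>f \<omega>\<bar>" "\<bar>g \<omega>\<bar>"] by simp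
    moreover have "0 \<le> \<bar>f \<omega>\<bar> * \<bar>g \<omega>\<bar>" by simp
    ultimately have "\<bar>f \<omega>\<bar> * \<bar>g \<omega>\<bar> \<le> (f \<omega>)\<^sup>2 + (g \<omega>)\<^sup>2" by linarith
    then show "norm (f \<omega> * g \<omega>) \<le> norm ((f \<omega>)\<^sup>2 + (g \<omega>)\<^sup>2)" by (simp add: abs_mult)
  qed
qed measurable

text \<open>The definition of a Gaussian process only provides some normal law for each linear
  combination; its parameters are determined by the first two moments.\<close>

lemma gaussian_process_linear:
  fixes G :: "'k \<Rightarrow> 'a \<Rightarrow> real"
  assumes G: "gaussian_process N G (\<lambda>_. 0) S" and F: "finite F"
  shows "distr N borel (\<lambda>\<omega>. \<Sum>x\<in>F. c x * G \<omega> x)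
      = normal_law 0 (sqrt (\<Sum>x\<in>F. \<Sum>y\<in>F. c x * c y * S x y))"
    and "(\<Sum>x\<in>F. \<Sum>y\<in>F. c x * c y * S x y) \<ge> 0"
    and "integrable N (\<lambda>\<omega>. (G \<omega> x)\<^sup>2)" and "(\<integral>\<omega>. (G \<omega> x)\<^sup>2 \<partial>N) = S x x"
    and "integrable N (\<lambda>\<omega>. \<bar>G \<omega> x\<bar>)" and "(\<integral>\<omega>. \<bar>G \<omega> x\<bar> \<partial>N) = sqrt (S x x) * sqrt (2 / pi)"
proof -
  interpret prob_space N using G by (simp add: gaussian_process_def)
  have [measurable]: "(\<lambda>\<omega>. G \<omega> x) \<in> borel_measurable N" for x
    using G by (simp add: gaussian_process_def)
  have law: "\<exists>\<mu> \<sigma>. \<sigma> \<ge> 0 \<and> distr N borel (\<lambda>\<omega>. \<Sum>x\<in>F. c x * G \<omega> x) = normal_law \<mu> \<sigma>"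
    if "finite F" for F and c :: "'a \<Rightarrow> real"
    using G that by (auto simp: gaussian_process_def)
  have mean: "(\<integral>\<omega>. G \<omega> x \<partial>N) = 0" and cov: "(\<integral>\<omega>. G \<omega> x * G \<omega> y \<partial>N) = S x y" for x y
    using G by (auto simp: gaussian_process_def)
  have coord: "\<exists>\<sigma>\<ge>0. distr N borel (\<lambda>\<omega>. G \<omega> x) = normal_law 0 \<sigma> \<and> \<sigma>\<^sup>2 = S x x" for x
  proof -
    obtain \<mu> \<sigma> where \<sigma>: "\<sigma> \<ge> 0" and d: "distr N borel (\<lambda>\<omega>. G \<omega> x) = normal_law \<mu> \<sigma>"
      using law[of "{x}" "\<lambda>_. 1"] by auto
    note m = moments_if_distr_normal_law[OF \<sigma> _ d]
    have "\<mu> = 0" using m(2) mean[of x] by simp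
    moreover have "\<sigma>\<^sup>2 = S x x"
      using m(4) cov[of x x] \<open>\<mu> = 0\<close> by (simp add: power2_eq_square)
    ultimately show ?thesis using \<sigma> d by auto
  qed
  have sq: "integrable N (\<lambda>\<omega>. (G \<omega> x)\<^sup>2)" "(\<integral>\<omega>. (G \<omega> x)\<^sup>2 \<partial>N) = S x x" "integrable N (\<lambda>\<omega>. G \<omega> x)"
    "integrable N (\<lambda>\<omega>. \<bar>G \<omega> x\<bar>)" "(\<integral>\<omega>. \<bar>G \<omega> x\<bar> \<partial>N) = sqrt (S x x) * sqrt (2 / pi)" for x
  proof -
    obtain \<sigma> where \<sigma>: "\<sigma> \<ge> 0" and d: "distr N borel (\<lambda>\<omega>. G \<omega> x) = normal_law 0 \<sigma>" "\<sigma>\<^sup>2 = S x x"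
      using coord[of x] by blast
    note m = moments_if_distr_normal_law[OF \<sigma> _ d(1)]
    have "sqrt (S x x) = \<sigma>" using \<sigma> d(2) by (intro real_sqrt_unique)
    then show "integrable N (\<lambda>\<omega>. (G \<omega> x)\<^sup>2)" "(\<integral>\<omega>. (G \<omega> x)\<^sup>2 \<partial>N) = S x x" "integrable N (\<lambda>\<omega>. G \<omega> x)"
      "integrable N (\<lambda>\<omega>. \<bar>G \<omega> x\<bar>)" "(\<integral>\<omega>. \<bar>G \<omega> x\<bar> \<partial>N) = sqrt (S x x) * sqrt (2 / pi)"
      using m d(2) by simp_all
  qed
  then show "integrable N (\<lambda>\<omega>. (G \<omega> x)\<^sup>2)" "(\<integral>\<omega>. (G \<omega> x)\<^sup>2 \<partial>N) = S x x"
    "integrable N (\<lambda>\<omega>. \<bar>G \<omega> x\<bar>)" "(\<integral>\<omega>. \<bar>G \<omega> x\<bar> \<partial>N) = sqrt (S x x) * sqrt (2 / pi)" by simp_all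
  let ?W = "\<lambda>\<omega>. \<Sum>x\<in>F. c x * G \<omega> x"
  obtain \<mu> \<sigma> where \<sigma>: "\<sigma> \<ge> 0" and d: "distr N borel ?W = normal_law \<mu> \<sigma>"
    using law[OF F] by blast
  note m = moments_if_distr_normal_law[OF \<sigma> _ d]
  have intW: "(\<integral>\<omega>. ?W \<omega> \<partial>N) = 0" using sq mean by simp
  then have \<mu>: "\<mu> = 0" using m(2) by simp
  have prodi: "integrable N (\<lambda>\<omega>. G \<omega> x * G \<omega> y)" for x y
    by (rule integrable_mult_if_square_integrable) (auto simp: sq)
  have "(\<integral>\<omega>. (?W \<omega>)\<^sup>2 \<partial>N) = (\<integral>\<omega>. (\<Sum>x\<in>F. \<Sum>y\<in>F. c x * c y * (G \<omega> x * G \<omega> y)) \<partial>N)"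
    by (simp add: power2_eq_square sum_product algebra_simps)
  also have "\<dots> = (\<Sum>x\<in>F. \<Sum>y\<in>F. c x * c y * S x y)" using prodi cov by simp
  finally have "\<sigma>\<^sup>2 = (\<Sum>x\<in>F. \<Sum>y\<in>F. c x * c y * S x y)"
    using m(4) \<mu> by simp
  then show "(\<Sum>x\<in>F. \<Sum>y\<in>F. c x * c y * S x y) \<ge> 0"
    "distr N borel ?W = normal_law 0 (sqrt (\<Sum>x\<in>F. \<Sum>y\<in>F. c x * c y * S x y))"
    using d \<mu> \<sigma> by (auto simp flip: \<open>\<sigma>\<^sup>2 = _\<close>)
qed

text \<open>Permits a change on a null set, by which every path of the limit, not only almost every
  one, is put into the weighted space.\<close>

lemma gaussian_process_cong_AE:
  assumes G: "gaussian_process N G m S" and ae: "AE \<omega> in N. G' \<omega> = G \<omega>"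
    and meas: "\<And>x. (\<lambda>\<omega>. G' \<omega> x) \<in> borel_measurable N"
  shows "gaussian_process N G' m S"
proof -
  have [measurable]: "(\<lambda>\<omega>. G \<omega> x) \<in> borel_measurable N" for x
    using G by (simp add: gaussian_process_def)
  note [measurable] = meas
  have "distr N borel (\<lambda>\<omega>. \<Sum>x\<in>F. c x * G' \<omega> x) = distr N borel (\<lambda>\<omega>. \<Sum>x\<in>F. c x * G \<omega> x)" for F c
    using ae by (intro distr_cong_AE) auto
  moreover have "(\<integral>\<omega>. G' \<omega> x \<partial>N) = (\<integral>\<omega>. G \<omega> x \<partial>N)" for x
    using ae by (intro integral_cong_AE) auto
  moreover have "(\<integral>\<omega>. (G' \<omega> x - m x) * (G' \<omega> x' - m x') \<partial>N)
      = (\<integral>\<omega>. (G \<omega> x - m x) * (G \<omega> x' - m x') \<partial>N)" for x x'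
    using ae by (intro integral_cong_AE) auto
  ultimately show ?thesis using G meas by (simp add: gaussian_process_def)
qed

text \<open>Bilinear expansion in which only the diagonal survives. It is applied to white noise
  with \<open>v = 1\<close>, and to linear forms of the successive observations with
  \<open>v\<close> the variance of one such form.\<close>

lemma expectation_sum_orthogonal:
  fixes \<xi> :: "'i \<Rightarrow> 'm \<Rightarrow> real"
  assumes "finite A" and int: "\<And>i j. i \<in> A \<Longrightarrow> j \<in> A \<Longrightarrow> integrable M (\<lambda>\<omega>. \<xi> i \<omega> * \<xi> j \<omega>)"
    and orth: "\<And>i j. i \<in> A \<Longrightarrow> j \<in> A \<Longrightarrow> (\<integral>\<omega>. \<xi> i \<omega> * \<xi> j \<omega> \<partial>M) = (if i = j then v else 0)"
  shows "integrable M (\<lambda>\<omega>. (\<Sum>i\<in>A. a i * \<xi> i \<omega>) * (\<Sum>i\<in>A. b i * \<xi> i \<omega>))"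
    and "(\<integral>\<omega>. (\<Sum>i\<in>A. a i * \<xi> i \<omega>) * (\<Sum>i\<in>A. b i * \<xi> i \<omega>) \<partial>M) = v * (\<Sum>i\<in>A. a i * b i)"
proof -
  have eq: "(\<Sum>i\<in>A. a i * \<xi> i \<omega>) * (\<Sum>i\<in>A. b i * \<xi> i \<omega>)
      = (\<Sum>i\<in>A. \<Sum>j\<in>A. a i * b j * (\<xi> i \<omega> * \<xi> j \<omega>))" for \<omega>
    by (simp add: sum_product algebra_simps)
  show "integrable M (\<lambda>\<omega>. (\<Sum>i\<in>A. a i * \<xi> i \<omega>) * (\<Sum>i\<in>A. b i * \<xi> i \<omega>))"
    unfolding eq using int by auto
  have "(\<integral>\<omega>. (\<Sum>i\<in>A. a i * \<xi> i \<omega>) * (\<Sum>i\<in>A. b i * \<xi> i \<omega>) \<partial>M)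
      = (\<Sum>i\<in>A. \<Sum>j\<in>A. a i * b j * (\<integral>\<omega>. \<xi> i \<omega> * \<xi> j \<omega> \<partial>M))"
    unfolding eq using int by (subst Bochner_Integration.integral_sum; auto)+
  also have "\<dots> = (\<Sum>i\<in>A. \<Sum>j\<in>A. if i = j then a i * b j * v else 0)"
    using orth by (intro sum.cong) auto
  also have "\<dots> = v * (\<Sum>i\<in>A. a i * b i)"
    using assms(1) by (simp add: sum_distrib_left algebra_simps)
  finally show "(\<integral>\<omega>. (\<Sum>i\<in>A. a i * \<xi> i \<omega>) * (\<Sum>i\<in>A. b i * \<xi> i \<omega>) \<partial>M) = v * (\<Sum>i\<in>A. a i * b i)" .
qed

lemma (in prob_space) indep_vars_expectation_mult:
  fixes \<xi> :: "'i \<Rightarrow> 'a \<Rightarrow> real"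
  assumes "indep_vars (\<lambda>_. borel) \<xi> I" "i \<in> I" "j \<in> I" "i \<noteq> j"
    and "integrable M (\<xi> i)" "integrable M (\<xi> j)"
  shows "integrable M (\<lambda>\<omega>. \<xi> i \<omega> * \<xi> j \<omega>)"
    and "expectation (\<lambda>\<omega>. \<xi> i \<omega> * \<xi> j \<omega>) = expectation (\<xi> i) * expectation (\<xi> j)"
proof -
  have ind: "indep_vars (\<lambda>_. borel) \<xi> {i, j}" by (rule indep_vars_subset[OF assms(1)]) (use assms in auto)
  show "integrable M (\<lambda>\<omega>. \<xi> i \<omega> * \<xi> j \<omega>)"
    using indep_vars_integrable[OF _ ind] assms by auto
  show "expectation (\<lambda>\<omega>. \<xi> i \<omega> * \<xi> j \<omega>) = expectation (\<xi> i) * expectation (\<xi> j)"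
    using indep_vars_lebesgue_integral[OF _ ind] assms by auto
qed

section \<open>Independent standard normal coordinates\<close>

text \<open>Indexing the product by the atoms themselves gives a measure on
  \<open>'a \<Rightarrow> real\<close>, the type that the theorem prescribes for the probability
  space of the limit.\<close>

definition white_noise :: "('a \<Rightarrow> real) measure" where
  "white_noise = PiM UNIV (\<lambda>_. normal_law 0 1)"

lemma prob_space_white_noise: "prob_space white_noise"
  unfolding white_noise_def by (intro prob_space_PiM prob_space_normal_law) simp

lemma measurable_white_noise [measurable]: "(\<lambda>\<omega>. \<omega> x) \<in> borel_measurable white_noise"
proof -
  have "(\<lambda>\<omega>. \<omega> x) \<in> white_noise \<rightarrow>\<^sub>M normal_law 0 1"
    unfolding white_noise_def by (rule measurable_component_singleton) simp
  then show ?thesis by (simp cong: measurable_cong_sets)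
qed

lemma distr_white_noise: "distr white_noise borel (\<lambda>\<omega>. \<omega> x) = normal_law 0 1"
proof -
  have "distr white_noise borel (\<lambda>\<omega>. \<omega> x) = distr white_noise (normal_law 0 1) (\<lambda>\<omega>. \<omega> x)"
    by (rule distr_cong) auto
  also have "\<dots> = normal_law 0 1"
    unfolding white_noise_def by (rule distr_PiM_component) (auto intro: prob_space_normal_law)
  finally show ?thesis .
qed

text \<open>The joint map of all coordinates is the identity, so its law is the product of the
  marginals, which characterises independence.\<close>

lemma indep_vars_white_noise:
  "prob_space.indep_vars white_noise (\<lambda>_. borel) (\<lambda>x \<omega>. \<omega> x) UNIV"
proof -
  interpret prob_space "white_noise :: ('a \<Rightarrow> real) measure" by (rule prob_space_white_noise)
  have "distr white_noise (PiM UNIV (\<lambda>_::'a. borel)) (\<lambda>\<omega>. \<lambda>x\<in>UNIV. \<omega> x :: real)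
      = distr white_noise white_noise (\<lambda>\<omega>. \<omega>)"
    by (rule distr_cong) (auto simp: white_noise_def intro!: sets_PiM_cong)
  also have "\<dots> = PiM UNIV (\<lambda>x. distr white_noise borel (\<lambda>\<omega>. \<omega> x))"
    by (simp add: distr_white_noise) (simp add: white_noise_def)
  finally show ?thesis by (subst indep_vars_iff_distr_eq_PiM') auto
qed

lemma distr_white_noise_linear:
  fixes c :: "'a \<Rightarrow> real"
  assumes F: "finite F"
  shows "distr white_noise borel (\<lambda>\<omega>. \<Sum>x\<in>F. c x * \<omega> x) = normal_law 0 (sqrt (\<Sum>x\<in>F. (c x)\<^sup>2))"
proof -
  interpret prob_space "white_noise :: ('a \<Rightarrow> real) measure" by (rule prob_space_white_noise)
  \<comment> \<open>Terms with coefficient \<open>0\<close> have a degenerate law without density,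
    so they are dropped before the normal densities are convolved; if nothing remains, the law is
    the point mass at \<open>0\<close>.\<close>
  define F' where "F' = {x \<in> F. c x \<noteq> 0}"
  have fin: "finite F'" using F by (simp add: F'_def)
  have sums: "(\<Sum>x\<in>F. c x * \<omega> x) = (\<Sum>x\<in>F'. c x * \<omega> x)" "(\<Sum>x\<in>F. (c x)\<^sup>2) = (\<Sum>x\<in>F'. (c x)\<^sup>2)" for \<omega> :: "'a \<Rightarrow> real"
    using F by (auto simp: F'_def intro!: sum.mono_neutral_right)
  show ?thesis
  proof (cases "F' = {}")
    case True
    have "distr (white_noise :: ('a \<Rightarrow> real) measure) borel (\<lambda>\<omega>. 0 :: real) = return borel 0"
      by simp
    then show ?thesis unfolding sums using True by (simp add: normal_law_def)
  next
    case False
    have "distributed white_noise lborel (\<lambda>\<omega>. c x * \<omega> x) (normal_density 0 \<bar>c x\<bar>)" if "x \<in> F'" for x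
    proof -
      have "distributed white_noise lborel (\<lambda>\<omega>. \<omega> x) (normal_density 0 1)"
        using distr_white_noise[of x] unfolding distributed_def
        by (auto simp: normal_law_def cong: distr_cong)
      then have "distributed white_noise lborel (\<lambda>\<omega>. 0 + c x * \<omega> x)
          (normal_density (0 + c x * 0) (\<bar>c x\<bar> * 1))"
        by (rule normal_density_affine) (use that in \<open>auto simp: F'_def\<close>)
      then show ?thesis by simp
    qed
    moreover have "indep_vars (\<lambda>_. borel) (\<lambda>x \<omega>. c x * \<omega> x) F'"
      by (rule indep_vars_compose2[OF indep_vars_subset[OF indep_vars_white_noise]]) auto
    ultimately have "distributed white_noise lborel (\<lambda>\<omega>. \<Sum>x\<in>F'. c x * \<omega> x)
        (normal_density (\<Sum>x\<in>F'. 0) (sqrt (\<Sum>x\<in>F'. \<bar>c x\<bar>\<^sup>2)))"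
      using fin False by (intro sum_indep_normal) (auto simp: F'_def)
    then have "distr white_noise lborel (\<lambda>\<omega>. \<Sum>x\<in>F'. c x * \<omega> x)
        = density lborel (normal_density 0 (sqrt (\<Sum>x\<in>F'. (c x)\<^sup>2)))"
      by (simp add: distributed_def)
    moreover have "distr white_noise lborel (\<lambda>\<omega>. \<Sum>x\<in>F'. c x * \<omega> x)
        = distr white_noise borel (\<lambda>\<omega>. \<Sum>x\<in>F'. c x * \<omega> x)"
      by (rule distr_cong) auto
    moreover have "(\<Sum>x\<in>F'. (c x)\<^sup>2) \<noteq> 0"
      using fin False by (subst sum_nonneg_eq_0_iff) (auto simp: F'_def)
    ultimately show ?thesis unfolding sums by (simp add: normal_law_def)
  qed
qed

lemma white_noise_orthonormal:
  "integrable white_noise (\<lambda>\<omega>. \<omega> x)" "(\<integral>\<omega>. \<omega> x \<partial>white_noise) = 0"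
  "integrable white_noise (\<lambda>\<omega>. \<omega> x * \<omega> y)"
  "(\<integral>\<omega>. \<omega> x * \<omega> y \<partial>white_noise) = (if x = y then 1 else 0)"
proof -
  interpret prob_space "white_noise :: ('a \<Rightarrow> real) measure" by (rule prob_space_white_noise)
  note m = moments_if_distr_normal_law[OF zero_le_one _ distr_white_noise]
  have 1: "integrable white_noise (\<lambda>\<omega>. \<omega> x)" "(\<integral>\<omega>. \<omega> x \<partial>white_noise) = 0"
    "integrable white_noise (\<lambda>\<omega>. \<omega> x * \<omega> x)" "(\<integral>\<omega>. \<omega> x * \<omega> x \<partial>white_noise) = 1" for x :: 'a
    using m[of x] by (simp_all add: power2_eq_square)
  then show "integrable white_noise (\<lambda>\<omega>. \<omega> x)" "(\<integral>\<omega>. \<omega> x \<partial>white_noise) = 0" by auto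
  show "integrable white_noise (\<lambda>\<omega>. \<omega> x * \<omega> y)"
    "(\<integral>\<omega>. \<omega> x * \<omega> y \<partial>white_noise) = (if x = y then 1 else 0)"
    using 1 indep_vars_expectation_mult[OF indep_vars_white_noise, of x y] by (cases "x = y"; auto)+
qed

section \<open>A Brownian bridge at discrete times\<close>

lemma initial_0 [simp]: "initial 0 = {}"
  by (simp add: initial_def)

lemma initial_Suc_to_nat_on:
  assumes "countable (UNIV :: 'a set)"
  shows "initial (Suc (to_nat_on UNIV x)) = insert (x :: 'a) (initial (to_nat_on UNIV x))"
  using inj_on_to_nat_on[OF assms] by (auto simp: initial_def less_Suc_eq inj_on_def)

lemma initial_Suc_eq:
  assumes "\<And>x :: 'a. to_nat_on UNIV x \<noteq> n"
  shows "initial (Suc n) = (initial n :: 'a set)"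
  using assms by (auto simp: initial_def less_Suc_eq)

lemma not_in_initial_to_nat_on [simp]: "x \<notin> initial (to_nat_on UNIV x)"
  by (simp add: initial_def)

text \<open>With \<^term>\<open>mass_left r n\<close> the mass outside the first \<^term>\<open>n\<close> atoms, the following process is the
  sequence of increments of a Brownian bridge at the times \<^term>\<open>1 - mass_left r n\<close>.
  It uses that a Brownian bridge at time \<open>t\<close>, divided by \<open>1 - t\<close>, has independent increments
  with variance \<open>1 / (1 - t) - 1\<close>. If no mass is left, division by zero makes the coefficients \<open>0\<close>.\<close>

definition mass_left :: "'a pmf \<Rightarrow> nat \<Rightarrow> real" where
  "mass_left r n = 1 - (\<Sum>y\<in>initial n. pmf r y)"

text \<open>With \<open>R\<close> and \<open>R'\<close> the mass left before and after
  \<open>y\<close>, the radicand is \<open>1 / R' - 1 / R\<close> when both are positive: the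
  variance of the corresponding increment of the bridge divided by the mass left.\<close>

definition bridge_coeff :: "'a pmf \<Rightarrow> 'a \<Rightarrow> real" where
  "bridge_coeff r y =
     sqrt (pmf r y / (mass_left r (to_nat_on UNIV y) * mass_left r (Suc (to_nat_on UNIV y))))"

text \<open>Let \<open>S\<close> be the sum of \<open>bridge_coeff r y * \<omega> y\<close> over the
  atoms before \<open>x\<close>. The bridge moves from \<open>R * S\<close> to
  \<open>R' * (S + bridge_coeff r x * \<omega> x)\<close>. Since \<open>R' - R = - pmf r x\<close>,
  the increment has coefficient \<open>R' * bridge_coeff r x\<close> at \<open>x\<close> and
  \<open>- pmf r x * bridge_coeff r y\<close> at earlier \<open>y\<close>.\<close>

definition bridge_matrix :: "'a pmf \<Rightarrow> 'a \<Rightarrow> 'a \<Rightarrow> real" where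
  "bridge_matrix r x y =
     (if y = x then mass_left r (Suc (to_nat_on UNIV x)) * bridge_coeff r x
      else if y \<in> initial (to_nat_on UNIV x) then - pmf r x * bridge_coeff r y else 0)"

definition bridge_process :: "'a pmf \<Rightarrow> ('a \<Rightarrow> real) \<Rightarrow> 'a \<Rightarrow> real" where
  "bridge_process r \<omega> x = (\<Sum>y\<in>initial (Suc (to_nat_on UNIV x)). bridge_matrix r x y * \<omega> y)"

context
  fixes r :: "'a pmf"
  assumes c: "countable (UNIV :: 'a set)"
begin

lemma mass_left_nonneg: "mass_left r n \<ge> 0"
  using measure_pmf.prob_le_1[of r "initial n"] finite_initial[OF c, of n]
  by (simp add: mass_left_def measure_measure_pmf_finite)

lemma mass_left_Suc: "mass_left r (Suc (to_nat_on UNIV x)) = mass_left r (to_nat_on UNIV x) - pmf r x"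
  using finite_initial[OF c] by (simp add: mass_left_def initial_Suc_to_nat_on[OF c])

lemma mass_left_antimono: "m \<le> n \<Longrightarrow> mass_left r n \<le> mass_left r m"
  unfolding mass_left_def using initial_mono[of m n] finite_initial[OF c, of n]
  by (auto intro!: sum_mono2)

lemma bridge_coeff_square:
  "(bridge_coeff r y)\<^sup>2 =
     pmf r y / (mass_left r (to_nat_on UNIV y) * mass_left r (Suc (to_nat_on UNIV y)))"
  using mass_left_nonneg by (simp add: bridge_coeff_def)

text \<open>The squared coefficients are differences of \<open>1 / mass_left\<close>, so the sum
  telescopes from \<open>mass_left r 0 = 1\<close>.\<close>

lemma sum_bridge_coeff:
  "mass_left r n > 0 \<Longrightarrow> (\<Sum>y\<in>initial n. (bridge_coeff r y)\<^sup>2) = 1 / mass_left r n - 1"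
proof (induction n)
  case 0
  then show ?case by (simp add: mass_left_def)
next
  case (Suc n)
  have pos: "mass_left r n > 0" using Suc.prems mass_left_antimono[of n "Suc n"] by simp
  show ?case
  proof (cases "\<exists>x :: 'a. to_nat_on UNIV x = n")
    case True
    then obtain x :: 'a where 1: "to_nat_on UNIV x = n" ..
    have "(\<Sum>y\<in>initial (Suc n). (bridge_coeff r y)\<^sup>2)
        = pmf r x / (mass_left r n * mass_left r (Suc n)) + (1 / mass_left r n - 1)"
      using Suc.IH[OF pos] finite_initial[OF c]
      unfolding 1[symmetric] initial_Suc_to_nat_on[OF c]
      by (subst sum.insert) (auto simp: bridge_coeff_square)
    also have "pmf r x = mass_left r n - mass_left r (Suc n)"
      using mass_left_Suc[of x] 1 by simp
    also have "(mass_left r n - mass_left r (Suc n)) / (mass_left r n * mass_left r (Suc n))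
        + (1 / mass_left r n - 1) = 1 / mass_left r (Suc n) - 1"
      using pos Suc.prems by (simp add: field_simps)
    finally show ?thesis .
  next
    case False
    \<comment> \<open>Such an \<open>n\<close> carries no atom, as happens beyond the cardinality of
      a finite type; nothing is added at this step.\<close>
    then have 2: "initial (Suc n) = (initial n :: 'a set)" by (intro initial_Suc_eq) auto
    then have "mass_left r (Suc n) = mass_left r n" by (simp add: mass_left_def)
    then show ?thesis using 2 Suc.IH[OF pos] by simp
  qed
qed

text \<open>Row \<open>x\<close> vanishes beyond the position of \<open>x\<close>. Rows of different
  atoms can thus be summed over one common initial segment.\<close>

lemma bridge_matrix_neutral:
  assumes "to_nat_on UNIV x < n"
  shows "(\<Sum>y\<in>initial n. bridge_matrix r x y * f y)
    = (\<Sum>y\<in>initial (Suc (to_nat_on UNIV x)). bridge_matrix r x y * f y)"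
proof (rule sum.mono_neutral_right)
  show "\<forall>y\<in>initial n - initial (Suc (to_nat_on UNIV x)). bridge_matrix r x y * f y = 0"
    by (auto simp: bridge_matrix_def initial_def)
qed (use assms initial_mono[of "Suc (to_nat_on UNIV x)" n] finite_initial[OF c] in auto)

text \<open>Write \<open>r\<close>, \<open>r'\<close> for the masses of \<open>x\<close>,
  \<open>x'\<close>. If no denominator vanishes, the diagonal entry is
  \<open>R' * r / R + r\<^sup>2 * (1 / R - 1)\<close>, which is \<open>r * (1 - r)\<close> as
  \<open>R' + r = R\<close>. For \<open>x\<close> before \<open>x'\<close> the entry is
  \<open>- r' * r / R + r * r' * (1 / R - 1) = - r * r'\<close>.\<close>

lemma bridge_matrix_cov:
  assumes "to_nat_on UNIV x < n" "to_nat_on UNIV x' < n"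
  shows "(\<Sum>y\<in>initial n. bridge_matrix r x y * bridge_matrix r x' y) = multinomial_cov r x x'"
proof -
  have diag: "(\<Sum>y\<in>initial n. bridge_matrix r x y * bridge_matrix r x y) = multinomial_cov r x x"
    if x: "to_nat_on UNIV x < n" for x
  proof -
    let ?e = "to_nat_on UNIV x"
    let ?R = "mass_left r ?e" and ?R' = "mass_left r (Suc ?e)"
    have "(\<Sum>y\<in>initial n. bridge_matrix r x y * bridge_matrix r x y)
        = (?R' * bridge_coeff r x)\<^sup>2 + (\<Sum>y\<in>initial ?e. bridge_matrix r x y * bridge_matrix r x y)"
      using finite_initial[OF c, of ?e] unfolding bridge_matrix_neutral[OF x] initial_Suc_to_nat_on[OF c]
      by (subst sum.insert) (auto simp: bridge_matrix_def power2_eq_square)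
    also have "(\<Sum>y\<in>initial ?e. bridge_matrix r x y * bridge_matrix r x y)
        = (\<Sum>y\<in>initial ?e. (pmf r x)\<^sup>2 * (bridge_coeff r y)\<^sup>2)"
      by (intro sum.cong) (auto simp: bridge_matrix_def power2_eq_square initial_def)
    also have "(?R' * bridge_coeff r x)\<^sup>2 = ?R'\<^sup>2 * pmf r x / (?R * ?R')"
      by (simp add: power_mult_distrib bridge_coeff_square)
    finally have *: "(\<Sum>y\<in>initial n. bridge_matrix r x y * bridge_matrix r x y)
        = ?R'\<^sup>2 * pmf r x / (?R * ?R') + (pmf r x)\<^sup>2 * (\<Sum>y\<in>initial ?e. (bridge_coeff r y)\<^sup>2)"
      by (simp add: sum_distrib_left)
    show ?thesis
    proof (cases "?R > 0")
      case True
      have r: "pmf r x = ?R - ?R'" using mass_left_Suc[of x] by simp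
      \<comment> \<open>If \<open>?R' = 0\<close>, then \<open>x\<close> carries all the remaining
        mass. Its own noise term vanishes by division by zero, and
        \<open>r\<^sup>2 * (1 / r - 1)\<close> is already the required variance.\<close>
      show ?thesis
        unfolding * sum_bridge_coeff[OF True] multinomial_cov_def r using True
        by (cases "?R' = 0") (simp_all add: field_simps power2_eq_square)
    next
      case False
      then have "pmf r x = 0"
        using mass_left_nonneg[of ?e] mass_left_nonneg[of "Suc ?e"] mass_left_Suc[of x] pmf_nonneg[of r x]
        by linarith
      then show ?thesis unfolding * by (simp add: multinomial_cov_def)
    qed
  qed
  have off: "(\<Sum>y\<in>initial n. bridge_matrix r x y * bridge_matrix r x' y) = - pmf r x * pmf r x'"
    if xx': "to_nat_on UNIV x < to_nat_on UNIV x'" and n: "to_nat_on UNIV x' < n" for x x'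
  proof -
    let ?e = "to_nat_on UNIV x"
    let ?R = "mass_left r ?e" and ?R' = "mass_left r (Suc ?e)"
    have "(\<Sum>y\<in>initial n. bridge_matrix r x y * bridge_matrix r x' y)
        = bridge_matrix r x x * bridge_matrix r x' x
          + (\<Sum>y\<in>initial ?e. bridge_matrix r x y * bridge_matrix r x' y)"
      using finite_initial[OF c, of ?e] xx' n
      by (subst bridge_matrix_neutral, simp, unfold initial_Suc_to_nat_on[OF c], subst sum.insert) auto
    also have "bridge_matrix r x x * bridge_matrix r x' x = - pmf r x' * (?R' * (bridge_coeff r x)\<^sup>2)"
      using xx' by (auto simp: bridge_matrix_def initial_def power2_eq_square)
    also have "(\<Sum>y\<in>initial ?e. bridge_matrix r x y * bridge_matrix r x' y)
        = (\<Sum>y\<in>initial ?e. pmf r x * pmf r x' * (bridge_coeff r y)\<^sup>2)"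
      using xx' by (intro sum.cong) (auto simp: bridge_matrix_def power2_eq_square initial_def)
    finally have *: "(\<Sum>y\<in>initial n. bridge_matrix r x y * bridge_matrix r x' y)
        = - pmf r x' * (?R' * (pmf r x / (?R * ?R')))
          + pmf r x * pmf r x' * (\<Sum>y\<in>initial ?e. (bridge_coeff r y)\<^sup>2)"
      by (simp add: sum_distrib_left bridge_coeff_square)
    show ?thesis
    proof (cases "?R' > 0")
      case True
      then have R: "?R > 0" using mass_left_antimono[of ?e "Suc ?e"] by simp
      show ?thesis unfolding * sum_bridge_coeff[OF R] using True R by (simp add: field_simps)
    next
      case False
      \<comment> \<open>No mass is left after \<open>x\<close>, so the later atom \<open>x'\<close>
        has probability \<open>0\<close> and both sides vanish.\<close>
      have "mass_left r (to_nat_on UNIV x') \<le> ?R'" using xx' by (intro mass_left_antimono) simp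
      then have "pmf r x' = 0"
        using False mass_left_nonneg[of "Suc (to_nat_on UNIV x')"] mass_left_Suc[of x'] pmf_nonneg[of r x']
        by linarith
      then show ?thesis unfolding * by simp
    qed
  qed
  consider "x = x'" | "to_nat_on UNIV x < to_nat_on UNIV x'" | "to_nat_on UNIV x' < to_nat_on UNIV x"
    using inj_on_to_nat_on[OF c] by (meson UNIV_I inj_onD linorder_less_linear)
  then show ?thesis
  proof cases
    case 1
    then show ?thesis using diag assms by simp
  next
    case 2
    then show ?thesis using off[OF 2 assms(2)] by (auto simp: multinomial_cov_def)
  next
    case 3
    then show ?thesis using off[OF 3 assms(1)] by (auto simp: multinomial_cov_def mult.commute)
  qed
qed

lemma gaussian_process_bridge:
  "gaussian_process white_noise (bridge_process r) (\<lambda>_. 0) (multinomial_cov r)"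
  unfolding gaussian_process_def
proof (intro conjI allI impI)
  show "prob_space (white_noise :: ('a \<Rightarrow> real) measure)" by (rule prob_space_white_noise)
  show "(\<lambda>\<omega>. bridge_process r \<omega> x) \<in> borel_measurable white_noise" for x
    unfolding bridge_process_def by measurable
  show mean: "(\<integral>\<omega>. bridge_process r \<omega> x \<partial>white_noise) = 0" for x
    unfolding bridge_process_def
    by (subst Bochner_Integration.integral_sum)
       (auto intro!: integrable_mult_right simp: white_noise_orthonormal)
  have extend: "bridge_process r \<omega> x = (\<Sum>y\<in>initial n. bridge_matrix r x y * \<omega> y)"
    if "to_nat_on UNIV x < n" for \<omega> x n
    unfolding bridge_process_def using bridge_matrix_neutral[OF that, of \<omega>] by simp
  show "(\<integral>\<omega>. (bridge_process r \<omega> x - 0) * (bridge_process r \<omega> x' - 0) \<partial>white_noise)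
      = multinomial_cov r x x'" for x x'
  proof -
    define n where "n = Suc (max (to_nat_on UNIV x) (to_nat_on UNIV x'))"
    have n: "to_nat_on UNIV x < n" "to_nat_on UNIV x' < n" by (auto simp: n_def)
    have "(\<integral>\<omega>. bridge_process r \<omega> x * bridge_process r \<omega> x' \<partial>white_noise)
        = 1 * (\<Sum>y\<in>initial n. bridge_matrix r x y * bridge_matrix r x' y)"
      unfolding extend[OF n(1)] extend[OF n(2)]
      by (rule expectation_sum_orthogonal(2)[OF finite_initial[OF c] white_noise_orthonormal(3,4)])
    then show ?thesis using bridge_matrix_cov[OF n] by simp
  qed
  fix F :: "'a set" and b :: "'a \<Rightarrow> real" assume F: "finite F"
  obtain n where n: "F \<subseteq> initial n" using finite_subset_initial[OF F] by blast
  \<comment> \<open>Exchanging two finite sums turns a combination of coordinates into one linear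
    form in the white noise, whose law is known.\<close>
  have "(\<Sum>x\<in>F. b x * bridge_process r \<omega> x)
      = (\<Sum>y\<in>initial n. (\<Sum>x\<in>F. b x * bridge_matrix r x y) * \<omega> y)" for \<omega>
  proof -
    have "(\<Sum>x\<in>F. b x * bridge_process r \<omega> x)
        = (\<Sum>x\<in>F. \<Sum>y\<in>initial n. b x * bridge_matrix r x y * \<omega> y)"
      using n by (intro sum.cong) (auto simp: initial_def extend sum_distrib_left mult.assoc)
    also have "\<dots> = (\<Sum>y\<in>initial n. \<Sum>x\<in>F. b x * bridge_matrix r x y * \<omega> y)" by (rule sum.swap)
    finally show ?thesis by (simp add: sum_distrib_right)
  qed
  then have "distr white_noise borel (\<lambda>\<omega>. \<Sum>x\<in>F. b x * bridge_process r \<omega> x)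
      = normal_law 0 (sqrt (\<Sum>y\<in>initial n. (\<Sum>x\<in>F. b x * bridge_matrix r x y)\<^sup>2))"
    by (simp add: distr_white_noise_linear[OF finite_initial[OF c]])
  then show "\<exists>\<mu> \<sigma>. 0 \<le> \<sigma> \<and>
      distr white_noise borel (\<lambda>\<omega>. \<Sum>x\<in>F. b x * bridge_process r \<omega> x) = normal_law \<mu> \<sigma>"
    by (intro exI conjI) (auto intro: sum_nonneg)
qed

end

section \<open>From characteristic functions to finite-dimensional convergence\<close>

text \<open>Clipping moves \<open>u\<close> only if \<open>\<bar>u\<bar> > K\<close>, and then by at
  most \<open>\<bar>u\<bar> \<le> u\<^sup>2 / K\<close>. Bounded second moments therefore make
  clipping harmless uniformly in \<open>n\<close>.\<close>

lemma abs_clip_diff_le: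
  fixes u K :: real
  assumes "K > 0"
  shows "\<bar>u - max (- K) (min K u)\<bar> \<le> u\<^sup>2 / K"
proof (cases "\<bar>u\<bar> \<le> K")
  case True
  then show ?thesis using assms by (auto simp: max_def min_def)
next
  case False
  then have "\<bar>u - max (- K) (min K u)\<bar> \<le> \<bar>u\<bar>" using assms by (auto simp: max_def min_def)
  also have "\<dots> \<le> u\<^sup>2 / K"
  proof -
    have "K * \<bar>u\<bar> \<le> \<bar>u\<bar> * \<bar>u\<bar>" using False by (intro mult_right_mono) auto
    then show ?thesis using assms by (simp add: field_simps power2_eq_square)
  qed
  finally show ?thesis .
qed

section \<open>Tilted laws in dimension one\<close>

text \<open>The positive lower bound on \<open>H\<close> passes to its expectation, so the
  normalised weight is a probability density and integrals under the tilted law are ratios of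
  weighted expectations.\<close>

lemma (in prob_space) real_distribution_density:
  fixes H W :: "'a \<Rightarrow> real" and f :: "real \<Rightarrow> 'c :: {banach, second_countable_topology}"
  assumes [measurable]: "H \<in> borel_measurable M" "W \<in> borel_measurable M"
    and H: "\<And>\<omega>. a \<le> H \<omega>" "\<And>\<omega>. H \<omega> \<le> b" and a: "a > 0"
  defines "D \<equiv> density M (\<lambda>\<omega>. ennreal (H \<omega> / expectation H))"
  shows "expectation H \<ge> a"
    and "real_distribution (distr D borel W)"
    and "f \<in> borel_measurable borel \<Longrightarrow>
      (\<integral>x. f x \<partial>distr D borel W) = (\<integral>\<omega>. H \<omega> *\<^sub>R f (W \<omega>) \<partial>M) /\<^sub>R expectation H"
proof -
  have H0: "H \<omega> > 0" for \<omega> using H(1)[of \<omega>] a by linarith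
  have Hb: "norm (H \<omega>) \<le> b" for \<omega> using H(2)[of \<omega>] H0[of \<omega>] by simp
  have intH: "integrable M H" by (rule integrable_const_bound[of _ b]) (use Hb in auto)
  show ge: "expectation H \<ge> a"
    using integral_mono[of M "\<lambda>_. a" H] H intH by (simp add: prob_space)
  then have pos: "expectation H > 0" using a by linarith
  have "prob_space D"
  proof
    have "emeasure D (space D) = (\<integral>\<^sup>+\<omega>. ennreal (H \<omega> / expectation H) \<partial>M)"
      by (simp add: D_def emeasure_density cong: nn_integral_cong)
    also have "\<dots> = ennreal (\<integral>\<omega>. H \<omega> / expectation H \<partial>M)"
      using intH H0 pos by (intro nn_integral_eq_integral) (auto simp: less_imp_le)
    also have "(\<integral>\<omega>. H \<omega> / expectation H \<partial>M) = 1" using pos by simp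
    finally show "emeasure D (space D) = 1" by simp
  qed
  then interpret D: prob_space D .
  have WD [measurable]: "W \<in> borel_measurable D" by (simp add: D_def)
  show "real_distribution (distr D borel W)" by (rule D.real_distribution_distr) simp
  assume [measurable]: "f \<in> borel_measurable borel"
  have "(\<integral>x. f x \<partial>distr D borel W) = (\<integral>\<omega>. f (W \<omega>) \<partial>D)" by (rule integral_distr) auto
  also have "\<dots> = (\<integral>\<omega>. (H \<omega> / expectation H) *\<^sub>R f (W \<omega>) \<partial>M)"
    unfolding D_def using H0 pos by (intro integral_density) (auto simp: less_imp_le)
  also have "\<dots> = (\<integral>\<omega>. (1 / expectation H) *\<^sub>R (H \<omega> *\<^sub>R f (W \<omega>)) \<partial>M)" by simp
  also have "\<dots> = (1 / expectation H) *\<^sub>R (\<integral>\<omega>. H \<omega> *\<^sub>R f (W \<omega>) \<partial>M)"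
    by (rule integral_scaleR_right)
  finally show "(\<integral>x. f x \<partial>distr D borel W) = (\<integral>\<omega>. H \<omega> *\<^sub>R f (W \<omega>) \<partial>M) /\<^sub>R expectation H"
    by (simp add: divide_inverse)
qed

text \<open>The hypothesis at \<open>s = 0\<close> is convergence of the normalising constants.
  Division by them turns the hypothesis into convergence of characteristic functions of the tilted
  laws; after the continuity theorem the constants are multiplied back.\<close>

lemma weighted_levy_continuity:
  fixes U :: "nat \<Rightarrow> 'p \<Rightarrow> real" and W :: "'q \<Rightarrow> real" and H :: "nat \<Rightarrow> 'p \<Rightarrow> real" and K :: "'q \<Rightarrow> real"
  assumes P: "prob_space P" and Q: "prob_space Q"
    and [measurable]: "\<And>n. U n \<in> borel_measurable P" "W \<in> borel_measurable Q"
      "\<And>n. H n \<in> borel_measurable P" "K \<in> borel_measurable Q"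
    and bH: "\<And>n \<omega>. a \<le> H n \<omega>" "\<And>n \<omega>. H n \<omega> \<le> b" and bK: "\<And>\<omega>. a \<le> K \<omega>" "\<And>\<omega>. K \<omega> \<le> b" and a: "a > 0"
    and conv: "\<And>s. (\<lambda>n. \<integral>\<omega>. H n \<omega> *\<^sub>R cis (s * U n \<omega>) \<partial>P) \<longlonglongrightarrow> (\<integral>\<omega>. K \<omega> *\<^sub>R cis (s * W \<omega>) \<partial>Q)"
    and g: "\<And>x. isCont g x" "\<And>x. \<bar>g x\<bar> \<le> C"
  shows "(\<lambda>n. \<integral>\<omega>. H n \<omega> * g (U n \<omega>) \<partial>P) \<longlonglongrightarrow> (\<integral>\<omega>. K \<omega> * g (W \<omega>) \<partial>Q)"
proof -
  interpret P: prob_space P by fact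
  interpret Q: prob_space Q by fact
  note wP = P.real_distribution_density[of "H n" "U n" a b for n, OF _ _ bH a]
  note wQ = Q.real_distribution_density[of K W a b, OF _ _ bK a]
  define h where "h n = P.expectation (H n)" for n
  define k where "k = Q.expectation K"
  define \<mu> where "\<mu> n = distr (density P (\<lambda>\<omega>. ennreal (H n \<omega> / h n))) borel (U n)" for n
  define \<nu> where "\<nu> = distr (density Q (\<lambda>\<omega>. ennreal (K \<omega> / k))) borel W"
  have h: "h n > 0" "h n \<noteq> 0" for n using wP(1)[of n] a by (auto simp: h_def)
  have k: "k > 0" "k \<noteq> 0" using wQ(1) a by (auto simp: k_def)
  have hk: "h \<longlonglongrightarrow> k"
  proof -
    have "(\<lambda>n. complex_of_real (h n)) \<longlonglongrightarrow> complex_of_real k"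
      using conv[of 0] by (simp add: h_def k_def scaleR_conv_of_real integral_of_real)
    then show ?thesis by (simp only: tendsto_of_real_iff)
  qed
  have g_meas [measurable]: "g \<in> borel_measurable borel"
    using g(1) by (intro borel_measurable_continuous_onI continuous_at_imp_continuous_on) auto
  have rd: "real_distribution (\<mu> n)" "real_distribution \<nu>" for n
    using wP(2)[of n] wQ(2) by (auto simp: \<mu>_def \<nu>_def h_def k_def)
  have "weak_conv_m \<mu> \<nu>"
  proof (rule levy_continuity[OF rd])
    fix s
    have "char (\<mu> n) s = (\<integral>\<omega>. H n \<omega> *\<^sub>R cis (s * U n \<omega>) \<partial>P) /\<^sub>R h n" for n
      unfolding char_def \<mu>_def h_def by (subst wP(3)) (auto simp: cis_conv_exp)
    moreover have "char \<nu> s = (\<integral>\<omega>. K \<omega> *\<^sub>R cis (s * W \<omega>) \<partial>Q) /\<^sub>R k"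
      unfolding char_def \<nu>_def k_def by (subst wQ(3)) (auto simp: cis_conv_exp)
    ultimately show "(\<lambda>n. char (\<mu> n) s) \<longlonglongrightarrow> char \<nu> s"
      using hk k conv by (auto intro!: tendsto_intros)
  qed
  then have "(\<lambda>n. \<integral>x. g x \<partial>\<mu> n) \<longlonglongrightarrow> (\<integral>x. g x \<partial>\<nu>)"
    by (rule weak_conv_imp_integral_bdd_continuous_conv[OF rd _ g(1)]) (use g(2) in auto)
  moreover have "(\<integral>x. g x \<partial>\<mu> n) = (\<integral>\<omega>. H n \<omega> * g (U n \<omega>) \<partial>P) / h n" for n
    unfolding \<mu>_def h_def by (subst wP(3)) (auto simp: divide_inverse)
  moreover have "(\<integral>x. g x \<partial>\<nu>) = (\<integral>\<omega>. K \<omega> * g (W \<omega>) \<partial>Q) / k"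
    unfolding \<nu>_def k_def by (subst wQ(3)) (auto simp: divide_inverse)
  ultimately have "(\<lambda>n. (\<integral>\<omega>. H n \<omega> * g (U n \<omega>) \<partial>P) / h n * h n) \<longlonglongrightarrow> (\<integral>\<omega>. K \<omega> * g (W \<omega>) \<partial>Q) / k * k"
    using hk by (intro tendsto_mult) simp_all
  then show ?thesis using h k by simp
qed

lemma borel_measurable_cis [measurable]: "cis \<in> borel_measurable borel"
  by (intro borel_measurable_continuous_onI continuous_intros)

section \<open>Joint convergence of finitely many coordinates\<close>

text \<open>The situation after the Cramer-Wold reduction: the joint characteristic function of the
  coordinates in \<open>F\<close> converges at every frequency vector \<open>t\<close>.\<close>

locale char_convergence = P: prob_space P + Q: prob_space Q
  for P :: "'p measure" and Q :: "'q measure" +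
  fixes V :: "nat \<Rightarrow> 'p \<Rightarrow> 'a \<Rightarrow> real" and G :: "'q \<Rightarrow> 'a \<Rightarrow> real" and F :: "'a set"
  assumes measurable_V [measurable]: "\<And>n x. (\<lambda>\<omega>. V n \<omega> x) \<in> borel_measurable P"
    and measurable_G [measurable]: "\<And>x. (\<lambda>\<omega>. G \<omega> x) \<in> borel_measurable Q"
    and finite_F: "finite F"
    and char_tendsto: "\<And>t. (\<lambda>n. \<integral>\<omega>. cis (\<Sum>x\<in>F. t x * V n \<omega> x) \<partial>P) \<longlonglongrightarrow> (\<integral>\<omega>. cis (\<Sum>x\<in>F. t x * G \<omega> x) \<partial>Q)"
begin

text \<open>Convergence with the weight \<open>h\<close> inserted into the joint characteristic
  function. Demanding it at every \<open>t\<close>, not only at \<open>0\<close>, makes the property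
  inductive: it survives multiplication of \<open>h\<close> by a function of one coordinate.\<close>

definition good :: "(('a \<Rightarrow> real) \<Rightarrow> real) \<Rightarrow> bool" where
  "good h \<longleftrightarrow> (\<forall>n. (\<lambda>\<omega>. h (V n \<omega>)) \<in> borel_measurable P) \<and> (\<lambda>\<omega>. h (G \<omega>)) \<in> borel_measurable Q \<and>
     (\<exists>C. \<forall>y. \<bar>h y\<bar> \<le> C) \<and>
     (\<forall>t. (\<lambda>n. \<integral>\<omega>. h (V n \<omega>) *\<^sub>R cis (\<Sum>x\<in>F. t x * V n \<omega> x) \<partial>P)
        \<longlonglongrightarrow> (\<integral>\<omega>. h (G \<omega>) *\<^sub>R cis (\<Sum>x\<in>F. t x * G \<omega> x) \<partial>Q))"

lemma goodD:
  assumes "good h"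
  shows "(\<lambda>\<omega>. h (V n \<omega>)) \<in> borel_measurable P" "(\<lambda>\<omega>. h (G \<omega>)) \<in> borel_measurable Q"
    "\<exists>C. \<forall>y. \<bar>h y\<bar> \<le> C"
    "(\<lambda>n. \<integral>\<omega>. h (V n \<omega>) *\<^sub>R cis (\<Sum>x\<in>F. t x * V n \<omega> x) \<partial>P)
        \<longlonglongrightarrow> (\<integral>\<omega>. h (G \<omega>) *\<^sub>R cis (\<Sum>x\<in>F. t x * G \<omega> x) \<partial>Q)"
  using assms by (auto simp: good_def)

lemma good_tendsto:
  assumes "good h"
  shows "(\<lambda>n. \<integral>\<omega>. h (V n \<omega>) \<partial>P) \<longlonglongrightarrow> (\<integral>\<omega>. h (G \<omega>) \<partial>Q)"
proof -
  have "(\<lambda>n. complex_of_real (\<integral>\<omega>. h (V n \<omega>) \<partial>P)) \<longlonglongrightarrow> complex_of_real (\<integral>\<omega>. h (G \<omega>) \<partial>Q)"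
    using goodD(4)[OF assms, of "\<lambda>_. 0"] by (simp add: scaleR_conv_of_real integral_of_real)
  then show ?thesis by (simp only: tendsto_of_real_iff)
qed

lemma good_integrable:
  assumes "good h"
  shows "integrable P (\<lambda>\<omega>. h (V n \<omega>) *\<^sub>R cis (\<Sum>x\<in>F. t x * V n \<omega> x))"
    and "integrable Q (\<lambda>\<omega>. h (G \<omega>) *\<^sub>R cis (\<Sum>x\<in>F. t x * G \<omega> x))"
proof -
  obtain C where C: "\<And>y. \<bar>h y\<bar> \<le> C" using goodD(3)[OF assms] by blast
  note [measurable] = goodD(1,2)[OF assms]
  show "integrable P (\<lambda>\<omega>. h (V n \<omega>) *\<^sub>R cis (\<Sum>x\<in>F. t x * V n \<omega> x))"
    by (rule P.integrable_const_bound[of _ C]) (use C in auto)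
  show "integrable Q (\<lambda>\<omega>. h (G \<omega>) *\<^sub>R cis (\<Sum>x\<in>F. t x * G \<omega> x))"
    by (rule Q.integrable_const_bound[of _ C]) (use C in auto)
qed

lemma good_cmult:
  assumes "good h"
  shows "good (\<lambda>y. c * h y)"
proof -
  obtain C where C: "\<And>y. \<bar>h y\<bar> \<le> C" using goodD(3)[OF assms] by blast
  have "\<bar>c * h y\<bar> \<le> \<bar>c\<bar> * C" for y using C[of y] by (simp add: abs_mult mult_left_mono)
  moreover have "(\<lambda>n. c *\<^sub>R (\<integral>\<omega>. h (V n \<omega>) *\<^sub>R cis (\<Sum>x\<in>F. t x * V n \<omega> x) \<partial>P))
      \<longlonglongrightarrow> c *\<^sub>R (\<integral>\<omega>. h (G \<omega>) *\<^sub>R cis (\<Sum>x\<in>F. t x * G \<omega> x) \<partial>Q)" for t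
    by (intro tendsto_intros goodD(4) assms)
  ultimately show ?thesis
    using goodD(1,2)[OF assms] unfolding good_def by (auto simp flip: integral_scaleR_right)
qed

lemma good_add:
  assumes "good h" "good h'"
  shows "good (\<lambda>y. h y + h' y)"
proof -
  obtain C C' where C: "\<And>y. \<bar>h y\<bar> \<le> C" "\<And>y. \<bar>h' y\<bar> \<le> C'" using goodD(3) assms by metis
  have "\<bar>h y + h' y\<bar> \<le> C + C'" for y using C(1)[of y] C(2)[of y] by linarith
  moreover have "(\<lambda>n. \<integral>\<omega>. (h (V n \<omega>) + h' (V n \<omega>)) *\<^sub>R cis (\<Sum>x\<in>F. t x * V n \<omega> x) \<partial>P)
      \<longlonglongrightarrow> (\<integral>\<omega>. (h (G \<omega>) + h' (G \<omega>)) *\<^sub>R cis (\<Sum>x\<in>F. t x * G \<omega> x) \<partial>Q)" for t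
    unfolding scaleR_add_left
      Bochner_Integration.integral_add[OF good_integrable(1)[OF assms(1)] good_integrable(1)[OF assms(2)]]
      Bochner_Integration.integral_add[OF good_integrable(2)[OF assms(1)] good_integrable(2)[OF assms(2)]]
    by (intro tendsto_intros goodD(4) assms)
  ultimately show ?thesis
    using goodD(1,2)[OF assms(1)] goodD(1,2)[OF assms(2)] unfolding good_def by auto
qed

lemma good_const: "good (\<lambda>_. c)"
proof -
  have "good (\<lambda>_. 1)" unfolding good_def using char_tendsto by (auto intro: exI[of _ 1])
  from good_cmult[OF this, of c] show ?thesis by simp
qed

text \<open>Tilting the laws by the weight \<open>h * (2 + \<phi>(t \<bullet> y))\<close>, where \<open>\<phi>\<close> is \<^const>\<open>cos\<close> or \<^const>\<open>sin\<close>,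
  reduces the joint statement to the one-dimensional continuity theorem for the coordinate \<open>y x\<close>.\<close>

lemma good_mult_coordinate_trig:
  assumes h: "good h" "\<And>y. 1 \<le> h y" and x: "x \<in> F" and g: "\<And>u. isCont g u" "\<And>u. \<bar>g u\<bar> \<le> C"
    and \<phi>: "\<And>u. complex_of_real (\<phi> u) = \<alpha> * cis u + \<beta> * cis (- u)" "\<And>u. \<bar>\<phi> u\<bar> \<le> 1"
      "\<phi> \<in> borel_measurable borel"
  shows "(\<lambda>n. \<integral>\<omega>. h (V n \<omega>) * (2 + \<phi> (\<Sum>x\<in>F. t x * V n \<omega> x)) * g (V n \<omega> x) \<partial>P)
      \<longlonglongrightarrow> (\<integral>\<omega>. h (G \<omega>) * (2 + \<phi> (\<Sum>x\<in>F. t x * G \<omega> x)) * g (G \<omega> x) \<partial>Q)"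
proof -
  obtain B where B: "\<And>y. \<bar>h y\<bar> \<le> B" using goodD(3)[OF h(1)] by blast
  note [measurable] = goodD(1,2)[OF h(1)] \<phi>(3)
  \<comment> \<open>The constant \<open>2\<close> puts \<open>2 + \<phi>\<close> between
    \<open>1\<close> and \<open>3\<close>; with \<open>h \<ge> 1\<close> the product is a weight
    bounded below by \<open>1\<close>.\<close>
  have b: "1 \<le> h y * (2 + \<phi> u)" "h y * (2 + \<phi> u) \<le> B * 3" for y u
  proof -
    have u: "1 \<le> 2 + \<phi> u" "2 + \<phi> u \<le> 3" using \<phi>(2)[of u] by linarith+
    show "1 \<le> h y * (2 + \<phi> u)" using mult_mono[of 1 "h y" 1 "2 + \<phi> u"] h(2)[of y] u by simp
    show "h y * (2 + \<phi> u) \<le> B * 3" using B[of y] h(2)[of y] u by (intro mult_mono) auto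
  qed
  \<comment> \<open>The frequency vector of \<open>s\<close> times coordinate \<open>x\<close> plus
    \<open>\<sigma>\<close> times the form \<open>t\<close>. The values \<open>0\<close>,
    \<open>1\<close>, \<open>- 1\<close> of \<open>\<sigma>\<close> give the three exponentials into
    which \<open>(2 + \<phi>) * cis\<close> expands, so goodness of \<open>h\<close> applies to
    each.\<close>
  define ts where "ts s \<sigma> z = (if z = x then s else 0) + \<sigma> * t z" for s \<sigma> z
  have ts: "(\<Sum>z\<in>F. ts s \<sigma> z * y z) = s * y x + \<sigma> * (\<Sum>z\<in>F. t z * y z)" for s \<sigma> y
    using finite_F x
    by (simp add: ts_def distrib_right sum.distrib sum_distrib_left if_distrib[of "\<lambda>u. u * _"] mult.assoc
        cong: if_cong)
  have expand: "(h y * (2 + \<phi> (\<Sum>z\<in>F. t z * y z))) *\<^sub>R cis (s * y x)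
      = 2 * (h y *\<^sub>R cis (\<Sum>z\<in>F. ts s 0 z * y z)) + \<alpha> * (h y *\<^sub>R cis (\<Sum>z\<in>F. ts s 1 z * y z))
        + \<beta> * (h y *\<^sub>R cis (\<Sum>z\<in>F. ts s (- 1) z * y z))" for s y
  proof -
    have *: "cis (s * y x + \<sigma> * u) = cis (s * y x) * cis (\<sigma> * u)" for \<sigma> u
      by (simp add: cis_mult)
    show ?thesis
      unfolding ts * scaleR_conv_of_real of_real_mult of_real_add \<phi>(1)
      by (simp add: algebra_simps)
  qed
  have lin: "(\<integral>\<omega>. 2 * f1 \<omega> + \<alpha> * f2 \<omega> + \<beta> * f3 \<omega> \<partial>M)
      = 2 * (\<integral>\<omega>. f1 \<omega> \<partial>M) + \<alpha> * (\<integral>\<omega>. f2 \<omega> \<partial>M) + \<beta> * (\<integral>\<omega>. f3 \<omega> \<partial>M)"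
    if "integrable M f1" "integrable M f2" "integrable M f3" for M :: "'z measure" and f1 f2 f3
    using that by simp
  show ?thesis
  proof (rule weighted_levy_continuity[OF P.prob_space_axioms Q.prob_space_axioms _ _ _ _ b(1,2) b(1,2) _ _ g])
    fix s
    show "(\<lambda>n. \<integral>\<omega>. (h (V n \<omega>) * (2 + \<phi> (\<Sum>x\<in>F. t x * V n \<omega> x))) *\<^sub>R cis (s * V n \<omega> x) \<partial>P)
      \<longlonglongrightarrow> (\<integral>\<omega>. (h (G \<omega>) * (2 + \<phi> (\<Sum>x\<in>F. t x * G \<omega> x))) *\<^sub>R cis (s * G \<omega> x) \<partial>Q)"
      unfolding expand lin[OF good_integrable(1)[OF h(1)] good_integrable(1)[OF h(1)] good_integrable(1)[OF h(1)]]
        lin[OF good_integrable(2)[OF h(1)] good_integrable(2)[OF h(1)] good_integrable(2)[OF h(1)]]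
      by (intro tendsto_intros goodD(4)[OF h(1)])
  qed auto
qed

text \<open>The shift by \<open>2\<close> is undone by subtracting the statement for
  \<open>\<phi> = 0\<close>; the resulting limits for \<open>cos\<close> and \<open>sin\<close> are
  the real and imaginary parts of the one for \<open>cis\<close>.\<close>

lemma good_mult_coordinate_ge_1:
  assumes h: "good h" "\<And>y. 1 \<le> h y" and x: "x \<in> F" and g: "\<And>u. isCont g u" "\<And>u. \<bar>g u\<bar> \<le> C"
  shows "good (\<lambda>y. h y * g (y x))"
proof -
  obtain B where B: "\<And>y. \<bar>h y\<bar> \<le> B" using goodD(3)[OF h(1)] by blast
  have gm [measurable]: "g \<in> borel_measurable borel"
    using g(1) by (intro borel_measurable_continuous_onI continuous_at_imp_continuous_on) auto
  note [measurable] = goodD(1,2)[OF h(1)]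
  have bnd: "\<bar>h y * g (y x)\<bar> \<le> B * C" for y
    unfolding abs_mult using B[of y] g(2)[of "y x"] by (intro mult_mono) auto
  have bnd': "\<bar>h y * g (y x) * \<phi>\<bar> \<le> B * C" if "\<bar>\<phi>\<bar> \<le> 1" for y \<phi>
    unfolding abs_mult[of "h y * g (y x)"] using bnd[of y] that
    by (metis abs_ge_zero mult.right_neutral mult_mono order_trans)
  have trig: "(\<lambda>n. \<integral>\<omega>. h (V n \<omega>) * g (V n \<omega> x) * \<phi> (\<Sum>x\<in>F. t x * V n \<omega> x) \<partial>P)
      \<longlonglongrightarrow> (\<integral>\<omega>. h (G \<omega>) * g (G \<omega> x) * \<phi> (\<Sum>x\<in>F. t x * G \<omega> x) \<partial>Q)"
    if \<phi>: "\<And>u. complex_of_real (\<phi> u) = \<alpha> * cis u + \<beta> * cis (- u)" "\<And>u. \<bar>\<phi> u\<bar> \<le> 1"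
      "\<phi> \<in> borel_measurable borel" for \<phi> \<alpha> \<beta> t
  proof -
    note [measurable] = \<phi>(3)
    have iP: "integrable P (\<lambda>\<omega>. h (V n \<omega>) * g (V n \<omega> x))"
      "integrable P (\<lambda>\<omega>. h (V n \<omega>) * g (V n \<omega> x) * \<phi> (\<Sum>x\<in>F. t x * V n \<omega> x))" for n
      by (rule P.integrable_const_bound[of _ "B * C"], use bnd bnd' \<phi>(2) in auto)+
    have iQ: "integrable Q (\<lambda>\<omega>. h (G \<omega>) * g (G \<omega> x))"
      "integrable Q (\<lambda>\<omega>. h (G \<omega>) * g (G \<omega> x) * \<phi> (\<Sum>x\<in>F. t x * G \<omega> x))"
      by (rule Q.integrable_const_bound[of _ "B * C"], use bnd bnd' \<phi>(2) in auto)+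
    have eq: "h y * (2 + \<phi> u) * g (y x) = 2 * (h y * g (y x)) + h y * g (y x) * \<phi> u" for y u
      by (simp add: algebra_simps)
    have 2: "(\<lambda>n. 2 * (\<integral>\<omega>. h (V n \<omega>) * g (V n \<omega> x) \<partial>P)) \<longlonglongrightarrow> 2 * (\<integral>\<omega>. h (G \<omega>) * g (G \<omega> x) \<partial>Q)"
      using good_mult_coordinate_trig[OF h x g, of "\<lambda>_. 0" 0 0] by (simp add: ac_simps)
    have 1: "(\<lambda>n. 2 * (\<integral>\<omega>. h (V n \<omega>) * g (V n \<omega> x) \<partial>P)
          + (\<integral>\<omega>. h (V n \<omega>) * g (V n \<omega> x) * \<phi> (\<Sum>x\<in>F. t x * V n \<omega> x) \<partial>P))
        \<longlonglongrightarrow> 2 * (\<integral>\<omega>. h (G \<omega>) * g (G \<omega> x) \<partial>Q)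
          + (\<integral>\<omega>. h (G \<omega>) * g (G \<omega> x) * \<phi> (\<Sum>x\<in>F. t x * G \<omega> x) \<partial>Q)"
      using good_mult_coordinate_trig[OF h x g \<phi>, of t] iP iQ unfolding eq by simp
    from tendsto_diff[OF 1 2] show ?thesis by simp
  qed
  have "(\<lambda>n. \<integral>\<omega>. (h (V n \<omega>) * g (V n \<omega> x)) *\<^sub>R cis (\<Sum>x\<in>F. t x * V n \<omega> x) \<partial>P)
      \<longlonglongrightarrow> (\<integral>\<omega>. (h (G \<omega>) * g (G \<omega> x)) *\<^sub>R cis (\<Sum>x\<in>F. t x * G \<omega> x) \<partial>Q)" for t
  proof -
    have split: "(\<integral>\<omega>. f \<omega> *\<^sub>R cis (u \<omega>) \<partial>M) = Complex (\<integral>\<omega>. f \<omega> * cos (u \<omega>) \<partial>M) (\<integral>\<omega>. f \<omega> * sin (u \<omega>) \<partial>M)"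
      if "integrable M (\<lambda>\<omega>. f \<omega> *\<^sub>R cis (u \<omega>))" for M :: "'z measure" and f u
      by (rule complex_eqI) (simp_all flip: integral_Re[OF that] integral_Im[OF that])
    have iP: "integrable P (\<lambda>\<omega>. (h (V n \<omega>) * g (V n \<omega> x)) *\<^sub>R cis (\<Sum>x\<in>F. t x * V n \<omega> x))" for n
      by (rule P.integrable_const_bound[of _ "B * C"]) (use bnd in auto)
    have iQ: "integrable Q (\<lambda>\<omega>. (h (G \<omega>) * g (G \<omega> x)) *\<^sub>R cis (\<Sum>x\<in>F. t x * G \<omega> x))"
      by (rule Q.integrable_const_bound[of _ "B * C"]) (use bnd in auto)
    have cos: "complex_of_real (cos u) = 1 / 2 * cis u + 1 / 2 * cis (- u)" for u
      by (simp add: complex_eq_iff)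
    have sin: "complex_of_real (sin u) = - (\<i> / 2) * cis u + \<i> / 2 * cis (- u)" for u
      by (simp add: complex_eq_iff)
    show ?thesis
      unfolding split[OF iP] split[OF iQ]
      by (intro tendsto_Complex trig[OF cos] trig[OF sin]) auto
  qed
  then show ?thesis unfolding good_def using bnd by auto
qed

text \<open>Adding \<open>\<bar>B\<bar> + 1\<close> lifts a bounded weight above \<open>1\<close>;
  the contribution of this constant is good by itself and is subtracted again.\<close>

lemma good_mult_coordinate:
  assumes h: "good h" and x: "x \<in> F" and g: "\<And>u. isCont g u" "\<And>u. \<bar>g u\<bar> \<le> C"
  shows "good (\<lambda>y. h y * g (y x))"
proof -
  obtain B where B: "\<And>y. \<bar>h y\<bar> \<le> B" using goodD(3)[OF h(1)] by blast
  have "1 \<le> h y + (\<bar>B\<bar> + 1)" for y using B[of y] by linarith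
  from good_mult_coordinate_ge_1[OF good_add[OF h good_const] this x g]
  have 1: "good (\<lambda>y. (h y + (\<bar>B\<bar> + 1)) * g (y x))" .
  have 2: "good (\<lambda>y. (\<bar>B\<bar> + 1) * g (y x))"
    by (rule good_mult_coordinate_ge_1[OF good_const _ x g]) simp
  from good_add[OF 1 good_cmult[OF 2, of "- 1"]] show ?thesis by (simp add: algebra_simps)
qed


section \<open>Polynomial approximation on a cube\<close>

text \<open>Generated by multiplication with one coordinate at a time, to match
  \<open>good_mult_coordinate\<close>; closure under general products, needed for a function ring,
  is derived afterwards.\<close>

inductive coordinate_polynomial :: "((nat \<Rightarrow> real) \<Rightarrow> real) \<Rightarrow> bool" where
  const: "coordinate_polynomial (\<lambda>_. c)"
| add: "coordinate_polynomial h \<Longrightarrow> coordinate_polynomial h' \<Longrightarrow> coordinate_polynomial (\<lambda>z. h z + h' z)"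
| mult_coordinate: "coordinate_polynomial h \<Longrightarrow> x \<in> F \<Longrightarrow>
    coordinate_polynomial (\<lambda>z. h z * z (to_nat_on UNIV x))"

lemma coordinate_polynomial_mult:
  assumes "coordinate_polynomial h'" "coordinate_polynomial h"
  shows "coordinate_polynomial (\<lambda>z. h z * h' z)"
  using assms
proof induction
  case (const c)
  then show ?case
  proof induction
    case (const c')
    show ?case by (rule coordinate_polynomial.const)
  next
    case (add h1 h2)
    from coordinate_polynomial.add[OF add.IH] show ?case by (simp add: algebra_simps)
  next
    case (mult_coordinate h x)
    from coordinate_polynomial.mult_coordinate[OF mult_coordinate.IH mult_coordinate.hyps(2)]
    show ?case by (simp add: algebra_simps)
  qed
next
  case (add h1 h2)
  from coordinate_polynomial.add[OF add.IH[OF add.prems]] show ?case by (simp add: algebra_simps)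
next
  case (mult_coordinate h1 x)
  from coordinate_polynomial.mult_coordinate[OF mult_coordinate.IH[OF mult_coordinate.prems] mult_coordinate.hyps(2)]
  show ?case by (simp add: algebra_simps)
qed

text \<open>Clipping the coordinates makes Stone--Weierstrass applicable: on the cube it approximates by
  polynomials, and polynomials in the clipped coordinates are bounded. Coordinates are indexed by
  natural numbers, since the function space \<^typ>\<open>nat \<Rightarrow> real\<close> is an instance of \<^class>\<open>t2_space\<close>.\<close>

lemma clipped_tendsto:
  fixes \<phi> :: "('a \<Rightarrow> real) \<Rightarrow> real"
  assumes c: "countable (UNIV :: 'a set)" and K: "K > 0"
    and w: "\<And>x. w x \<ge> 0" and lip: "\<And>y z. \<bar>\<phi> y - \<phi> z\<bar> \<le> (\<Sum>x\<in>F. w x * \<bar>y x - z x\<bar>)"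
    and bnd: "\<And>y. \<bar>\<phi> y\<bar> \<le> C"
  defines "clip \<equiv> \<lambda>y x. max (- K) (min K (y x))"
  assumes [measurable]: "\<And>n. (\<lambda>\<omega>. \<phi> (clip (V n \<omega>))) \<in> borel_measurable P"
    "(\<lambda>\<omega>. \<phi> (clip (G \<omega>))) \<in> borel_measurable Q"
  shows "(\<lambda>n. \<integral>\<omega>. \<phi> (clip (V n \<omega>)) \<partial>P) \<longlonglongrightarrow> (\<integral>\<omega>. \<phi> (clip (G \<omega>)) \<partial>Q)"
proof (rule LIMSEQ_I)
  fix \<epsilon> :: real assume \<epsilon>: "\<epsilon> > 0"
  let ?e = "to_nat_on (UNIV :: 'a set)"
  \<comment> \<open>The factor \<open>{0}\<close> at indices that do not come from \<open>F\<close>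
    keeps the cube compact and forces distinct points to differ at an index from \<open>F\<close>,
    where a coordinate polynomial separates them.\<close>
  define cube where "cube = PiE UNIV (\<lambda>j. if j \<in> ?e ` F then {- K..K} else {0 :: real})"
  define \<psi> where "\<psi> z = \<phi> (\<lambda>x. z (?e x))" for z :: "nat \<Rightarrow> real"
  define emb where "emb y j = (if j \<in> ?e ` F then clip y (from_nat_into UNIV j) else 0)" for y j
  have emb_e: "emb y (?e x) = clip y x" if "x \<in> F" for x y
    using that c by (simp add: emb_def)
  have emb_cube: "emb y \<in> cube" for y
    using K by (auto simp: cube_def emb_def clip_def)
  \<comment> \<open>By \<open>lip\<close>, \<open>\<phi>\<close> depends only on coordinates in
    \<open>F\<close>, where \<open>emb y\<close> and \<open>clip y\<close> agree.\<close>
  have "\<bar>\<psi> (emb y) - \<phi> (clip y)\<bar> \<le> (\<Sum>x\<in>F. w x * \<bar>emb y (?e x) - clip y x\<bar>)" for y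
    unfolding \<psi>_def by (rule lip)
  also have "(\<Sum>x\<in>F. w x * \<bar>emb y (?e x) - clip y x\<bar>) = 0" for y
    by (rule sum.neutral) (simp add: emb_e)
  finally have \<psi>_emb: "\<psi> (emb y) = \<phi> (clip y)" for y by simp
  interpret function_ring_on "Collect coordinate_polynomial" cube
  proof
    have "compactin (product_topology (\<lambda>_. euclidean) UNIV) cube"
      unfolding cube_def compactin_PiE by auto
    then show "compact cube" by (simp add: euclidean_product_topology)
    show "continuous_on cube f" if "f \<in> Collect coordinate_polynomial" for f
    proof -
      from that have "coordinate_polynomial f" by simp
      then have "continuous_on UNIV f"
        by induction (auto intro!: continuous_intros)
      then show ?thesis by (rule continuous_on_subset) simp
    qed
    show "(\<lambda>z. f z + g z) \<in> Collect coordinate_polynomial"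
      if "f \<in> Collect coordinate_polynomial" "g \<in> Collect coordinate_polynomial" for f g
      using that coordinate_polynomial.add by simp
    show "(\<lambda>z. f z * g z) \<in> Collect coordinate_polynomial"
      if "f \<in> Collect coordinate_polynomial" "g \<in> Collect coordinate_polynomial" for f g
      using that coordinate_polynomial_mult by simp
    show "(\<lambda>_. c) \<in> Collect coordinate_polynomial" for c
      by (simp add: coordinate_polynomial.const)
    show "\<exists>f\<in>Collect coordinate_polynomial. f z \<noteq> f z'" if "z \<in> cube" "z' \<in> cube" "z \<noteq> z'" for z z'
    proof -
      obtain j where j: "z j \<noteq> z' j" using \<open>z \<noteq> z'\<close> by blast
      have "j \<in> ?e ` F"
      proof (rule ccontr)
        assume "j \<notin> ?e ` F"
        then have "z j = 0" "z' j = 0" using PiE_mem[OF that(1)[unfolded cube_def], of j]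
            PiE_mem[OF that(2)[unfolded cube_def], of j] by simp_all
        then show False using j by simp
      qed
      then obtain x where x: "x \<in> F" "j = ?e x" by blast
      \<comment> \<open>The factor \<open>1\<close> is the constant polynomial to which the
        multiplication rule is applied.\<close>
      have "coordinate_polynomial (\<lambda>z. 1 * z (?e x))"
        using x by (intro coordinate_polynomial.intros)
      then show ?thesis using j x by (intro bexI[of _ "\<lambda>z. 1 * z (?e x)"]) auto
    qed
  qed
  have "continuous_on cube \<psi>"
    unfolding continuous_on_def
  proof
    fix z0 assume "z0 \<in> cube"
    have "((\<lambda>z. \<Sum>x\<in>F. w x * \<bar>z (?e x) - z0 (?e x)\<bar>) \<longlongrightarrow> (\<Sum>x\<in>F. w x * \<bar>z0 (?e x) - z0 (?e x)\<bar>))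
        (at z0 within cube)"
    proof -
      have "continuous_on UNIV (\<lambda>z. \<Sum>x\<in>F. w x * \<bar>z (?e x) - z0 (?e x)\<bar>)"
        by (intro continuous_intros continuous_on_product_coordinates)
      then have "continuous_on cube (\<lambda>z. \<Sum>x\<in>F. w x * \<bar>z (?e x) - z0 (?e x)\<bar>)"
        by (rule continuous_on_subset) simp
      then show ?thesis using \<open>z0 \<in> cube\<close> unfolding continuous_on_def by blast
    qed
    then have "((\<lambda>z. \<Sum>x\<in>F. w x * \<bar>z (?e x) - z0 (?e x)\<bar>) \<longlongrightarrow> 0) (at z0 within cube)" by simp
    then have "((\<lambda>z. \<psi> z - \<psi> z0) \<longlongrightarrow> 0) (at z0 within cube)"
      by (rule Lim_null_comparison[rotated]) (simp add: \<psi>_def lip)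
    then show "(\<psi> \<longlongrightarrow> \<psi> z0) (at z0 within cube)" by (simp add: LIM_zero_iff)
  qed
  from Stone_Weierstrass_basic[OF this, of "\<epsilon> / 3"] \<epsilon>
  obtain h where h: "coordinate_polynomial h" "\<And>z. z \<in> cube \<Longrightarrow> \<bar>\<psi> z - h z\<bar> < \<epsilon> / 3" by auto
  \<comment> \<open>The generating rules of polynomials match the closure rules of
    \<open>good\<close>: each factor is a clipped coordinate, hence a bounded continuous function of
    a single coordinate.\<close>
  from h(1) have "good (\<lambda>y. h (emb y))"
  proof induction
    case (const c)
    show ?case by (rule good_const)
  next
    case (add h h')
    then show ?case using good_add by blast
  next
    case (mult_coordinate h x)
    have "good (\<lambda>y. h (emb y) * max (- K) (min K (y x)))"
      using mult_coordinate K by (intro good_mult_coordinate[where C = K]) (auto intro!: continuous_intros)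
    then show ?case using emb_e[OF mult_coordinate.hyps(2)] by (simp add: clip_def)
  qed
  note gd = this
  note [measurable] = goodD(1,2)[OF gd]
  obtain B where B: "\<And>y. \<bar>h (emb y)\<bar> \<le> B" using goodD(3)[OF gd] by blast
  have close: "\<bar>\<phi> (clip y) - h (emb y)\<bar> \<le> \<epsilon> / 3" for y
    using h(2)[OF emb_cube, of y] by (simp add: \<psi>_emb)
  have closeP: "\<bar>(\<integral>\<omega>. \<phi> (clip (V n \<omega>)) \<partial>P) - (\<integral>\<omega>. h (emb (V n \<omega>)) \<partial>P)\<bar> \<le> \<epsilon> / 3" for n
  proof -
    have i: "integrable P (\<lambda>\<omega>. \<phi> (clip (V n \<omega>)))" "integrable P (\<lambda>\<omega>. h (emb (V n \<omega>)))"
      by (rule P.integrable_const_bound[of _ C], use bnd in auto)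
         (rule P.integrable_const_bound[of _ B], use B in auto)
    have "\<bar>\<integral>\<omega>. \<phi> (clip (V n \<omega>)) - h (emb (V n \<omega>)) \<partial>P\<bar> \<le> (\<integral>\<omega>. \<epsilon> / 3 \<partial>P)"
      using i close by (intro order_trans[OF integral_abs_bound] integral_mono) auto
    then show ?thesis using i by (simp add: P.prob_space)
  qed
  have closeQ: "\<bar>(\<integral>\<omega>. \<phi> (clip (G \<omega>)) \<partial>Q) - (\<integral>\<omega>. h (emb (G \<omega>)) \<partial>Q)\<bar> \<le> \<epsilon> / 3"
  proof -
    have i: "integrable Q (\<lambda>\<omega>. \<phi> (clip (G \<omega>)))" "integrable Q (\<lambda>\<omega>. h (emb (G \<omega>)))"
      by (rule Q.integrable_const_bound[of _ C], use bnd in auto)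
         (rule Q.integrable_const_bound[of _ B], use B in auto)
    have "\<bar>\<integral>\<omega>. \<phi> (clip (G \<omega>)) - h (emb (G \<omega>)) \<partial>Q\<bar> \<le> (\<integral>\<omega>. \<epsilon> / 3 \<partial>Q)"
      using i close by (intro order_trans[OF integral_abs_bound] integral_mono) auto
    then show ?thesis using i by (simp add: Q.prob_space)
  qed
  obtain n0 where n0: "\<And>n. n \<ge> n0 \<Longrightarrow>
      \<bar>(\<integral>\<omega>. h (emb (V n \<omega>)) \<partial>P) - (\<integral>\<omega>. h (emb (G \<omega>)) \<partial>Q)\<bar> < \<epsilon> / 3"
    using LIMSEQ_D[OF good_tendsto[OF gd], of "\<epsilon> / 3"] \<epsilon> by auto
  show "\<exists>no. \<forall>n\<ge>no. norm ((\<integral>\<omega>. \<phi> (clip (V n \<omega>)) \<partial>P) - (\<integral>\<omega>. \<phi> (clip (G \<omega>)) \<partial>Q)) < \<epsilon>"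
  proof (intro exI[of _ n0] allI impI)
    fix n assume "n0 \<le> n"
    from n0[OF this] closeP[of n] closeQ
    show "norm ((\<integral>\<omega>. \<phi> (clip (V n \<omega>)) \<partial>P) - (\<integral>\<omega>. \<phi> (clip (G \<omega>)) \<partial>Q)) < \<epsilon>"
      unfolding real_norm_def by linarith
  qed
qed

text \<open>Second moments bound the cost of clipping at level \<open>K\<close> by
  \<open>A / K\<close> under all laws involved, uniformly in \<open>n\<close>. The hypothesis
  \<open>meas\<close> speaks of arbitrary \<open>W\<close> because it is applied to the processes
  and to their clipped versions.\<close>

lemma Lipschitz_tendsto:
  fixes \<phi> :: "('a \<Rightarrow> real) \<Rightarrow> real"
  assumes c: "countable (UNIV :: 'a set)"
    and w: "\<And>x. w x \<ge> 0" and lip: "\<And>y z. \<bar>\<phi> y - \<phi> z\<bar> \<le> (\<Sum>x\<in>F. w x * \<bar>y x - z x\<bar>)"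
    and bnd: "\<And>y. \<bar>\<phi> y\<bar> \<le> C"
    and meas: "\<And>W :: 'p \<Rightarrow> 'a \<Rightarrow> real. (\<And>x. (\<lambda>\<omega>. W \<omega> x) \<in> borel_measurable P) \<Longrightarrow>
        (\<lambda>\<omega>. \<phi> (W \<omega>)) \<in> borel_measurable P"
      "\<And>W :: 'q \<Rightarrow> 'a \<Rightarrow> real. (\<And>x. (\<lambda>\<omega>. W \<omega> x) \<in> borel_measurable Q) \<Longrightarrow>
        (\<lambda>\<omega>. \<phi> (W \<omega>)) \<in> borel_measurable Q"
    and mP: "\<And>n x. integrable P (\<lambda>\<omega>. (V n \<omega> x)\<^sup>2)" "\<And>n x. (\<integral>\<omega>. (V n \<omega> x)\<^sup>2 \<partial>P) \<le> v x"
    and mQ: "\<And>x. integrable Q (\<lambda>\<omega>. (G \<omega> x)\<^sup>2)" "\<And>x. (\<integral>\<omega>. (G \<omega> x)\<^sup>2 \<partial>Q) \<le> v x"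
  shows "(\<lambda>n. \<integral>\<omega>. \<phi> (V n \<omega>) \<partial>P) \<longlonglongrightarrow> (\<integral>\<omega>. \<phi> (G \<omega>) \<partial>Q)"
proof (rule LIMSEQ_I)
  fix \<epsilon> :: real assume \<epsilon>: "\<epsilon> > 0"
  define A where "A = (\<Sum>x\<in>F. w x * v x)"
  \<comment> \<open>Chosen so that \<open>A / K < \<epsilon> / 3\<close>; the summand
    \<open>1\<close> makes \<open>K\<close> positive and the inequality strict even if
    \<open>A = 0\<close>.\<close>
  define K where "K = 3 * \<bar>A\<bar> / \<epsilon> + 1"
  have K: "K > 0" using \<epsilon> by (simp add: K_def add_nonneg_pos)
  have AK: "A / K < \<epsilon> / 3"
  proof -
    have "\<epsilon> * K = 3 * \<bar>A\<bar> + \<epsilon>" using \<epsilon> by (simp add: K_def algebra_simps)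
    then have "3 * A < \<epsilon> * K" using \<epsilon> abs_ge_self[of A] by linarith
    then show ?thesis using K by (simp add: field_simps)
  qed
  define clip where "clip = (\<lambda>(y :: 'a \<Rightarrow> real) x. max (- K) (min K (y x)))"
  have clip: "\<bar>\<phi> y - \<phi> (clip y)\<bar> \<le> (\<Sum>x\<in>F. w x / K * (y x)\<^sup>2)" for y
  proof -
    have "\<bar>\<phi> y - \<phi> (clip y)\<bar> \<le> (\<Sum>x\<in>F. w x * \<bar>y x - clip y x\<bar>)" by (rule lip)
    also have "\<dots> \<le> (\<Sum>x\<in>F. w x * ((y x)\<^sup>2 / K))"
      using w abs_clip_diff_le[OF K] by (intro sum_mono mult_left_mono) (auto simp: clip_def)
    finally show ?thesis by simp
  qed
  have close: "\<bar>(\<integral>\<omega>. \<phi> (W \<omega>) \<partial>M) - (\<integral>\<omega>. \<phi> (clip (W \<omega>)) \<partial>M)\<bar> < \<epsilon> / 3"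
    if M: "prob_space M" and m: "(\<lambda>\<omega>. \<phi> (W \<omega>)) \<in> borel_measurable M"
        "(\<lambda>\<omega>. \<phi> (clip (W \<omega>))) \<in> borel_measurable M"
      and W: "\<And>x. integrable M (\<lambda>\<omega>. (W \<omega> x)\<^sup>2)" "\<And>x. (\<integral>\<omega>. (W \<omega> x)\<^sup>2 \<partial>M) \<le> v x"
    for M :: "'z measure" and W
  proof -
    interpret M: prob_space M by fact
    have i: "integrable M (\<lambda>\<omega>. \<phi> (W \<omega>))" "integrable M (\<lambda>\<omega>. \<phi> (clip (W \<omega>)))"
      by (rule M.integrable_const_bound[of _ C], use bnd m in auto)+
    have "\<bar>\<integral>\<omega>. \<phi> (W \<omega>) - \<phi> (clip (W \<omega>)) \<partial>M\<bar> \<le> (\<integral>\<omega>. (\<Sum>x\<in>F. w x / K * (W \<omega> x)\<^sup>2) \<partial>M)"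
      using i clip W by (intro order_trans[OF integral_abs_bound] integral_mono) auto
    also have "\<dots> = (\<Sum>x\<in>F. w x / K * (\<integral>\<omega>. (W \<omega> x)\<^sup>2 \<partial>M))" using W by simp
    also have "\<dots> \<le> (\<Sum>x\<in>F. w x / K * v x)"
      using W(2) w K by (intro sum_mono mult_left_mono) auto
    also have "\<dots> = A / K" by (simp add: A_def sum_divide_distrib)
    finally have "\<bar>\<integral>\<omega>. \<phi> (W \<omega>) - \<phi> (clip (W \<omega>)) \<partial>M\<bar> < \<epsilon> / 3" using AK by (rule le_less_trans)
    then show ?thesis by (simp only: Bochner_Integration.integral_diff[OF i])
  qed
  have m: "(\<lambda>\<omega>. \<phi> (clip (V n \<omega>))) \<in> borel_measurable P" "(\<lambda>\<omega>. \<phi> (V n \<omega>)) \<in> borel_measurable P"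
    "(\<lambda>\<omega>. \<phi> (clip (G \<omega>))) \<in> borel_measurable Q" "(\<lambda>\<omega>. \<phi> (G \<omega>)) \<in> borel_measurable Q" for n
    by (rule meas; simp add: clip_def)+
  have "(\<lambda>n. \<integral>\<omega>. \<phi> (clip (V n \<omega>)) \<partial>P) \<longlonglongrightarrow> (\<integral>\<omega>. \<phi> (clip (G \<omega>)) \<partial>Q)"
    using clipped_tendsto[OF c K w lip bnd] m unfolding clip_def by blast
  from LIMSEQ_D[OF this, of "\<epsilon> / 3"] \<epsilon> obtain n0 where n0: "\<And>n. n \<ge> n0 \<Longrightarrow>
      \<bar>(\<integral>\<omega>. \<phi> (clip (V n \<omega>)) \<partial>P) - (\<integral>\<omega>. \<phi> (clip (G \<omega>)) \<partial>Q)\<bar> < \<epsilon> / 3" by auto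
  show "\<exists>no. \<forall>n\<ge>no. norm ((\<integral>\<omega>. \<phi> (V n \<omega>) \<partial>P) - (\<integral>\<omega>. \<phi> (G \<omega>) \<partial>Q)) < \<epsilon>"
  proof (intro exI[of _ n0] allI impI)
    fix n assume "n0 \<le> n"
    from n0[OF this] close[OF P.prob_space_axioms m(2)[of n] m(1)[of n] mP] close[OF Q.prob_space_axioms m(4,3) mQ]
    show "norm ((\<integral>\<omega>. \<phi> (V n \<omega>) \<partial>P) - (\<integral>\<omega>. \<phi> (G \<omega>) \<partial>Q)) < \<epsilon>"
      unfolding real_norm_def by linarith
  qed
qed

end

section \<open>Fluctuations of the empirical measure\<close>

text \<open>The variance of \<open>\<bar>W\<bar>\<close> is nonnegative.\<close>

lemma (in prob_space) expectation_abs_le_sqrt: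
  fixes W :: "'a \<Rightarrow> real"
  assumes W: "W \<in> borel_measurable M" "integrable M (\<lambda>\<omega>. (W \<omega>)\<^sup>2)" and v: "(\<integral>\<omega>. (W \<omega>)\<^sup>2 \<partial>M) \<le> v"
  shows "integrable M (\<lambda>\<omega>. \<bar>W \<omega>\<bar>)" "(\<integral>\<omega>. \<bar>W \<omega>\<bar> \<partial>M) \<le> sqrt v"
proof -
  show int: "integrable M (\<lambda>\<omega>. \<bar>W \<omega>\<bar>)"
    using square_integrable_imp_integrable[OF W] by simp
  have "0 \<le> variance (\<lambda>\<omega>. \<bar>W \<omega>\<bar>)" by (rule variance_positive)
  also have "variance (\<lambda>\<omega>. \<bar>W \<omega>\<bar>) = (\<integral>\<omega>. (W \<omega>)\<^sup>2 \<partial>M) - (\<integral>\<omega>. \<bar>W \<omega>\<bar> \<partial>M)\<^sup>2"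
    using variance_eq[OF int] W(2) by simp
  finally show "(\<integral>\<omega>. \<bar>W \<omega>\<bar> \<partial>M) \<le> sqrt v" using v by (intro real_le_rsqrt) linarith
qed

text \<open>A centred normal law is the standard one scaled by \<open>\<sigma>\<close>, which moves
  the scale into the argument of the characteristic function; at \<open>\<sigma> = 0\<close> both
  sides are \<open>1\<close>.\<close>

lemma integral_cis_normal_law:
  assumes "\<sigma> \<ge> 0"
  shows "(\<integral>u. cis u \<partial>normal_law 0 \<sigma>) = char std_normal_distribution \<sigma>"
proof (cases "\<sigma> = 0")
  case True
  then show ?thesis by (simp add: normal_law_def integral_return char_std_normal_distribution)
next
  case False
  interpret real_distribution std_normal_distribution by (rule real_dist_normal_dist)
  have "distributed std_normal_distribution lborel (\<lambda>u. 0 + \<sigma> * u) (normal_density (0 + \<sigma> * 0) (\<bar>\<sigma>\<bar> * 1))"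
    by (rule normal_density_affine)
       (use False in \<open>auto simp: distributed_def distr_id2 normal_density_nonneg\<close>)
  then have "distr std_normal_distribution lborel (\<lambda>u. \<sigma> * u) = normal_law 0 \<sigma>"
    using assms False by (simp add: distributed_def normal_law_def)
  then have "(\<integral>u. cis u \<partial>normal_law 0 \<sigma>) = (\<integral>u. cis u \<partial>distr std_normal_distribution lborel (\<lambda>u. \<sigma> * u))"
    by simp
  also have "\<dots> = (\<integral>u. cis (\<sigma> * u) \<partial>std_normal_distribution)"
    by (rule integral_distr) auto
  finally show ?thesis by (simp add: char_def cis_conv_exp)
qed

locale iid_sample = prob_space M for M :: "'m measure" +
  fixes X :: "nat \<Rightarrow> 'm \<Rightarrow> 'a" and r :: "'a pmf"
  assumes indep: "indep_vars (\<lambda>_. count_space UNIV) X {1..}"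
    and distr_X: "\<And>k. k \<ge> 1 \<Longrightarrow> distr M (count_space UNIV) (X k) = measure_pmf r"
begin

definition fluctuation :: "nat \<Rightarrow> 'm \<Rightarrow> 'a \<Rightarrow> real" where
  "fluctuation n \<omega> x = sqrt (real n) * (empirical_measure X n \<omega> x - pmf r x)"

text \<open>The sample is numbered from \<open>1\<close>, the summands of the central limit theorem
  from \<open>0\<close>; hence \<open>Suc k\<close>.\<close>

definition centred :: "nat \<Rightarrow> 'm \<Rightarrow> 'a \<Rightarrow> real" where
  "centred k \<omega> x = of_bool (X (Suc k) \<omega> = x) - pmf r x"

lemma measurable_X: "k \<ge> 1 \<Longrightarrow> X k \<in> M \<rightarrow>\<^sub>M count_space UNIV"
  using indep by (auto simp: indep_vars_def2)

lemma measurable_X_Suc [measurable]: "X (Suc k) \<in> M \<rightarrow>\<^sub>M count_space UNIV"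
  by (rule measurable_X) simp

lemma expectation_X:
  fixes f :: "'a \<Rightarrow> real"
  shows "(\<integral>\<omega>. f (X (Suc k) \<omega>) \<partial>M) = (\<integral>y. f y \<partial>measure_pmf r)"
proof -
  have "(\<integral>y. f y \<partial>measure_pmf r) = (\<integral>y. f y \<partial>distr M (count_space UNIV) (X (Suc k)))"
    by (simp add: distr_X)
  also have "\<dots> = (\<integral>\<omega>. f (X (Suc k) \<omega>) \<partial>M)" by (rule integral_distr) auto
  finally show ?thesis by simp
qed

lemma measurable_centred [measurable]: "(\<lambda>\<omega>. centred k \<omega> x) \<in> borel_measurable M"
  unfolding centred_def by measurable

lemma centred_bound: "\<bar>centred k \<omega> x\<bar> \<le> 1"
  using pmf_le_1[of r x] pmf_nonneg[of r x] by (auto simp: centred_def of_bool_def)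

lemma integrable_centred:
  "integrable M (\<lambda>\<omega>. centred k \<omega> x)" "integrable M (\<lambda>\<omega>. centred k \<omega> x * centred l \<omega> y)"
proof -
  show "integrable M (\<lambda>\<omega>. centred k \<omega> x)"
    by (rule integrable_const_bound[of _ 1]) (use centred_bound in auto)
  have "\<bar>centred k \<omega> x * centred l \<omega> y\<bar> \<le> 1" for \<omega>
    using mult_mono[OF centred_bound centred_bound, of k \<omega> x l \<omega> y] by (simp add: abs_mult mult.commute)
  then show "integrable M (\<lambda>\<omega>. centred k \<omega> x * centred l \<omega> y)"
    by (intro integrable_const_bound[of _ 1]) auto
qed

lemma expectation_centred: "(\<integral>\<omega>. centred k \<omega> x \<partial>M) = 0"
proof -
  have "(\<integral>\<omega>. centred k \<omega> x \<partial>M) = (\<integral>y. indicator {x} y - pmf r x \<partial>measure_pmf r)"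
    unfolding centred_def
    using expectation_X[of "\<lambda>y. indicator {x} y - pmf r x" k]
    by (simp add: indicator_def of_bool_def)
  also have "\<dots> = 0"
    by (subst Bochner_Integration.integral_diff)
       (auto simp: measure_pmf_single intro!: measure_pmf.integrable_const_bound[of _ 1])
  finally show ?thesis .
qed

lemma expectation_centred_mult:
  "(\<integral>\<omega>. centred k \<omega> x * centred k \<omega> y \<partial>M) = multinomial_cov r x y"
proof -
  let ?i = "\<lambda>x y. indicator {x} y :: real"
  have [simp]: "integrable (measure_pmf r) (\<lambda>z. ?i x z)" for x
    by (intro measure_pmf.integrable_const_bound[of _ 1]) auto
  have i2: "?i x z * ?i y z = (if x = y then ?i x z else 0)" for z
    by (auto simp: indicator_def)
  have [simp]: "integrable (measure_pmf r) (\<lambda>z. ?i x z * ?i y z)"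
    unfolding i2 by (cases "x = y") simp_all
  have "(\<integral>\<omega>. centred k \<omega> x * centred k \<omega> y \<partial>M)
      = (\<integral>z. (?i x z - pmf r x) * (?i y z - pmf r y) \<partial>measure_pmf r)"
    unfolding centred_def
    using expectation_X[of "\<lambda>z. (?i x z - pmf r x) * (?i y z - pmf r y)" k]
    by (simp add: indicator_def of_bool_def)
  also have "\<dots> = (\<integral>z. ?i x z * ?i y z - pmf r y * ?i x z - pmf r x * ?i y z + pmf r x * pmf r y \<partial>measure_pmf r)"
    by (rule Bochner_Integration.integral_cong) (auto simp: algebra_simps)
  also have "\<dots> = (\<integral>z. ?i x z * ?i y z \<partial>measure_pmf r) - pmf r x * pmf r y"
    by (simp add: measure_pmf_single)
  also have "\<dots> = multinomial_cov r x y"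
    unfolding i2 by (simp add: multinomial_cov_def measure_pmf_single algebra_simps)
  finally show ?thesis .
qed

lemma indep_vars_X_Suc: "indep_vars (\<lambda>_. count_space UNIV) (\<lambda>k. X (Suc k)) UNIV"
  unfolding indep_vars_def
proof (intro conjI ballI)
  show "random_variable (count_space UNIV) (X (Suc k))" for k by measurable
  let ?S = "\<lambda>k. sigma_sets (space M) {X k -` A \<inter> space M |A. A \<in> sets (count_space UNIV)}"
  have S: "indep_sets ?S {1..}" using indep unfolding indep_vars_def by simp
  show "indep_sets (\<lambda>k. ?S (Suc k)) UNIV"
  proof (rule indep_setsI)
    show "?S (Suc k) \<subseteq> events" for k using S by (auto simp: indep_sets_def)
    fix A J assume J: "J \<noteq> {}" "finite J" and A: "\<forall>j\<in>J. A j \<in> ?S (Suc j)"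
    have "prob (\<Inter>j\<in>Suc ` J. A (j - 1)) = (\<Prod>j\<in>Suc ` J. prob (A (j - 1)))"
      by (rule indep_setsD[OF S]) (use J A in auto)
    then show "prob (\<Inter>j\<in>J. A j) = (\<Prod>j\<in>J. prob (A j))"
      by (simp add: prod.reindex)
  qed
qed

lemma indep_vars_sum_centred:
  "indep_vars (\<lambda>_. borel) (\<lambda>k \<omega>. \<Sum>x\<in>F. t x * centred k \<omega> x) UNIV"
  unfolding centred_def
  by (rule indep_vars_compose2[OF indep_vars_X_Suc,
        of "\<lambda>k z. \<Sum>x\<in>F. t x * (of_bool (z = x) - pmf r x)" "\<lambda>_. borel"]) simp

lemma fluctuation_eq: "fluctuation n \<omega> x = (\<Sum>k<n. 1 / sqrt (real n) * centred k \<omega> x)"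
proof (cases "n = 0")
  case False
  have "(\<Sum>k=1..n. of_bool (X k \<omega> = x)) = (\<Sum>k<n. of_bool (X (Suc k) \<omega> = x) :: real)"
    by (rule sum.reindex_bij_witness[of _ Suc "\<lambda>k. k - 1"]) auto
  then have "empirical_measure X n \<omega> x - pmf r x = (\<Sum>k<n. centred k \<omega> x) / real n"
    using False by (simp add: empirical_measure_def centred_def sum_subtractf field_simps)
  then have "fluctuation n \<omega> x
      = sqrt (real n) * ((\<Sum>k<n. centred k \<omega> x) / (sqrt (real n) * sqrt (real n)))"
    by (simp add: fluctuation_def)
  also have "\<dots> = 1 / sqrt (real n) * (\<Sum>k<n. centred k \<omega> x)"
  proof -
    have *: "q * (S / (q * q)) = 1 / q * S" if "q \<noteq> 0" for q S :: real using that by simp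
    show ?thesis by (rule *) (use False in simp)
  qed
  finally show ?thesis by (simp only: sum_distrib_left)
qed (simp add: fluctuation_def)

lemma measurable_fluctuation [measurable]: "(\<lambda>\<omega>. fluctuation n \<omega> x) \<in> borel_measurable M"
  unfolding fluctuation_eq by measurable

lemma linear_centred:
  assumes "finite F"
  shows "integrable M (\<lambda>\<omega>. \<Sum>x\<in>F. t x * centred k \<omega> x)"
    and "(\<integral>\<omega>. (\<Sum>x\<in>F. t x * centred k \<omega> x) \<partial>M) = 0"
    and "integrable M (\<lambda>\<omega>. (\<Sum>x\<in>F. t x * centred k \<omega> x) * (\<Sum>x\<in>F. t x * centred l \<omega> x))"
    and "(\<integral>\<omega>. (\<Sum>x\<in>F. t x * centred k \<omega> x) * (\<Sum>x\<in>F. t x * centred l \<omega> x) \<partial>M)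
      = (if k = l then (\<Sum>x\<in>F. \<Sum>y\<in>F. t x * t y * multinomial_cov r x y) else 0)"
proof -
  show 1: "integrable M (\<lambda>\<omega>. \<Sum>x\<in>F. t x * centred k \<omega> x)" for k using integrable_centred by simp
  show 2: "(\<integral>\<omega>. (\<Sum>x\<in>F. t x * centred k \<omega> x) \<partial>M) = 0" for k
    using integrable_centred expectation_centred by simp
  have eq: "(\<Sum>x\<in>F. t x * centred k \<omega> x) * (\<Sum>x\<in>F. t x * centred l \<omega> x)
      = (\<Sum>x\<in>F. \<Sum>y\<in>F. t x * t y * (centred k \<omega> x * centred l \<omega> y))" for \<omega>
    by (simp add: sum_product algebra_simps)
  show "integrable M (\<lambda>\<omega>. (\<Sum>x\<in>F. t x * centred k \<omega> x) * (\<Sum>x\<in>F. t x * centred l \<omega> x))"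
    unfolding eq using integrable_centred by simp
  show "(\<integral>\<omega>. (\<Sum>x\<in>F. t x * centred k \<omega> x) * (\<Sum>x\<in>F. t x * centred l \<omega> x) \<partial>M)
      = (if k = l then (\<Sum>x\<in>F. \<Sum>y\<in>F. t x * t y * multinomial_cov r x y) else 0)"
  proof (cases "k = l")
    case True
    then show ?thesis unfolding eq using integrable_centred expectation_centred_mult by simp
  next
    case False
    then show ?thesis
      using indep_vars_expectation_mult(2)[OF indep_vars_sum_centred[of t F] _ _ False] 1 2 by simp
  qed
qed

lemma linear_fluctuation_eq:
  "(\<Sum>x\<in>F. t x * fluctuation n \<omega> x) = (\<Sum>k<n. 1 / sqrt (real n) * (\<Sum>x\<in>F. t x * centred k \<omega> x))"
  unfolding fluctuation_eq sum_distrib_left by (subst sum.swap) (simp add: ac_simps)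

text \<open>The factor \<open>1 / sqrt n\<close> cancels the sum of \<open>n\<close> equal
  variances, so for \<open>n > 0\<close> the second moment is that of one observation. All bounds
  uniform in \<open>n\<close> come from this.\<close>

lemma linear_fluctuation_square:
  assumes "finite F"
  shows "integrable M (\<lambda>\<omega>. (\<Sum>x\<in>F. t x * fluctuation n \<omega> x)\<^sup>2)"
    and "(\<integral>\<omega>. (\<Sum>x\<in>F. t x * fluctuation n \<omega> x)\<^sup>2 \<partial>M)
      = (if n = 0 then 0 else \<Sum>x\<in>F. \<Sum>y\<in>F. t x * t y * multinomial_cov r x y)"
proof -
  note * = expectation_sum_orthogonal[OF finite_lessThan linear_centred(3)[OF assms] linear_centred(4)[OF assms]]
  show "integrable M (\<lambda>\<omega>. (\<Sum>x\<in>F. t x * fluctuation n \<omega> x)\<^sup>2)"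
    unfolding linear_fluctuation_eq power2_eq_square by (rule *(1))
  have "(\<integral>\<omega>. (\<Sum>x\<in>F. t x * fluctuation n \<omega> x)\<^sup>2 \<partial>M)
      = (\<Sum>x\<in>F. \<Sum>y\<in>F. t x * t y * multinomial_cov r x y) * (\<Sum>k<n. 1 / sqrt (real n) * (1 / sqrt (real n)))"
    unfolding linear_fluctuation_eq power2_eq_square by (rule *(2))
  also have "(\<Sum>k<n. 1 / sqrt (real n) * (1 / sqrt (real n))) = (if n = 0 then 0 else 1)"
    by simp
  finally show "(\<integral>\<omega>. (\<Sum>x\<in>F. t x * fluctuation n \<omega> x)\<^sup>2 \<partial>M)
      = (if n = 0 then 0 else \<Sum>x\<in>F. \<Sum>y\<in>F. t x * t y * multinomial_cov r x y)"
    by (simp split: if_splits)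
qed

lemma multinomial_cov_diag_le: "0 \<le> multinomial_cov r x x" "multinomial_cov r x x \<le> pmf r x"
  using pmf_nonneg[of r x] pmf_le_1[of r x]
  by (auto simp: multinomial_cov_def mult_left_le)

lemma fluctuation_square:
  "integrable M (\<lambda>\<omega>. (fluctuation n \<omega> x)\<^sup>2)" "(\<integral>\<omega>. (fluctuation n \<omega> x)\<^sup>2 \<partial>M) \<le> pmf r x"
  using linear_fluctuation_square[of "{x}" "\<lambda>_. 1" n] multinomial_cov_diag_le[of x] by auto

text \<open>The Cramer-Wold step: a linear form of the fluctuation is a normalised sum of i.i.d.
  real variables whose variance equals that of the same form of \<open>G\<close>.\<close>

lemma fluctuation_char_tendsto:
  assumes F: "finite F" and G: "gaussian_process N G (\<lambda>_. 0) (multinomial_cov r)"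
  shows "(\<lambda>n. \<integral>\<omega>. cis (\<Sum>x\<in>F. t x * fluctuation n \<omega> x) \<partial>M) \<longlonglongrightarrow> (\<integral>\<omega>. cis (\<Sum>x\<in>F. t x * G \<omega> x) \<partial>N)"
proof -
  have [measurable]: "(\<lambda>\<omega>. G \<omega> x) \<in> borel_measurable N" for x
    using G by (simp add: gaussian_process_def)
  define \<sigma> where "\<sigma> = sqrt (\<Sum>x\<in>F. \<Sum>y\<in>F. t x * t y * multinomial_cov r x y)"
  have \<sigma>: "\<sigma> \<ge> 0" "\<sigma>\<^sup>2 = (\<Sum>x\<in>F. \<Sum>y\<in>F. t x * t y * multinomial_cov r x y)"
    using gaussian_process_linear(2)[OF G F, of t] by (auto simp: \<sigma>_def)
  have "(\<integral>\<omega>. cis (\<Sum>x\<in>F. t x * G \<omega> x) \<partial>N) = (\<integral>u. cis u \<partial>distr N borel (\<lambda>\<omega>. \<Sum>x\<in>F. t x * G \<omega> x))"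
    by (rule integral_distr[symmetric]) auto
  also have "\<dots> = char std_normal_distribution \<sigma>"
    using gaussian_process_linear(1)[OF G F, of t] integral_cis_normal_law[OF \<sigma>(1)] by (simp add: \<sigma>_def)
  finally have G_char: "(\<integral>\<omega>. cis (\<Sum>x\<in>F. t x * G \<omega> x) \<partial>N) = char std_normal_distribution \<sigma>" .
  show ?thesis
  proof (cases "\<sigma> = 0")
    \<comment> \<open>The central limit theorem requires positive variance. Here the form vanishes
      almost surely, for instance when \<open>t\<close> is constant on a set \<open>F\<close> of
      full mass.\<close>
    case True
    have "AE \<omega> in M. (\<Sum>x\<in>F. t x * fluctuation n \<omega> x)\<^sup>2 = 0" for n
      using linear_fluctuation_square[OF F, of t n] \<sigma>(2) True
      by (subst integral_nonneg_eq_0_iff_AE[symmetric]) (auto split: if_splits)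
    then have "(\<integral>\<omega>. cis (\<Sum>x\<in>F. t x * fluctuation n \<omega> x) \<partial>M) = (\<integral>\<omega>. 1 \<partial>M)" for n
    proof (intro integral_cong_AE)
      show "AE \<omega> in M. cis (\<Sum>x\<in>F. t x * fluctuation n \<omega> x) = 1"
        using \<open>AE \<omega> in M. (\<Sum>x\<in>F. t x * fluctuation n \<omega> x)\<^sup>2 = 0\<close>
        by eventually_elim simp
    qed auto
    then show ?thesis unfolding G_char using True by (simp add: prob_space char_std_normal_distribution)
  next
    case False
    then have pos: "\<sigma> > 0" using \<sigma> by simp
    let ?w = "\<lambda>k \<omega>. \<Sum>x\<in>F. t x * centred k \<omega> x"
    have w_sq: "integrable M (\<lambda>\<omega>. (?w k \<omega>)\<^sup>2)" "(\<integral>\<omega>. (?w k \<omega>)\<^sup>2 \<partial>M) = \<sigma>\<^sup>2" for k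
      using linear_centred(3,4)[OF F, of t k k] by (auto simp: power2_eq_square \<sigma>(2)[unfolded power2_eq_square])
    have "weak_conv_m (\<lambda>n. distr M borel (\<lambda>\<omega>. (\<Sum>k<n. ?w k \<omega>) / sqrt (real n * \<sigma>\<^sup>2))) std_normal_distribution"
    proof (rule central_limit_theorem_zero_mean[where \<mu> = "distr M borel (?w 0)"])
      show "indep_vars (\<lambda>_. borel) ?w UNIV" by (rule indep_vars_sum_centred)
      show "expectation (?w k) = 0" for k by (rule linear_centred(2)[OF F])
      then show "variance (?w k) = \<sigma>\<^sup>2" for k using w_sq by simp
      show "distr M borel (?w k) = distr M borel (?w 0)" for k
      proof -
        let ?f = "\<lambda>z. \<Sum>x\<in>F. t x * (of_bool (z = x) - pmf r x)"
        have "distr M borel (?w k) = distr (measure_pmf r) borel ?f" for k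
          unfolding distr_X[of "Suc k", symmetric, simplified] centred_def
          by (subst distr_distr) (auto simp: comp_def)
        then show ?thesis by simp
      qed
    qed (use pos w_sq in auto)
    \<comment> \<open>Evaluation at \<open>\<sigma>\<close> cancels the division by the standard
      deviation in the standardised sums.\<close>
    then have "(\<lambda>n. char (distr M borel (\<lambda>\<omega>. (\<Sum>k<n. ?w k \<omega>) / sqrt (real n * \<sigma>\<^sup>2))) \<sigma>)
        \<longlonglongrightarrow> char std_normal_distribution \<sigma>"
      by (intro levy_continuity1 real_dist_normal_dist real_distribution_distr) auto
    moreover have "char (distr M borel (\<lambda>\<omega>. (\<Sum>k<n. ?w k \<omega>) / sqrt (real n * \<sigma>\<^sup>2))) \<sigma>
        = (\<integral>\<omega>. cis (\<Sum>x\<in>F. t x * fluctuation n \<omega> x) \<partial>M)" for n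
    proof -
      have "\<sigma> * ((\<Sum>k<n. ?w k \<omega>) / sqrt (real n * \<sigma>\<^sup>2)) = (\<Sum>x\<in>F. t x * fluctuation n \<omega> x)" for \<omega>
        unfolding linear_fluctuation_eq sum_distrib_left[symmetric] using pos
        by (simp add: real_sqrt_mult)
      then show ?thesis unfolding char_def by (subst integral_distr) (auto simp: cis_conv_exp)
    qed
    ultimately show ?thesis unfolding G_char by simp
  qed
qed

end

section \<open>Convergence in the weighted space\<close>

text \<open>For a finite partial sum \<open>A\<close> of \<open>?w x * s x\<close>, taking
  expectations gives \<open>b * A \<le> K + (b / 4 + prob ?B / b) * A\<close>. The factor on the
  right is at most \<open>b / 2\<close>, so \<open>A \<le> 2 * K / b\<close> for every initial
  segment.\<close>

lemma gaussian_wl1_imp_summable: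
  fixes x0 :: "'a::metric_space"
  assumes c: "countable (UNIV :: 'a set)"
    and G: "gaussian_process N G (\<lambda>_. 0) (multinomial_cov r)"
    and sp: "\<And>\<omega>. \<omega> \<in> space N \<Longrightarrow> G \<omega> \<in> wl1_space p x0"
  shows "(\<lambda>x. wl1_weight p x0 x * sqrt (pmf r x)) summable_on UNIV"
proof -
  interpret prob_space N using G by (simp add: gaussian_process_def)
  have Gm [measurable]: "(\<lambda>\<omega>. G \<omega> x) \<in> borel_measurable N" for x
    using G by (simp add: gaussian_process_def)
  let ?w = "wl1_weight p x0"
  define s where "s x = sqrt (multinomial_cov r x x)" for x
  define b where "b = sqrt (2 / pi)"
  have b: "b > 0" by (simp add: b_def)
  have cov: "multinomial_cov r x x = pmf r x * (1 - pmf r x)" "multinomial_cov r x x \<ge> 0" for x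
    using pmf_le_1[of r x] by (auto simp: multinomial_cov_def)
  have s0: "s x \<ge> 0" and s2: "(s x)\<^sup>2 = multinomial_cov r x x" for x using cov(2)[of x] by (auto simp: s_def)
  note lin = gaussian_process_linear(3-6)[OF G finite.emptyI]
  have sqi: "integrable N (\<lambda>\<omega>. (G \<omega> x)\<^sup>2)" and sq: "(\<integral>\<omega>. (G \<omega> x)\<^sup>2 \<partial>N) = (s x)\<^sup>2"
    and absi: "integrable N (\<lambda>\<omega>. \<bar>G \<omega> x\<bar>)" and ab: "(\<integral>\<omega>. \<bar>G \<omega> x\<bar> \<partial>N) = b * s x" for x
    using lin[of x] s2[of x] by (simp_all add: s_def b_def)
  define T where "T \<omega> = (\<Sum>\<^sub>\<infinity>x. ?w x * \<bar>G \<omega> x\<bar>)" for \<omega>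
  have [measurable]: "T \<in> borel_measurable N"
    unfolding T_def by (rule borel_measurable_infsum(1)[OF c]) auto
  have "(\<lambda>k. prob {\<omega> \<in> space N. T \<omega> > real k}) \<longlonglongrightarrow> prob (\<Inter>k. {\<omega> \<in> space N. T \<omega> > real k})"
    by (rule finite_Lim_measure_decseq) (auto simp: decseq_def)
  also have "(\<Inter>k. {\<omega> \<in> space N. T \<omega> > real k}) = {}"
  proof (intro equals0I)
    fix \<omega> assume *: "\<omega> \<in> (\<Inter>k. {\<omega> \<in> space N. T \<omega> > real k})"
    obtain k :: nat where "T \<omega> < real k" using reals_Archimedean2 by blast
    moreover have "T \<omega> > real k" using * by blast
    ultimately show False by linarith
  qed
  finally have "(\<lambda>k. prob {\<omega> \<in> space N. T \<omega> > real k}) \<longlonglongrightarrow> 0" by simp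
  \<comment> \<open>This threshold makes \<open>prob ?B / b\<close> at most \<open>b / 4\<close>,
    equal to the coefficient of the quadratic term.\<close>
  from order_tendstoD(2)[OF this, of "b\<^sup>2 / 4"] b
  have "\<forall>\<^sub>F k in sequentially. prob {\<omega> \<in> space N. T \<omega> > real k} < b\<^sup>2 / 4" by simp
  from eventually_happens'[OF sequentially_bot this]
  obtain K :: nat where K: "prob {\<omega> \<in> space N. T \<omega> > real K} < b\<^sup>2 / 4" ..
  let ?B = "{\<omega> \<in> space N. T \<omega> > real K}"
  have le: "(\<Sum>x\<in>initial n. ?w x * s x) \<le> 2 * real K / b" for n
  proof -
    \<comment> \<open>Coordinates of variance \<open>0\<close> are left out because the bound
      divides by \<open>s x\<close>; they contribute nothing to the sum.\<close>
    define I where "I = {x \<in> initial n. s x > 0}"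
    have fin: "finite I" "I \<subseteq> initial n" using finite_initial[OF c, of n] by (auto simp: I_def)
    define A where "A = (\<Sum>x\<in>I. ?w x * s x)"
    have A0: "A \<ge> 0" unfolding A_def by (intro sum_nonneg) (simp add: s0)
    have pt: "(\<Sum>x\<in>I. ?w x * \<bar>G \<omega> x\<bar>) \<le> real K
        + (\<Sum>x\<in>I. ?w x * (b / 4 * ((G \<omega> x)\<^sup>2 / s x) + s x / b * indicator ?B \<omega>))"
      if \<omega>: "\<omega> \<in> space N" for \<omega>
    proof (cases "T \<omega> > real K")
      case False
      \<comment> \<open>Membership in the weighted space enters here: without summability
        \<open>T \<omega>\<close> would be \<open>0\<close> by default and bound nothing.\<close>
      have "(\<Sum>x\<in>I. ?w x * \<bar>G \<omega> x\<bar>) \<le> T \<omega>"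
        unfolding T_def using sp[OF \<omega>] fin(1) by (intro finite_sum_le_infsum) (auto simp: wl1_space_iff)
      moreover have "0 \<le> (\<Sum>x\<in>I. ?w x * (b / 4 * ((G \<omega> x)\<^sup>2 / s x) + s x / b * indicator ?B \<omega>))"
        using b s0 by (intro sum_nonneg mult_nonneg_nonneg add_nonneg_nonneg) auto
      ultimately show ?thesis using False by linarith
    next
      case True
      have "\<bar>G \<omega> x\<bar> \<le> b / 4 * ((G \<omega> x)\<^sup>2 / s x) + s x / b * indicator ?B \<omega>" if "x \<in> I" for x
      proof -
        have sx: "s x > 0" using that by (simp add: I_def)
        \<comment> \<open>The weighted inequality of arithmetic and geometric means, a pointwise
          substitute for Cauchy-Schwarz on \<open>?B\<close>; the weights are tuned to
          \<open>b\<close>.\<close>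
        have "0 \<le> (b * \<bar>G \<omega> x\<bar> - 2 * s x)\<^sup>2" by simp
        then have "4 * (b * s x) * \<bar>G \<omega> x\<bar> \<le> b\<^sup>2 * (G \<omega> x)\<^sup>2 + 4 * (s x)\<^sup>2"
          by (simp add: power2_diff power_mult_distrib algebra_simps)
        then have "\<bar>G \<omega> x\<bar> \<le> (b\<^sup>2 * (G \<omega> x)\<^sup>2 + 4 * (s x)\<^sup>2) / (4 * (b * s x))"
          using b sx by (simp add: pos_le_divide_eq algebra_simps)
        also have "\<dots> = b / 4 * ((G \<omega> x)\<^sup>2 / s x) + s x / b"
          using b sx by (simp add: add_divide_distrib power2_eq_square)
        finally show ?thesis using True \<omega> by simp
      qed
      then have "(\<Sum>x\<in>I. ?w x * \<bar>G \<omega> x\<bar>)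
          \<le> (\<Sum>x\<in>I. ?w x * (b / 4 * ((G \<omega> x)\<^sup>2 / s x) + s x / b * indicator ?B \<omega>))"
        by (intro sum_mono mult_left_mono) auto
      then show ?thesis by simp
    qed
    have "b * A = (\<integral>\<omega>. (\<Sum>x\<in>I. ?w x * \<bar>G \<omega> x\<bar>) \<partial>N)"
      using absi ab by (simp add: A_def sum_distrib_left algebra_simps)
    also have "\<dots> \<le> (\<integral>\<omega>. real K
        + (\<Sum>x\<in>I. ?w x * (b / 4 * ((G \<omega> x)\<^sup>2 / s x) + s x / b * indicator ?B \<omega>)) \<partial>N)"
      using absi sqi pt by (intro integral_mono) (auto intro!: integrable_real_indicator simp: emeasure_eq_measure)
    also have "\<dots> = real K
        + (\<Sum>x\<in>I. ?w x * (b / 4 * ((s x)\<^sup>2 / s x) + s x / b * prob ?B))"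
      using sqi sq by (simp add: prob_space emeasure_eq_measure Int_absorb1 Collect_conj_eq)
    also have "(\<Sum>x\<in>I. ?w x * (b / 4 * ((s x)\<^sup>2 / s x) + s x / b * prob ?B))
        = (b / 4 + prob ?B / b) * A"
      unfolding A_def sum_distrib_left
      by (intro sum.cong) (auto simp: I_def power2_eq_square algebra_simps)
    also have "\<dots> \<le> (b / 4 + b / 4) * A"
      using K b A0 by (intro mult_right_mono add_left_mono) (auto simp: field_simps power2_eq_square)
    finally have "A \<le> 2 * real K / b" using b by (simp add: field_simps)
    moreover have "(\<Sum>x\<in>initial n. ?w x * s x) = A"
      unfolding A_def I_def using s0 finite_initial[OF c, of n]
      by (intro sum.mono_neutral_right) (auto simp: not_less order_antisym)
    ultimately show ?thesis by simp
  qed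
  have "(\<lambda>x. ?w x * s x) summable_on UNIV"
    by (rule summable_on_if_sum_initial_le[OF c, of _ _ "2 * real K / b"]) (use le s0 in auto)
  then have sum1: "(\<lambda>x. sqrt 2 * (?w x * s x)) summable_on UNIV" by (rule summable_on_cmult_right)
  \<comment> \<open>If \<open>pmf r x \<le> 1 / 2\<close>, then
    \<open>sqrt (pmf r x) \<le> sqrt 2 * s x\<close>. For heavier atoms \<open>1 - pmf r x\<close>
    may be arbitrarily small, even \<open>0\<close>, but there are only finitely many of
    them.\<close>
  let ?big = "{x. pmf r x > 1 / 2}"
  have "finite ?big"
  proof (rule ccontr)
    assume "infinite ?big"
    then obtain D where D: "D \<subseteq> ?big" "finite D" "card D = 2"
      using infinite_arbitrarily_large by blast
    then have "(\<Sum>x\<in>D. 1 / 2) < (\<Sum>x\<in>D. pmf r x)" by (intro sum_strict_mono) auto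
    also have "\<dots> \<le> 1"
      using measure_pmf.prob_le_1[of r D] D(2) by (simp add: measure_measure_pmf_finite)
    finally show False using D by simp
  qed
  then have sum2: "(\<lambda>x. if x \<in> ?big then ?w x * sqrt (pmf r x) else 0) summable_on UNIV"
    by (rule summable_on_finite_support) auto
  show ?thesis
  proof (rule summable_on_comparison_test[OF summable_on_add[OF sum1 sum2]])
    fix x
    show "?w x * sqrt (pmf r x)
        \<le> sqrt 2 * (?w x * s x) + (if x \<in> ?big then ?w x * sqrt (pmf r x) else 0)"
    proof (cases "x \<in> ?big")
      case True
      then show ?thesis using s0[of x] by simp
    next
      case False
      then have "pmf r x * 1 \<le> pmf r x * (2 * (1 - pmf r x))" by (intro mult_left_mono) auto
      then have "sqrt (pmf r x) \<le> sqrt (2 * multinomial_cov r x x)" by (simp add: cov algebra_simps)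
      then have "?w x * sqrt (pmf r x) \<le> ?w x * (sqrt 2 * s x)"
        by (intro mult_left_mono) (auto simp: s_def real_sqrt_mult)
      then show ?thesis using False by (simp add: mult.left_commute)
    qed
  qed auto
qed

section \<open>A limit with all paths in the weighted space\<close>

text \<open>The first absolute moment of each bridge coordinate is at most
  \<open>sqrt (pmf r x)\<close>, so the weighted norm has finite expectation and almost every path
  of the bridge lies in the space.\<close>

lemma gaussian_process_in_wl1_exists:
  fixes x0 :: "'a::metric_space"
  assumes c: "countable (UNIV :: 'a set)"
    and sum: "(\<lambda>x. wl1_weight p x0 x * sqrt (pmf r x)) summable_on UNIV"
  shows "\<exists>(N :: ('a \<Rightarrow> real) measure) G. gaussian_process N G (\<lambda>_. 0) (multinomial_cov r) \<and>
    (\<forall>\<omega>. G \<omega> \<in> wl1_space p x0)"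
proof -
  interpret prob_space "white_noise :: ('a \<Rightarrow> real) measure" by (rule prob_space_white_noise)
  let ?w = "wl1_weight p x0"
  let ?B = "bridge_process r"
  note B = gaussian_process_bridge[OF c, of r]
  have [measurable]: "(\<lambda>\<omega>. ?B \<omega> x) \<in> borel_measurable white_noise" for x
    using B by (simp add: gaussian_process_def)
  \<comment> \<open>Setting the exceptional paths to \<open>0\<close> is needed because a random
    element takes all its values in the space.\<close>
  define G where "G \<omega> = (if ?B \<omega> \<in> wl1_space p x0 then ?B \<omega> else (\<lambda>_. 0))" for \<omega>
  have pred: "Measurable.pred white_noise (\<lambda>\<omega>. ?B \<omega> \<in> wl1_space p x0)"
    unfolding wl1_space_iff by (rule borel_measurable_infsum(2)[OF c]) auto
  have "(\<lambda>\<omega>. G \<omega> x) \<in> borel_measurable white_noise" for x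
  proof -
    have "(\<lambda>\<omega>. G \<omega> x) = (\<lambda>\<omega>. if ?B \<omega> \<in> wl1_space p x0 then ?B \<omega> x else 0)" by (auto simp: G_def)
    then show ?thesis using pred by simp
  qed
  moreover have "AE \<omega> in white_noise. G \<omega> = ?B \<omega>"
  proof -
    note lin = gaussian_process_linear(3,4)[OF B finite.emptyI]
    have "(\<integral>\<omega>. (?B \<omega> x)\<^sup>2 \<partial>white_noise) \<le> pmf r x" for x
      using lin(2)[of x] pmf_le_1[of r x] by (auto simp: multinomial_cov_def mult_left_le)
    note a = expectation_abs_le_sqrt[OF _ lin(1) this]
    have "AE \<omega> in white_noise. (\<lambda>x. ?w x * \<bar>?B \<omega> x\<bar>) summable_on UNIV"
      by (rule expectation_infsum_le(1)[OF c _ _ _ sum]) (use a in \<open>auto intro: mult_left_mono\<close>)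
    then show ?thesis by eventually_elim (simp add: G_def wl1_space_iff)
  qed
  ultimately have "gaussian_process white_noise G (\<lambda>_. 0) (multinomial_cov r)"
    by (intro gaussian_process_cong_AE[OF B])
  moreover have "G \<omega> \<in> wl1_space p x0" for \<omega>
    by (simp add: G_def finite_support_in_wl1_space[of "{}"])
  ultimately show ?thesis by blast
qed

lemma (in iid_sample) expectation_abs_fluctuation:
  "integrable M (\<lambda>\<omega>. \<bar>fluctuation n \<omega> x\<bar>)" "(\<integral>\<omega>. \<bar>fluctuation n \<omega> x\<bar> \<partial>M) \<le> sqrt (pmf r x)"
  using expectation_abs_le_sqrt[OF measurable_fluctuation fluctuation_square] by auto

section \<open>Uniform tail bounds and sufficiency\<close>

locale wl1_sample = iid_sample M X r
  for M :: "'m measure" and X :: "nat \<Rightarrow> 'm \<Rightarrow> 'a::metric_space" and r +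
  fixes p :: real and x0 :: 'a
  assumes countable_UNIV: "countable (UNIV :: 'a set)"
    and summable_sqrt: "(\<lambda>x. wl1_weight p x0 x * sqrt (pmf r x)) summable_on UNIV"
begin

text \<open>The empirical measure has finite support, and
  \<open>pmf r x \<le> sqrt (pmf r x)\<close> puts \<open>r\<close> itself into the space.\<close>

lemma fluctuation_in_wl1_space: "fluctuation n \<omega> \<in> wl1_space p x0"
proof -
  have "empirical_measure X n \<omega> \<in> wl1_space p x0"
    by (rule finite_support_in_wl1_space[of "(\<lambda>k. X k \<omega>) ` {1..n}"])
       (auto simp: empirical_measure_def intro!: sum.neutral)
  moreover have "pmf r \<in> wl1_space p x0"
    unfolding wl1_space_iff
  proof (rule summable_on_comparison_test[OF summable_sqrt])
    fix x
    have "pmf r x = sqrt (pmf r x) * sqrt (pmf r x)" by simp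
    also have "\<dots> \<le> sqrt (pmf r x) * 1" by (intro mult_left_mono) (auto simp: pmf_le_1)
    finally show "wl1_weight p x0 x * \<bar>pmf r x\<bar> \<le> wl1_weight p x0 x * sqrt (pmf r x)"
      by (intro mult_left_mono) auto
  qed auto
  ultimately have "(\<lambda>x. empirical_measure X n \<omega> x - pmf r x) \<in> wl1_space p x0"
    by (rule wl1_space_diff)
  then have "(\<lambda>x. sqrt (real n) * (wl1_weight p x0 x * \<bar>empirical_measure X n \<omega> x - pmf r x\<bar>)) summable_on UNIV"
    unfolding wl1_space_iff by (rule summable_on_cmult_right)
  then show ?thesis by (simp add: wl1_space_iff fluctuation_def abs_mult ac_simps)
qed

text \<open>The distance to the truncation is the weighted tail, whose expectation is bounded by
  moments. The bound depends on \<open>W\<close> only through \<open>sqrt (pmf r x)\<close>, so it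
  serves all fluctuations and the limit at once.\<close>

lemma expectation_Lipschitz_restrict0:
  fixes g :: "('a \<Rightarrow> real) \<Rightarrow> real" and W :: "'z \<Rightarrow> 'a \<Rightarrow> real"
  assumes Q: "prob_space Q" and F: "finite F"
    and W: "\<And>x. integrable Q (\<lambda>\<omega>. \<bar>W \<omega> x\<bar>)" "\<And>x. (\<integral>\<omega>. \<bar>W \<omega> x\<bar> \<partial>Q) \<le> sqrt (pmf r x)"
      "\<And>\<omega>. \<omega> \<in> space Q \<Longrightarrow> W \<omega> \<in> wl1_space p x0"
    and g: "\<And>a b. a \<in> wl1_space p x0 \<Longrightarrow> b \<in> wl1_space p x0 \<Longrightarrow> \<bar>g a - g b\<bar> \<le> L * wl1_dist p x0 a b"
      "\<And>a. a \<in> wl1_space p x0 \<Longrightarrow> \<bar>g a\<bar> \<le> C" and L: "L \<ge> 0"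
    and m: "(\<lambda>\<omega>. g (W \<omega>)) \<in> borel_measurable Q" "(\<lambda>\<omega>. g (restrict0 F (W \<omega>))) \<in> borel_measurable Q"
  shows "\<bar>(\<integral>\<omega>. g (W \<omega>) \<partial>Q) - (\<integral>\<omega>. g (restrict0 F (W \<omega>)) \<partial>Q)\<bar>
    \<le> L * (\<Sum>\<^sub>\<infinity>x\<in>- F. wl1_weight p x0 x * sqrt (pmf r x))"
proof -
  interpret Q: prob_space Q by fact
  let ?w = "wl1_weight p x0"
  have s: "(\<lambda>x. ?w x * sqrt (pmf r x)) summable_on - F"
    by (rule summable_on_subset_banach[OF summable_sqrt]) simp
  have w_int: "integrable Q (\<lambda>\<omega>. ?w x * \<bar>W \<omega> x\<bar>)"
    and w_le: "(\<integral>\<omega>. ?w x * \<bar>W \<omega> x\<bar> \<partial>Q) \<le> ?w x * sqrt (pmf r x)" for x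
    using W(1,2)[of x] by (auto intro: mult_left_mono)
  have w_nn: "0 \<le> ?w x * \<bar>W \<omega> x\<bar>" for x \<omega> by simp
  note e = expectation_infsum_le(2,3)[OF countable_UNIV w_int w_nn w_le s]
  have i: "integrable Q (\<lambda>\<omega>. g (W \<omega>))" "integrable Q (\<lambda>\<omega>. g (restrict0 F (W \<omega>)))"
    using W(3) g(2) F m by (auto intro!: Q.integrable_const_bound[of _ C])
  have "\<bar>\<integral>\<omega>. g (W \<omega>) - g (restrict0 F (W \<omega>)) \<partial>Q\<bar>
      \<le> (\<integral>\<omega>. L * (\<Sum>\<^sub>\<infinity>x\<in>- F. ?w x * \<bar>W \<omega> x\<bar>) \<partial>Q)"
  proof (rule order_trans[OF integral_abs_bound integral_mono])
    show "integrable Q (\<lambda>\<omega>. L * (\<Sum>\<^sub>\<infinity>x\<in>- F. ?w x * \<bar>W \<omega> x\<bar>))" using e(1) by simp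
    fix \<omega> assume \<omega>: "\<omega> \<in> space Q"
    show "\<bar>g (W \<omega>) - g (restrict0 F (W \<omega>))\<bar> \<le> L * (\<Sum>\<^sub>\<infinity>x\<in>- F. ?w x * \<bar>W \<omega> x\<bar>)"
      using g(1)[OF W(3)[OF \<omega>] restrict0_in_wl1_space[OF F], of "W \<omega>"]
      by (simp add: wl1_dist_restrict0[OF F W(3)[OF \<omega>]])
  qed (use i in simp)
  also have "\<dots> \<le> L * (\<Sum>\<^sub>\<infinity>x\<in>- F. ?w x * sqrt (pmf r x))"
    using e(2) L by (simp add: mult_left_mono)
  finally show ?thesis by (simp only: Bochner_Integration.integral_diff[OF i])
qed

text \<open>For a Lipschitz test function the error splits into three parts: truncation of the
  fluctuation, convergence of the truncated vectors, truncation of the limit. General test functions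
  follow by Lipschitz minorants.\<close>

lemma fluctuation_converges:
  assumes G: "gaussian_process N G (\<lambda>_. 0) (multinomial_cov r)"
    and sp: "\<And>\<omega>. \<omega> \<in> space N \<Longrightarrow> G \<omega> \<in> wl1_space p x0"
  shows "converges_in_distribution (wl1_topology p x0) M fluctuation N G"
proof -
  interpret N: prob_space N using G by (simp add: gaussian_process_def)
  interpret W: Metric_space "wl1_space p x0" "wl1_dist p x0" by (rule Metric_space_wl1)
  have top: "W.mtopology = wl1_topology p x0" by (simp add: wl1_topology_def)
  have Gm [measurable]: "(\<lambda>\<omega>. G \<omega> x) \<in> borel_measurable N" for x
    using G by (simp add: gaussian_process_def)
  note lin = gaussian_process_linear(3,4)[OF G finite.emptyI]
  have G_sq: "(\<integral>\<omega>. (G \<omega> x)\<^sup>2 \<partial>N) \<le> pmf r x" for x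
    using lin(2)[of x] multinomial_cov_diag_le[of x] by simp
  note G_abs = N.expectation_abs_le_sqrt[OF Gm lin(1) G_sq]
  have F_meas: "fluctuation n \<in> M \<rightarrow>\<^sub>M borel_of (wl1_topology p x0)" for n
    by (rule measurable_borel_of_wl1[OF countable_UNIV measurable_fluctuation fluctuation_in_wl1_space])
  have G_meas: "G \<in> N \<rightarrow>\<^sub>M borel_of (wl1_topology p x0)"
    by (rule measurable_borel_of_wl1[OF countable_UNIV Gm sp])
  have Lipschitz: "(\<lambda>n. \<integral>\<omega>. g (fluctuation n \<omega>) \<partial>M) \<longlonglongrightarrow> (\<integral>\<omega>. g (G \<omega>) \<partial>N)"
    if L: "L \<ge> 0" and g: "\<And>a b. a \<in> wl1_space p x0 \<Longrightarrow> b \<in> wl1_space p x0 \<Longrightarrow> \<bar>g a - g b\<bar> \<le> L * wl1_dist p x0 a b"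
      "\<And>a. a \<in> wl1_space p x0 \<Longrightarrow> \<bar>g a\<bar> \<le> C" for g :: "('a \<Rightarrow> real) \<Rightarrow> real" and L C
  proof (rule LIMSEQ_I)
    fix \<epsilon> :: real assume \<epsilon>: "\<epsilon> > 0"
    have g_meas: "g \<in> borel_measurable (borel_of (wl1_topology p x0))"
      using continuous_map_borel_of[OF W.Lipschitz_continuous_map_real[OF g(1) L]] by (simp add: top)
    let ?t = "\<lambda>m. L * (\<Sum>\<^sub>\<infinity>x\<in>- initial m. wl1_weight p x0 x * sqrt (pmf r x))"
    have "?t \<longlonglongrightarrow> L * 0"
      by (intro tendsto_intros infsum_Compl_initial_tendsto countable_UNIV summable_sqrt)
    from order_tendstoD(2)[OF this, of "\<epsilon> / 3"] \<epsilon>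
    have "\<forall>\<^sub>F m in sequentially. ?t m < \<epsilon> / 3" by simp
    \<comment> \<open>The cut \<open>m\<close> is chosen from the tail of the deterministic sum
      alone, hence independently of \<open>n\<close>.\<close>
    from eventually_happens'[OF sequentially_bot this] obtain m where m: "?t m < \<epsilon> / 3" ..
    define F :: "'a set" where "F = initial m"
    have fin: "finite F" unfolding F_def by (rule finite_initial[OF countable_UNIV])
    have res_meas: "(\<lambda>\<omega>. g (restrict0 F (V \<omega>))) \<in> borel_measurable Q"
      if "\<And>x. (\<lambda>\<omega>. V \<omega> x) \<in> borel_measurable Q" for Q :: "'z measure" and V
    proof (rule measurable_compose[OF _ g_meas])
      show "(\<lambda>\<omega>. restrict0 F (V \<omega>)) \<in> Q \<rightarrow>\<^sub>M borel_of (wl1_topology p x0)"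
        by (rule measurable_borel_of_wl1[OF countable_UNIV])
           (use that fin in \<open>auto simp: restrict0_def\<close>)
    qed
    \<comment> \<open>The finite-dimensional setting is entered inside the proof because
      \<open>F\<close> depends on \<open>\<epsilon>\<close>.\<close>
    interpret char_convergence M N fluctuation G F
      by unfold_locales (simp_all add: fin fluctuation_char_tendsto[OF fin G])
    have "(\<lambda>n. \<integral>\<omega>. g (restrict0 F (fluctuation n \<omega>)) \<partial>M) \<longlonglongrightarrow> (\<integral>\<omega>. g (restrict0 F (G \<omega>)) \<partial>N)"
    proof (rule Lipschitz_tendsto[OF countable_UNIV])
      show "0 \<le> L * wl1_weight p x0 x" for x using L by simp
      show "\<bar>g (restrict0 F y) - g (restrict0 F z)\<bar> \<le> (\<Sum>x\<in>F. L * wl1_weight p x0 x * \<bar>y x - z x\<bar>)" for y z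
      proof -
        have "wl1_dist p x0 (restrict0 F y) (restrict0 F z)
            = (\<Sum>x\<in>F. wl1_weight p x0 x * \<bar>restrict0 F y x - restrict0 F z x\<bar>)"
          by (rule wl1_dist_finite_support[OF fin]) (auto simp: restrict0_def)
        also have "\<dots> = (\<Sum>x\<in>F. wl1_weight p x0 x * \<bar>y x - z x\<bar>)"
          by (intro sum.cong) (auto simp: restrict0_def)
        finally show ?thesis
          using g(1)[OF restrict0_in_wl1_space[OF fin] restrict0_in_wl1_space[OF fin], of y z]
          by (simp add: sum_distrib_left mult.assoc)
      qed
      show "\<bar>g (restrict0 F y)\<bar> \<le> C" for y using g(2) fin by simp
    qed (use res_meas fluctuation_square lin(1) G_sq in blast)+
    from LIMSEQ_D[OF this, of "\<epsilon> / 3"] \<epsilon> obtain n0 where n0: "\<And>n. n \<ge> n0 \<Longrightarrow>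
        \<bar>(\<integral>\<omega>. g (restrict0 F (fluctuation n \<omega>)) \<partial>M) - (\<integral>\<omega>. g (restrict0 F (G \<omega>)) \<partial>N)\<bar> < \<epsilon> / 3" by auto
    have t1: "\<bar>(\<integral>\<omega>. g (fluctuation n \<omega>) \<partial>M) - (\<integral>\<omega>. g (restrict0 F (fluctuation n \<omega>)) \<partial>M)\<bar> < \<epsilon> / 3" for n
    proof (rule le_less_trans[OF expectation_Lipschitz_restrict0[where W = "fluctuation n"
          and g = g and C = C and L = L and F = F] m[folded F_def]])
      show "(\<lambda>\<omega>. g (fluctuation n \<omega>)) \<in> borel_measurable M"
        by (rule measurable_compose[OF F_meas g_meas])
      show "(\<lambda>\<omega>. g (restrict0 F (fluctuation n \<omega>))) \<in> borel_measurable M"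
        by (rule res_meas[OF measurable_fluctuation])
    qed (fact prob_space_axioms fin expectation_abs_fluctuation g L | rule fluctuation_in_wl1_space)+
    have t2: "\<bar>(\<integral>\<omega>. g (G \<omega>) \<partial>N) - (\<integral>\<omega>. g (restrict0 F (G \<omega>)) \<partial>N)\<bar> < \<epsilon> / 3"
    proof (rule le_less_trans[OF expectation_Lipschitz_restrict0[where W = G
          and g = g and C = C and L = L and F = F] m[folded F_def]])
      show "(\<lambda>\<omega>. g (G \<omega>)) \<in> borel_measurable N"
        by (rule measurable_compose[OF G_meas g_meas])
      show "(\<lambda>\<omega>. g (restrict0 F (G \<omega>))) \<in> borel_measurable N"
        by (rule res_meas[OF Gm])
    qed (fact N.prob_space_axioms fin G_abs sp g L)+
    show "\<exists>no. \<forall>n\<ge>no. norm ((\<integral>\<omega>. g (fluctuation n \<omega>) \<partial>M) - (\<integral>\<omega>. g (G \<omega>) \<partial>N)) < \<epsilon>"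
    proof (intro exI[of _ n0] allI impI)
      fix n assume "n0 \<le> n"
      from n0[OF this] t1[of n] t2
      show "norm ((\<integral>\<omega>. g (fluctuation n \<omega>) \<partial>M) - (\<integral>\<omega>. g (G \<omega>) \<partial>N)) < \<epsilon>"
        unfolding real_norm_def by linarith
    qed
  qed
  show ?thesis
    unfolding converges_in_distribution_def random_element_def
  proof (intro conjI allI impI)
    fix f :: "('a \<Rightarrow> real) \<Rightarrow> real"
    assume "continuous_map (wl1_topology p x0) euclideanreal f \<and> bounded (f ` topspace (wl1_topology p x0))"
    then have f: "continuous_map W.mtopology euclideanreal f" "bounded (f ` wl1_space p x0)"
      by (simp_all add: top)
    show "(\<lambda>n. \<integral>\<omega>. f (fluctuation n \<omega>) \<partial>M) \<longlonglongrightarrow> (\<integral>\<omega>. f (G \<omega>) \<partial>N)"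
      by (rule W.expectation_tendsto_if_Lipschitz[OF prob_space_axioms N.prob_space_axioms
            F_meas[folded top] G_meas[folded top] _ f]) (rule Lipschitz)
  qed (use F_meas G_meas prob_space_axioms N.prob_space_axioms in auto)
qed

end

theorem lemma2p6:
  fixes p :: real
    and x0 :: "'a::metric_space"
    and r :: "'a pmf"
    and M :: "'m measure"
    and X :: "nat \<Rightarrow> 'm \<Rightarrow> 'a"
  assumes "countable (UNIV :: 'a set)"
    and "p \<ge> 1"
    and "prob_space M"
    and "prob_space.indep_vars M (\<lambda>_. count_space UNIV) X {1..}"
    and "\<And>k. k \<ge> 1 \<Longrightarrow> distr M (count_space UNIV) (X k) = measure_pmf r"
  shows "(\<exists>(N :: ('a \<Rightarrow> real) measure) G.
            gaussian_process N G (\<lambda>_. 0) (multinomial_cov r) \<and>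
            converges_in_distribution (wl1_topology p x0) M
              (\<lambda>n \<omega> x. sqrt (real n) * (empirical_measure X n \<omega> x - pmf r x)) N G)
         \<longleftrightarrow> (\<lambda>x. dist x x0 powr p * sqrt (pmf r x)) summable_on UNIV"
  unfolding wl1_weight_summable_iff[symmetric]
proof
  assume "\<exists>(N :: ('a \<Rightarrow> real) measure) G.
            gaussian_process N G (\<lambda>_. 0) (multinomial_cov r) \<and>
            converges_in_distribution (wl1_topology p x0) M
              (\<lambda>n \<omega> x. sqrt (real n) * (empirical_measure X n \<omega> x - pmf r x)) N G"
  then obtain N :: "('a \<Rightarrow> real) measure" and G
    where G: "gaussian_process N G (\<lambda>_. 0) (multinomial_cov r)"
      and R: "random_element (wl1_topology p x0) N G"
    by (auto simp: converges_in_distribution_def)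
  have "G \<in> N \<rightarrow>\<^sub>M borel_of (wl1_topology p x0)" using R by (simp add: random_element_def)
  from measurable_space[OF this] have "G \<omega> \<in> wl1_space p x0" if "\<omega> \<in> space N" for \<omega>
    using that by simp
  then show "(\<lambda>x. wl1_weight p x0 x * sqrt (pmf r x)) summable_on UNIV"
    by (rule gaussian_wl1_imp_summable[OF assms(1) G])
next
  assume sum: "(\<lambda>x. wl1_weight p x0 x * sqrt (pmf r x)) summable_on UNIV"
  interpret wl1_sample M X r p x0
    using assms sum by (intro wl1_sample.intro iid_sample.intro iid_sample_axioms.intro wl1_sample_axioms.intro)
  obtain N :: "('a \<Rightarrow> real) measure" and G
    where G: "gaussian_process N G (\<lambda>_. 0) (multinomial_cov r)" "\<And>\<omega>. G \<omega> \<in> wl1_space p x0"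
    using gaussian_process_in_wl1_exists[OF assms(1) sum] by blast
  have "converges_in_distribution (wl1_topology p x0) M fluctuation N G"
    using G by (intro fluctuation_converges)
  with G(1) show "\<exists>(N :: ('a \<Rightarrow> real) measure) G.
            gaussian_process N G (\<lambda>_. 0) (multinomial_cov r) \<and>
            converges_in_distribution (wl1_topology p x0) M
              (\<lambda>n \<omega> x. sqrt (real n) * (empirical_measure X n \<omega> x - pmf r x)) N G"
    unfolding fluctuation_def[abs_def] by (intro exI conjI)
qed

end
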